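(* Let $p\in(1,\infty)$, $L>0$, and let $\gamma:[0,L]\to\mathbb{R}^2$ be an arclength parametrized $p$-elastica. Then $\gamma\in W^{3,1}(0,L;\mathbb{R}^2)$. In particular, $\gamma\in C^2([0,L];\mathbb{R}^2)$. In addition, $\gamma$ is analytic on $[0,L]\setminus\partial Z$, where $Z:=\{s\in[0,L]\mid k(s)=0\}$ and $\partial Z$ denotes the relative topological boundary of $Z$ in $[0,L]$.
   Context: Here $k$ is the (counterclockwise) signed curvature of $\gamma$ (taken as its continuous representative in the definition of $Z$). For an immersed curve $\gamma$ of class $W^{2,p}$ on a bounded interval $I$ ($\gamma'\neq0$ on $\overline I$), let $\mathcal{B}_p[\gamma]=\int_\gamma|k|^p\,ds$ ($s$ arclength, $k$ signed curvature) and let $\mathcal{L}[\gamma]$ be the length. The curve $\gamma\in W^{2,p}(I;\mathbb{R}^2)$ is a $p$-elastica if there is $\lambda\in\mathbb{R}$ such that $\frac{d}{d\varepsilon}\big(\mathcal{B}_p[\gamma+\varepsilon\eta]+\lambda\mathcal{L}[\gamma+\varepsilon\eta]\big)\big|_{\varepsilon=0}=0$ for all $\eta\in C^\infty_{\rm c}(I;\mathbb{R}^2)$; for an arclength parametrized $p$-elastica, $I=(0,L)$ and $|\gamma'|\equiv1$. *)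

theory Defs
  imports "HOL-Analysis.Analysis"
begin

section \<open>Smooth functions, test functions, analytic functions of one real variable\<close>

text \<open>At points of the boundary of \<open>S\<close> the derivatives are one-sided, so \<open>Ck_on m {a..b} f\<close>
  says that \<open>f\<close> is of class \<open>C\<^sup>m\<close> up to the boundary.\<close>

fun Ck_on :: "nat \<Rightarrow> real set \<Rightarrow> (real \<Rightarrow> 'a::real_normed_vector) \<Rightarrow> bool" where
  "Ck_on 0 S f \<longleftrightarrow> continuous_on S f"
| "Ck_on (Suc m) S f \<longleftrightarrow>
     (\<exists>f'. (\<forall>x\<in>S. (f has_vector_derivative f' x) (at x within S)) \<and> Ck_on m S f')"

text \<open>\<open>C\<^sub>c\<^sup>\<infinity>(a,b)\<close>, extended by zero to the whole line.\<close>

definition test_function :: "real \<Rightarrow> real \<Rightarrow> (real \<Rightarrow> 'a::real_normed_vector) \<Rightarrow> bool" where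
  "test_function a b \<phi> \<longleftrightarrow>
     (\<forall>m. Ck_on m UNIV \<phi>) \<and>
     compact (closure {x. \<phi> x \<noteq> 0}) \<and> closure {x. \<phi> x \<noteq> 0} \<subseteq> {a<..<b}"

text \<open>Meant for sets \<open>S\<close> that are relatively open in a nondegenerate interval. At an endpoint of
  that interval belonging to \<open>S\<close> this is analyticity up to the boundary.\<close>

definition real_analytic_on :: "(real \<Rightarrow> 'a::real_normed_vector) \<Rightarrow> real set \<Rightarrow> bool" where
  "real_analytic_on f S \<longleftrightarrow>
     (\<forall>x0\<in>S. \<exists>r>0. \<exists>c :: nat \<Rightarrow> 'a. \<forall>x\<in>S. \<bar>x - x0\<bar> < r \<longrightarrow>
        (\<lambda>n. (x - x0) ^ n *\<^sub>R c n) sums f x)"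


section \<open>Sobolev spaces on a bounded open interval\<close>

definition locally_integrable :: "real \<Rightarrow> real \<Rightarrow> (real \<Rightarrow> 'a::euclidean_space) \<Rightarrow> bool" where
  "locally_integrable a b f \<longleftrightarrow>
     (\<forall>K. compact K \<and> K \<subseteq> {a<..<b} \<longrightarrow> set_integrable lebesgue K f)"

text \<open>\<open>g\<close> is a weak derivative of \<open>f\<close> of order \<open>m\<close> on \<open>(a,b)\<close>.\<close>

definition has_weak_derivative ::
    "real \<Rightarrow> real \<Rightarrow> nat \<Rightarrow> (real \<Rightarrow> 'a::euclidean_space) \<Rightarrow> (real \<Rightarrow> 'a) \<Rightarrow> bool" where
  "has_weak_derivative a b m f g \<longleftrightarrow>
     locally_integrable a b f \<and> locally_integrable a b g \<and>
     (\<forall>\<phi> :: real \<Rightarrow> real. test_function a b \<phi> \<longrightarrow>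
        (LINT x|lebesgue_on {a<..<b}. (deriv ^^ m) \<phi> x *\<^sub>R f x) =
        (-1) ^ m *\<^sub>R (LINT x|lebesgue_on {a<..<b}. \<phi> x *\<^sub>R g x))"

text \<open>Weak derivatives are unique almost everywhere; \<open>weak_deriv\<close> picks some representative, so
  only its values up to null sets are meaningful.\<close>

definition weak_deriv ::
    "real \<Rightarrow> real \<Rightarrow> nat \<Rightarrow> (real \<Rightarrow> 'a::euclidean_space) \<Rightarrow> real \<Rightarrow> 'a" where
  "weak_deriv a b m f = (SOME g. has_weak_derivative a b m f g)"

definition Lp_fun :: "real \<Rightarrow> real \<Rightarrow> real \<Rightarrow> (real \<Rightarrow> 'a::euclidean_space) \<Rightarrow> bool" where
  "Lp_fun a b p f \<longleftrightarrow>
     f \<in> borel_measurable (lebesgue_on {a<..<b}) \<and>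
     integrable (lebesgue_on {a<..<b}) (\<lambda>x. norm (f x) powr p)"

text \<open>\<open>f \<in> W\<^sup>m\<^sup>,\<^sup>p(a,b)\<close>.\<close>

definition sobolev ::
    "real \<Rightarrow> real \<Rightarrow> nat \<Rightarrow> real \<Rightarrow> (real \<Rightarrow> 'a::euclidean_space) \<Rightarrow> bool" where
  "sobolev a b m p f \<longleftrightarrow>
     Lp_fun a b p f \<and> (\<forall>i\<le>m. \<exists>g. has_weak_derivative a b i f g \<and> Lp_fun a b p g)"

definition continuous_representative ::
    "real \<Rightarrow> real \<Rightarrow> (real \<Rightarrow> 'a::euclidean_space) \<Rightarrow> (real \<Rightarrow> 'a) \<Rightarrow> bool" where
  "continuous_representative a b f g \<longleftrightarrow>
     continuous_on {a..b} g \<and> (AE x in lebesgue_on {a<..<b}. g x = f x)"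


section \<open>Planar curves and \<open>p\<close>-elasticae\<close>

text \<open>Signed curvature, counterclockwise positive, for an arbitrary regular parametrization; for a
  \<open>W\<^sup>2\<^sup>,\<^sup>p\<close> curve it is defined almost everywhere only.\<close>

definition signed_curvature :: "real \<Rightarrow> real \<Rightarrow> (real \<Rightarrow> real^2) \<Rightarrow> real \<Rightarrow> real" where
  "signed_curvature a b \<gamma> x =
     (let T = weak_deriv a b 1 \<gamma> x; A = weak_deriv a b 2 \<gamma> x
      in (T $ 1 * A $ 2 - T $ 2 * A $ 1) / norm T ^ 3)"

definition bending_energy :: "real \<Rightarrow> real \<Rightarrow> real \<Rightarrow> (real \<Rightarrow> real^2) \<Rightarrow> real" where
  "bending_energy p a b \<gamma> =
     (LINT x|lebesgue_on {a<..<b}.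
        \<bar>signed_curvature a b \<gamma> x\<bar> powr p * norm (weak_deriv a b 1 \<gamma> x))"

definition curve_length :: "real \<Rightarrow> real \<Rightarrow> (real \<Rightarrow> real^2) \<Rightarrow> real" where
  "curve_length a b \<gamma> = (LINT x|lebesgue_on {a<..<b}. norm (weak_deriv a b 1 \<gamma> x))"

text \<open>A \<open>W\<^sup>2\<^sup>,\<^sup>p\<close> curve is identified with its continuous representative on \<open>[a,b]\<close>. That
  representative is automatically \<open>C\<^sup>1\<close> up to the boundary, so the classical (at the endpoints,
  one-sided) derivative below is well defined and is the continuous representative of the
  weak derivative.\<close>

definition immersed_W2p :: "real \<Rightarrow> real \<Rightarrow> real \<Rightarrow> (real \<Rightarrow> real^2) \<Rightarrow> bool" where
  "immersed_W2p p a b \<gamma> \<longleftrightarrow>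
     continuous_on {a..b} \<gamma> \<and> sobolev a b 2 p \<gamma> \<and>
     (\<forall>x\<in>{a..b}. vector_derivative \<gamma> (at x within {a..b}) \<noteq> 0)"

definition p_elastica :: "real \<Rightarrow> real \<Rightarrow> real \<Rightarrow> (real \<Rightarrow> real^2) \<Rightarrow> bool" where
  "p_elastica p a b \<gamma> \<longleftrightarrow>
     immersed_W2p p a b \<gamma> \<and>
     (\<exists>l :: real. \<forall>\<eta> :: real \<Rightarrow> real^2. test_function a b \<eta> \<longrightarrow>
        ((\<lambda>\<epsilon>. bending_energy p a b (\<lambda>x. \<gamma> x + \<epsilon> *\<^sub>R \<eta> x)
              + l * curve_length a b (\<lambda>x. \<gamma> x + \<epsilon> *\<^sub>R \<eta> x))
         has_real_derivative 0) (at 0))"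

definition arclength_p_elastica :: "real \<Rightarrow> real \<Rightarrow> (real \<Rightarrow> real^2) \<Rightarrow> bool" where
  "arclength_p_elastica p L \<gamma> \<longleftrightarrow>
     p_elastica p 0 L \<gamma> \<and>
     (\<forall>s\<in>{0..L}. norm (vector_derivative \<gamma> (at s within {0..L})) = 1)"

end

theory Submission
  imports Defs "HOL-Complex_Analysis.Complex_Analysis"
begin

text \<open>Write \<open>T = \<gamma>'\<close>, let \<open>N\<close> be \<open>T\<close> rotated by a right angle, and put
  \<open>w = sgn k * \<bar>k\<bar> powr (p - 1)\<close>. The first variation reads
  \<open>\<integral> p w N \<bullet> \<eta>'' + ((1 - 2 p) \<bar>k\<bar> powr p + l) T \<bullet> \<eta>' = 0\<close>, so by du Bois-Reymond
  \<open>p w N\<close> is absolutely continuous with derivative \<open>((1 - 2 p) \<bar>k\<bar> powr p + l) T + C\<close> for a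
  constant vector \<open>C\<close>. Hence \<open>w\<close>, and with it \<open>k\<close>, is continuous, and taking normal and
  tangential components gives \<open>p w' = C \<bullet> N\<close> and \<open>(p - 1) \<bar>k\<bar> powr p = l + C \<bullet> T\<close>.

  Integrability of \<open>k'\<close> is local. Near a zero of \<open>k\<close> the function \<open>C \<bullet> N\<close> vanishes only where
  \<open>k\<close> does, because \<open>(C \<bullet> N)\<^sup>2 + (C \<bullet> T)\<^sup>2 = \<bar>C\<bar>\<^sup>2\<close>; a maximum argument for \<open>C \<bullet> T\<close> then shows
  that the zeros of \<open>k\<close> form an interval, off which \<open>k\<close> is monotone.

  Where \<open>k \<noteq> 0\<close>, the second identity turns \<open>T' = \<i> k T\<close> into an autonomous equation with
  holomorphic right-hand side in the complex variable \<open>T\<close>; inverting a holomorphic primitive of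
  the reciprocal of that right-hand side makes \<open>T\<close> analytic. In the interior of the zero set of
  \<open>k\<close> the curve is a line segment.\<close>

section \<open>Test functions\<close>

text \<open>The obstacle is the zero set of \<open>k\<close>. The first variation makes
  \<open>w\<close> of class C^1, but \<open>k\<close> is \<open>w\<close> raised to the signed power
  \<open>1 / (p - 1)\<close>, which is not differentiable at 0 when \<open>p > 2\<close>. The
  candidate \<open>k' = \<bar>k\<bar> powr (2 - p) * (C \<bullet> N) / (p * (p - 1))\<close> may
  then be unbounded near zeros of \<open>k\<close>, and no chain rule bounds its integral.
  Monotonicity takes the place of the chain rule: a derivative of one sign that has a gauge integral
  is absolutely integrable. This gives the exponent 1 in W^{3,1}. A second difficulty is the choice
  of representatives. The energies contain weak derivatives known only up to null sets, whereas
  maximum arguments and power series need values at points. The relation \<open>AC_on\<close>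
  mediates: the function is fixed everywhere, and only its derivative may be changed on a null
  set.\<close>

lemma Ck_on_Suc_imp: "Ck_on (Suc m) S f \<Longrightarrow> Ck_on m S f"
proof (induction m arbitrary: f)
  case 0
  then show ?case
    by (auto simp: continuous_on_eq_continuous_within intro: has_vector_derivative_continuous)
next
  case (Suc m)
  from Suc.prems obtain f' where "\<forall>x\<in>S. (f has_vector_derivative f' x) (at x within S)"
    "Ck_on (Suc m) S f'" by (auto simp only: Ck_on.simps)
  with Suc.IH[of f'] show ?case by auto
qed

lemma Ck_on_cong: "(\<And>x. x \<in> S \<Longrightarrow> f x = g x) \<Longrightarrow> Ck_on m S f \<longleftrightarrow> Ck_on m S g"
proof (cases m)
  case 0
  assume "\<And>x. x \<in> S \<Longrightarrow> f x = g x"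
  then show ?thesis using 0 by (simp cong: continuous_on_cong)
next
  case (Suc n)
  assume *: "\<And>x. x \<in> S \<Longrightarrow> f x = g x"
  have "(f has_vector_derivative D) (at x within S) \<longleftrightarrow> (g has_vector_derivative D) (at x within S)"
    if "x \<in> S" for x D
    using that * by (intro has_vector_derivative_cong_ev) (auto simp: eventually_at_filter)
  then show ?thesis using Suc by auto
qed

lemma Ck_on_const: "Ck_on m S (\<lambda>x. c)"
proof (induction m arbitrary: c)
  case (Suc m)
  have "\<forall>x\<in>S. ((\<lambda>x. c) has_vector_derivative 0) (at x within S)" by simp
  with Suc[of 0] show ?case by (metis Ck_on.simps(2))
qed simp

lemma Ck_on_add: "Ck_on m S f \<Longrightarrow> Ck_on m S g \<Longrightarrow> Ck_on m S (\<lambda>x. f x + g x)"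
proof (induction m arbitrary: f g)
  case (Suc m)
  then obtain f' g' where *: "\<forall>x\<in>S. (f has_vector_derivative f' x) (at x within S)" "Ck_on m S f'"
    "\<forall>x\<in>S. (g has_vector_derivative g' x) (at x within S)" "Ck_on m S g'" by auto
  have "\<forall>x\<in>S. ((\<lambda>x. f x + g x) has_vector_derivative (f' x + g' x)) (at x within S)"
    using * by (auto intro!: derivative_eq_intros)
  with Suc.IH[OF *(2,4)] show ?case by auto
qed (auto intro: continuous_intros)

lemma Ck_on_scaleR:
  fixes f :: "real \<Rightarrow> real"
  shows "Ck_on m S f \<Longrightarrow> Ck_on m S g \<Longrightarrow> Ck_on m S (\<lambda>x. f x *\<^sub>R g x)"
proof (induction m arbitrary: f g)
  case (Suc m)
  then obtain f' g' where *: "\<forall>x\<in>S. (f has_vector_derivative f' x) (at x within S)" "Ck_on m S f'"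
    "\<forall>x\<in>S. (g has_vector_derivative g' x) (at x within S)" "Ck_on m S g'" by auto
  have "\<forall>x\<in>S. ((\<lambda>x. f x *\<^sub>R g x) has_vector_derivative (f x *\<^sub>R g' x + f' x *\<^sub>R g x)) (at x within S)"
    using * by (auto intro!: has_vector_derivative_scaleR simp: has_real_derivative_iff_has_vector_derivative)
  moreover have "Ck_on m S (\<lambda>x. f x *\<^sub>R g' x + f' x *\<^sub>R g x)"
    using Suc.IH *(2,4) Suc.prems[THEN Ck_on_Suc_imp] by (intro Ck_on_add) auto
  ultimately show ?case by auto
qed (auto intro: continuous_intros)

lemma Ck_on_compose_affine:
  assumes "Ck_on m UNIV f" shows "Ck_on m UNIV (\<lambda>x. f (r * x + s))"
  using assms
proof (induction m arbitrary: f)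
  case 0
  then have "continuous_on UNIV (f \<circ> (\<lambda>x. r * x + s))"
    by (intro continuous_on_compose continuous_intros) (auto intro: continuous_on_subset)
  then show ?case by (simp add: o_def)
next
  case (Suc m)
  then obtain f' where *: "\<And>x. (f has_vector_derivative f' x) (at x)" "Ck_on m UNIV f'" by auto
  have "((f \<circ> (\<lambda>x. r * x + s)) has_vector_derivative (r *\<^sub>R f' (r * x + s))) (at x)" for x
    by (intro vector_diff_chain_at) (auto intro!: derivative_eq_intros * simp: has_real_derivative_iff_has_vector_derivative[symmetric])
  moreover have "Ck_on m UNIV (\<lambda>x. r *\<^sub>R f' (r * x + s))"
    by (intro Ck_on_scaleR Ck_on_const Suc.IH *)
  ultimately show ?case unfolding o_def Ck_on.simps
    by (intro exI[of _ "\<lambda>x. r *\<^sub>R f' (r * x + s)"]) simp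
qed

lemma Ck_on_deriv:
  fixes f :: "real \<Rightarrow> real"
  assumes "Ck_on (Suc m) UNIV f"
  shows "(f has_real_derivative deriv f x) (at x)" "Ck_on m UNIV (deriv f)"
proof -
  obtain f' where *: "\<And>x. (f has_vector_derivative f' x) (at x)" "Ck_on m UNIV f'" using assms by auto
  then have "deriv f = f'"
    by (auto intro!: ext DERIV_imp_deriv simp: has_real_derivative_iff_has_vector_derivative)
  with * show "(f has_real_derivative deriv f x) (at x)" "Ck_on m UNIV (deriv f)"
    by (auto simp: has_real_derivative_iff_has_vector_derivative)
qed

lemma test_function_compactE:
  assumes "test_function a b \<phi>"
  obtains c d where "a < c" "c < d" "d < b" "\<And>x. x \<notin> {c..d} \<Longrightarrow> \<phi> x = 0" | "\<phi> = (\<lambda>x. 0)"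
proof (cases "{x. \<phi> x \<noteq> 0} = {}")
  case True
  then show ?thesis using that(2) by auto
next
  case False
  let ?K = "closure {x. \<phi> x \<noteq> 0}"
  have K: "compact ?K" "?K \<noteq> {}" "?K \<subseteq> {a<..<b}" using assms False by (auto simp: test_function_def)
  obtain l where l: "l \<in> ?K" "\<And>x. x \<in> ?K \<Longrightarrow> l \<le> x" using compact_attains_inf[OF K(1,2)] by auto
  obtain u where u: "u \<in> ?K" "\<And>x. x \<in> ?K \<Longrightarrow> x \<le> u" using compact_attains_sup[OF K(1,2)] by auto
  have "a < l" "u < b" "l \<le> u" using l u K by auto
  \<comment> \<open>The right end is moved from \<open>u\<close> to the midpoint of \<open>u\<close>
    and \<open>b\<close>, so that \<open>c < d\<close> follows from \<open>l \<le> u\<close>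
    alone.\<close>
  show ?thesis
  proof (rule that(1)[of "l" "(u+b)/2"])
    show "\<phi> x = 0" if "x \<notin> {l..(u+b)/2}" for x
    proof (rule ccontr)
      assume "\<phi> x \<noteq> 0"
      then have "x \<in> ?K" by (intro subsetD[OF closure_subset]) simp
      then show False using that l(2) u(2) \<open>u < b\<close> by fastforce
    qed
  qed (use \<open>a < l\<close> \<open>u < b\<close> \<open>l \<le> u\<close> in \<open>auto simp: field_simps\<close>)
qed

lemma test_functionI:
  assumes "\<And>m. Ck_on m UNIV \<phi>" "a < c" "d < b" "\<And>x. x \<notin> {c..d} \<Longrightarrow> \<phi> x = 0"
  shows "test_function a b \<phi>"
proof -
  have "closure {x. \<phi> x \<noteq> 0} \<subseteq> {c..d}" using assms(4) by (intro closure_minimal) blast+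
  moreover then have "compact (closure {x. \<phi> x \<noteq> 0})"
    by (meson bounded_closed_interval bounded_subset closed_closure compact_eq_bounded_closed)
  ultimately show ?thesis using assms unfolding test_function_def by force
qed

lemma test_function_zero_outside:
  assumes "test_function a b \<phi>" "x \<notin> {a<..<b}" shows "\<phi> x = 0"
  using assms subsetD[OF closure_subset, of x "{x. \<phi> x \<noteq> 0}"] unfolding test_function_def by blast

lemma test_function_Ck: "test_function a b \<phi> \<Longrightarrow> Ck_on m UNIV \<phi>"
  by (simp add: test_function_def)

lemma test_function_continuous: "test_function a b \<phi> \<Longrightarrow> continuous_on S \<phi>"
  using test_function_Ck[of a b \<phi> 0] by (auto intro: continuous_on_subset)

lemma test_function_scaleR:
  assumes "test_function a b \<phi>" shows "test_function a b (\<lambda>x. \<phi> x *\<^sub>R (e :: 'a::real_normed_vector))"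
  using assms
proof (rule test_function_compactE)
  fix c d assume "a < c" "c < d" "d < b" "\<And>x. x \<notin> {c..d} \<Longrightarrow> \<phi> x = 0"
  then show ?thesis
    using test_function_Ck[OF assms] by (intro test_functionI[of _ a c d b] Ck_on_scaleR Ck_on_const) auto
qed (auto simp: test_function_def Ck_on_const)

lemma test_function_has_derivative:
  fixes \<phi> :: "real \<Rightarrow> real"
  assumes "test_function a b \<phi>" shows "(\<phi> has_real_derivative deriv \<phi> x) (at x)"
  using Ck_on_deriv(1)[OF test_function_Ck[OF assms]] .

lemma test_function_deriv:
  fixes \<phi> :: "real \<Rightarrow> real"
  assumes "test_function a b \<phi>" shows "test_function a b (deriv \<phi>)"
proof -
  have C: "Ck_on m UNIV (deriv \<phi>)" for m using Ck_on_deriv(2)[OF test_function_Ck[OF assms]] .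
  have "{x. deriv \<phi> x \<noteq> 0} \<subseteq> closure {x. \<phi> x \<noteq> 0}"
  proof (rule ccontr)
    assume "\<not> ?thesis"
    then obtain x where x: "deriv \<phi> x \<noteq> 0" "x \<in> - closure {x. \<phi> x \<noteq> 0}" by auto
    have "(\<phi> has_real_derivative 0) (at x)"
    proof (rule has_field_derivative_transform_within_open[of "\<lambda>_. 0"])
      show "\<And>y. y \<in> - closure {x. \<phi> x \<noteq> 0} \<Longrightarrow> 0 = \<phi> y"
        using subsetD[OF closure_subset, of _ "{x. \<phi> x \<noteq> 0}"] by force
    qed (use x in auto)
    with x show False using test_function_has_derivative[OF assms] DERIV_unique by blast
  qed
  then have S: "closure {x. deriv \<phi> x \<noteq> 0} \<subseteq> closure {x. \<phi> x \<noteq> 0}" by (simp add: closure_minimal)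
  then have "compact (closure {x. deriv \<phi> x \<noteq> 0})"
    using assms closed_Int_compact[OF closed_closure, of "closure {x. \<phi> x \<noteq> 0}" "{x. deriv \<phi> x \<noteq> 0}"]
    unfolding test_function_def by (simp add: inf.absorb1)
  with S C assms show ?thesis unfolding test_function_def by blast
qed

lemma test_function_deriv_iter:
  fixes \<phi> :: "real \<Rightarrow> real"
  assumes "test_function a b \<phi>" shows "test_function a b ((deriv ^^ m) \<phi>)"
  by (induction m) (auto simp: assms test_function_deriv)

lemma test_function_diff_cmult:
  fixes \<phi> \<psi> :: "real \<Rightarrow> real"
  assumes "test_function a b \<phi>" "test_function a b \<psi>"
  shows "test_function a b (\<lambda>x. \<phi> x - r * \<psi> x)"
proof -
  have "Ck_on m UNIV (\<lambda>x. \<phi> x + (- r) *\<^sub>R \<psi> x)" for m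
    using assms by (intro Ck_on_add Ck_on_scaleR[of _ _ "\<lambda>_. - r"] Ck_on_const test_function_Ck)
  moreover have sub: "closure {x. \<phi> x - r * \<psi> x \<noteq> 0} \<subseteq> closure {x. \<phi> x \<noteq> 0} \<union> closure {x. \<psi> x \<noteq> 0}"
    unfolding closure_Un[symmetric] by (rule closure_mono) auto
  moreover have "compact (closure {x. \<phi> x - r * \<psi> x \<noteq> 0})"
  proof -
    have "compact (closure {x. \<phi> x \<noteq> 0} \<union> closure {x. \<psi> x \<noteq> 0})"
      using assms unfolding test_function_def by (intro compact_Un) auto
    from closed_Int_compact[OF closed_closure this, of "{x. \<phi> x - r * \<psi> x \<noteq> 0}"] sub
    show ?thesis by (simp only: inf.absorb1)
  qed
  moreover have "closure {x. \<phi> x - r * \<psi> x \<noteq> 0} \<subseteq> {a<..<b}"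
    by (rule order_trans[OF sub]) (use assms in \<open>simp add: test_function_def\<close>)
  ultimately show ?thesis by (simp add: test_function_def)
qed

text \<open>A primitive started to the left of the support is constant to its right, and that
  constant is the total integral. Mean zero is what keeps the support of the primitive
  compact.\<close>

lemma test_function_antiderivative:
  fixes \<phi> :: "real \<Rightarrow> real"
  assumes "test_function a b \<phi>" "integral {a..b} \<phi> = 0"
  obtains \<psi> where "test_function a b \<psi>" "deriv \<psi> = \<phi>"
  using assms(1)
proof (rule test_function_compactE)
  fix c d assume cd: "a < c" "c < d" "d < b" "\<And>x. x \<notin> {c..d} \<Longrightarrow> \<phi> x = 0"
  define \<psi> where "\<psi> x = (if x < c then 0 else integral {c..x} \<phi>)" for x
  have cont: "continuous_on A \<phi>" for A by (rule test_function_continuous[OF assms(1)])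
  have int: "\<phi> integrable_on {u..v}" for u v by (rule integrable_continuous_real[OF cont])
  \<comment> \<open>The free base point \<open>y\<close> lets the fundamental theorem be applied
    around any \<open>x\<close>, also to the left of \<open>c\<close>.\<close>
  have alt: "\<psi> x = integral {y..x} \<phi>" if "y \<le> c" "y \<le> x" for x y
  proof (cases "x < c")
    case True
    have "integral {y..x} \<phi> = integral {y..x} (\<lambda>x. 0)"
      by (rule Henstock_Kurzweil_Integration.integral_cong) (use True cd(4) in auto)
    then show ?thesis using True by (simp add: \<psi>_def)
  next
    case False
    have "integral {y..c} \<phi> = integral {y..c} (\<lambda>x. 0)"
      by (rule integral_spike[of "{c}"]) (use cd(4) in auto)
    then have "integral {y..x} \<phi> = integral {c..x} \<phi>"
      using Henstock_Kurzweil_Integration.integral_combine[of y c x \<phi>] that False int by simp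
    then show ?thesis using False by (simp add: \<psi>_def)
  qed
  have D: "(\<psi> has_vector_derivative \<phi> x) (at x)" for x
  proof -
    define y where "y = min c x - 1"
    have "((\<lambda>u. integral {y..u} \<phi>) has_vector_derivative \<phi> x) (at x within {y..x+1})"
      by (rule integral_has_vector_derivative[OF cont]) (auto simp: y_def)
    then have "((\<lambda>u. integral {y..u} \<phi>) has_vector_derivative \<phi> x) (at x)"
      by (simp add: at_within_Icc_at y_def)
    then show ?thesis
      by (rule has_vector_derivative_transform_within_open[of _ _ _ "{y<..}"])
        (auto simp: y_def intro!: alt[symmetric])
  qed
  then have "deriv \<psi> = \<phi>"
    by (auto intro!: ext DERIV_imp_deriv simp: has_real_derivative_iff_has_vector_derivative)
  moreover have "test_function a b \<psi>"
  proof (rule test_functionI[OF _ cd(1,3)])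
    show "Ck_on m UNIV \<psi>" for m
    proof (rule Ck_on_Suc_imp)
      show "Ck_on (Suc m) UNIV \<psi>" using D test_function_Ck[OF assms(1)] by auto
    qed
    fix x assume "x \<notin> {c..d}"
    then consider "x < c" | "x > d" by fastforce
    then show "\<psi> x = 0"
    proof cases
      case 2
      have "\<psi> b = 0" using assms(2) alt[of a b] cd by simp
      moreover have "\<psi> b = \<psi> d + integral {d..b} \<phi>"
        using Henstock_Kurzweil_Integration.integral_combine[of a d b \<phi>] cd alt[of a b] alt[of a d] int
        by simp
      moreover have "\<psi> x = \<psi> d + integral {d..x} \<phi>"
        using Henstock_Kurzweil_Integration.integral_combine[of a d x \<phi>] cd alt[of a x] alt[of a d] int 2
        by simp
      moreover have "integral {d..y} \<phi> = integral {d..y} (\<lambda>x. 0)" for y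
        by (rule integral_spike[of "{d}"]) (use cd(4) in auto)
      ultimately show ?thesis by simp
    qed (auto simp: \<psi>_def)
  qed
  ultimately show ?thesis using that by blast
next
  assume "\<phi> = (\<lambda>x. 0)"
  then show ?thesis using that[of "\<lambda>x. 0"] assms(1) by auto
qed

section \<open>Smooth cut-off functions\<close>

lemma poly_times_exp_minus_at_top: "((\<lambda>y::real. poly P y * exp (- y)) \<longlongrightarrow> 0) at_top"
proof -
  have "((\<lambda>y::real. \<Sum>i\<le>degree P. coeff P i * (y ^ i / exp y)) \<longlongrightarrow> (\<Sum>i\<le>degree P. coeff P i * 0)) at_top"
    by (intro tendsto_intros tendsto_power_div_exp_0)
  then show ?thesis
    by (simp add: poly_altdef sum_distrib_right exp_minus divide_inverse mult.assoc)
qed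

text \<open>This family, with \<open>P\<close> ranging over all polynomials, is closed under differentiation; that is
  why \<open>exp (- (1 / x))\<close> extended by zero is smooth.\<close>

definition flat_fun :: "real poly \<Rightarrow> real \<Rightarrow> real" where
  "flat_fun P x = (if x \<le> 0 then 0 else poly P (1 / x) * exp (- (1 / x)))"

lemma flat_fun_tendsto_0: "(flat_fun P \<longlongrightarrow> 0) (at_right 0)"
proof -
  have "((\<lambda>x. poly P (inverse x) * exp (- inverse x)) \<longlongrightarrow> 0) (at_right 0)"
    by (rule filterlim_compose[OF poly_times_exp_minus_at_top filterlim_inverse_at_top_right])
  then show ?thesis
    by (rule Lim_transform_eventually)
      (auto simp: eventually_at_right_field flat_fun_def divide_inverse intro!: exI[of _ 1])
qed

text \<open>With \<open>y = 1 / x\<close> one has \<open>d/dx = - y\<^sup>2 d/dy\<close>, and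
  \<open>P(y) exp (- y)\<close> differentiates in \<open>y\<close> to
  \<open>(P' - P)(y) exp (- y)\<close>; hence the polynomial
  \<open>[:0, 0, 1:] * (P - pderiv P)\<close>.\<close>

lemma flat_fun_derivative:
  "(flat_fun P has_real_derivative flat_fun ([:0, 0, 1:] * (P - pderiv P)) x) (at x)"
proof -
  consider "x < 0" | "x > 0" | "x = 0" by linarith
  then show ?thesis
  proof cases
    case 1
    have "(flat_fun P has_real_derivative 0) (at x)"
      by (rule has_field_derivative_transform_within_open[of "\<lambda>_. 0" _ _ "{..<0}"])
        (use 1 in \<open>auto simp: flat_fun_def\<close>)
    with 1 show ?thesis by (simp add: flat_fun_def)
  next
    case 2
    let ?D = "flat_fun ([:0, 0, 1:] * (P - pderiv P)) x"
    have "((\<lambda>x. poly P (1 / x) * exp (- (1 / x))) has_real_derivative ?D) (at x)"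
      using 2 by (auto intro!: derivative_eq_intros DERIV_chain'[of "\<lambda>x. 1/x" _ _ _ "poly P"]
            poly_DERIV simp: flat_fun_def power2_eq_square field_simps)
    then show ?thesis
      by (rule has_field_derivative_transform_within_open[of _ _ _ "{0<..}"])
        (use 2 in \<open>auto simp: flat_fun_def\<close>)
  next
    case 3
    \<comment> \<open>The difference quotient at 0 belongs to the family again: dividing by
      \<open>y\<close> multiplies \<open>P\<close> by the variable.\<close>
    have "((\<lambda>y. flat_fun P y / y) \<longlongrightarrow> 0) (at_right 0)"
    proof (rule Lim_transform_eventually[OF flat_fun_tendsto_0[of "[:0,1:] * P"]])
      show "\<forall>\<^sub>F x in at_right 0. flat_fun ([:0, 1:] * P) x = flat_fun P x / x"
        by (auto simp: eventually_at_right_field flat_fun_def intro!: exI[of _ 1])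
    qed
    moreover have "((\<lambda>y. flat_fun P y / y) \<longlongrightarrow> 0) (at_left 0)"
      by (rule Lim_transform_eventually[of "\<lambda>_. 0"])
        (auto simp: eventually_at_left_field flat_fun_def intro!: exI[of _ "-1"])
    ultimately have "((\<lambda>y. flat_fun P y / y) \<longlongrightarrow> 0) (at 0)"
      by (simp add: filterlim_at_split)
    with 3 show ?thesis by (simp add: has_field_derivative_iff flat_fun_def)
  qed
qed

lemma Ck_on_flat_fun: "Ck_on m UNIV (flat_fun P)"
proof (induction m arbitrary: P)
  case 0
  show ?case
    by (auto intro!: DERIV_isCont flat_fun_derivative simp: continuous_on_eq_continuous_at)
next
  case (Suc m)
  then show ?case using flat_fun_derivative[of P] has_real_derivative_iff_has_vector_derivative by (metis Ck_on.simps(2))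
qed

text \<open>The profile \<open>exp (- (1 / x))\<close> tends to 1 at infinity, so stretching by
  \<open>Suc n\<close> makes the product of two one-sided cut-offs converge to the indicator of
  \<open>{c<..<d}\<close>. The values stay in [0, 1] and the support in a fixed interval, as
  dominated convergence asks.\<close>

definition bump :: "real \<Rightarrow> real \<Rightarrow> nat \<Rightarrow> real \<Rightarrow> real" where
  "bump c d n x = flat_fun 1 (real (Suc n) * (x - c)) * flat_fun 1 (real (Suc n) * (d - x))"

lemma test_function_bump:
  assumes "a < c" "d < b" shows "test_function a b (bump c d n)"
proof (rule test_functionI)
  let ?n = "real (Suc n)"
  have "Ck_on m UNIV (\<lambda>x. flat_fun 1 (?n * x + (- ?n * c)) *\<^sub>R flat_fun 1 ((- ?n) * x + ?n * d))" for m
    by (intro Ck_on_scaleR Ck_on_compose_affine Ck_on_flat_fun)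
  then show "Ck_on m UNIV (bump c d n)" for m
    by (rule Ck_on_cong[THEN iffD1, rotated]) (simp add: bump_def algebra_simps)
  fix x assume "x \<notin> {c..d}"
  then consider "x - c < 0" | "d - x < 0" by force
  then show "bump c d n x = 0"
    by cases (auto simp: bump_def flat_fun_def mult_le_0_iff)
qed (use assms in auto)

lemma bump_nonneg: "0 \<le> bump c d n x" and bump_le_1: "bump c d n x \<le> 1"
proof -
  have "0 \<le> flat_fun 1 y" "flat_fun 1 y \<le> 1" for y by (auto simp: flat_fun_def)
  then show "0 \<le> bump c d n x" "bump c d n x \<le> 1" unfolding bump_def by (simp_all add: mult_le_one)
qed

lemma bump_eq_0: "x \<notin> {c<..<d} \<Longrightarrow> bump c d n x = 0"
  by (auto simp: bump_def flat_fun_def mult_le_0_iff)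

lemma bump_pos: "x \<in> {c<..<d} \<Longrightarrow> 0 < bump c d n x"
  by (auto simp: bump_def flat_fun_def mult_le_0_iff intro!: mult_pos_pos)

lemma bump_tendsto: "(\<lambda>n. bump c d n x) \<longlonglongrightarrow> (if x \<in> {c<..<d} then 1 else 0)"
proof (cases "x \<in> {c<..<d}")
  case True
  have "(\<lambda>n. exp (- (1 / (real (Suc n) * r)))) \<longlonglongrightarrow> 1" if "r > 0" for r
  proof -
    have "(\<lambda>n. exp (- (inverse (real (Suc n)) * inverse r))) \<longlonglongrightarrow> exp (- (0 * inverse r))"
      by (intro tendsto_intros LIMSEQ_inverse_real_of_nat)
    then show ?thesis by (simp add: field_simps)
  qed
  from tendsto_mult[OF this this, of "x - c" "d - x"] True show ?thesis
    by (simp add: bump_def flat_fun_def mult_le_0_iff)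
next
  case False
  show ?thesis unfolding if_not_P[OF False] bump_eq_0[OF False] by (rule tendsto_const)
qed

section \<open>Weak derivatives\<close>

text \<open>Null sets enter the definitions through measure theory, whereas the spike rules of the
  gauge integral take negligible sets; later arguments pass back and forth through this
  equivalence.\<close>

lemma AE_lebesgue_on_iff_negligible:
  assumes "S \<in> sets lebesgue"
  shows "(AE x in lebesgue_on S. P x) \<longleftrightarrow> (\<exists>N. negligible N \<and> (\<forall>x\<in>S - N. P x))"
proof -
  have "{x. \<not> (x \<in> S \<longrightarrow> P x)} \<subseteq> N \<longleftrightarrow> (\<forall>x\<in>S - N. P x)" for N by blast
  moreover have "(AE x in lebesgue_on S. P x) \<longleftrightarrow> (AE x in lebesgue. x \<in> S \<longrightarrow> P x)"
    using assms by (intro AE_restrict_space_iff) simp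
  ultimately show ?thesis
    by (simp only: eventually_ae_filter negligible_iff_null_sets Bex_def space_completion space_lborel UNIV_I simp_thms)
      simp
qed

lemma AE_lebesgue_on_IooI:
  assumes "negligible N" "\<And>x. x \<in> {a<..<b::real} - N \<Longrightarrow> P x"
  shows "AE x in lebesgue_on {a<..<b}. P x"
proof -
  have S: "{a<..<b} \<in> sets lebesgue" by simp
  show ?thesis by (rule AE_lebesgue_on_iff_negligible[OF S, THEN iffD2]) (use assms in blast)
qed

lemma AE_lebesgue_on_IooE:
  assumes "AE x in lebesgue_on {a<..<b::real}. P x"
  obtains N where "negligible N" "\<And>x. x \<in> {a<..<b} - N \<Longrightarrow> P x"
proof -
  have "{a<..<b} \<in> sets lebesgue" by simp
  from AE_lebesgue_on_iff_negligible[OF this, THEN iffD1, OF assms] that show ?thesis by blast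
qed

lemma locally_integrable_Icc:
  assumes "locally_integrable a b f" "a < c" "d < b"
  shows "f absolutely_integrable_on {c..d}"
proof -
  have "{c..d} \<subseteq> {a<..<b}" using assms(2,3) by auto
  then show ?thesis using assms(1) unfolding locally_integrable_def by blast
qed

lemma absolutely_integrable_continuous_scaleR:
  fixes f :: "real \<Rightarrow> 'a::euclidean_space"
  assumes "continuous_on {c..d} \<phi>" "f absolutely_integrable_on {c..d}"
  shows "(\<lambda>x. \<phi> x *\<^sub>R f x) absolutely_integrable_on {c..d}"
proof -
  have "bilinear (\<lambda>r (v::'a). r *\<^sub>R v)"
    unfolding bilinear_conv_bounded_bilinear by (rule bounded_bilinear_scaleR)
  moreover have "\<phi> \<in> borel_measurable (lebesgue_on {c..d})"
    using assms(1) by (rule continuous_imp_measurable_on_sets_lebesgue) auto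
  moreover have "bounded (\<phi> ` {c..d})"
    using assms(1) by (intro compact_imp_bounded compact_continuous_image) auto
  ultimately show ?thesis
    using absolutely_integrable_bounded_measurable_product[of _ \<phi> "{c..d}" f] assms(2) by simp
qed

text \<open>Integrability of \<open>f\<close> may fail near \<open>a\<close> and \<open>b\<close>;
  the test function restores it by cutting down to a compact subinterval. The second part lets later
  computations use the gauge integral over the closed interval.\<close>

lemma test_function_times:
  fixes f :: "real \<Rightarrow> 'a::euclidean_space" and \<phi> :: "real \<Rightarrow> real"
  assumes f: "locally_integrable a b f" and \<phi>: "test_function a b \<phi>"
  shows "(\<lambda>x. \<phi> x *\<^sub>R f x) absolutely_integrable_on {a..b}"
    and "(LINT x|lebesgue_on {a<..<b}. \<phi> x *\<^sub>R f x) = integral {a..b} (\<lambda>x. \<phi> x *\<^sub>R f x)"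
proof -
  show 1: "(\<lambda>x. \<phi> x *\<^sub>R f x) absolutely_integrable_on {a..b}"
  proof (cases rule: test_function_compactE[OF \<phi>])
    case cd: (1 c d)
    have "(\<lambda>x. \<phi> x *\<^sub>R f x) absolutely_integrable_on {c..d}"
      by (rule absolutely_integrable_continuous_scaleR[OF test_function_continuous[OF \<phi>] locally_integrable_Icc[OF f cd(1,3)]])
    moreover have "(\<lambda>x. indicator {c..d} x *\<^sub>R (\<phi> x *\<^sub>R f x)) = (\<lambda>x. indicator {a..b} x *\<^sub>R (\<phi> x *\<^sub>R f x))"
    proof
      fix x show "indicator {c..d} x *\<^sub>R (\<phi> x *\<^sub>R f x) = indicator {a..b} x *\<^sub>R (\<phi> x *\<^sub>R f x)"
        using cd by (cases "x \<in> {c..d}") auto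
    qed
    ultimately show ?thesis by (simp only: set_integrable_def)
  next
    case 2
    then show ?thesis by (simp add: set_integrable_def)
  qed
  then have "(\<lambda>x. \<phi> x *\<^sub>R f x) absolutely_integrable_on {a<..<b}"
    by (simp only: absolutely_integrable_on_Icc_iff_Ioo)
  then have "integrable (lebesgue_on {a<..<b}) (\<lambda>x. \<phi> x *\<^sub>R f x)"
    by (simp add: set_integrable_def integrable_restrict_space)
  then show "(LINT x|lebesgue_on {a<..<b}. \<phi> x *\<^sub>R f x) = integral {a..b} (\<lambda>x. \<phi> x *\<^sub>R f x)"
    by (simp add: lebesgue_integral_eq_integral integral_open_interval_real)
qed

lemma has_weak_derivative_iff:
  fixes f :: "real \<Rightarrow> 'a::euclidean_space"
  shows "has_weak_derivative a b m f g \<longleftrightarrow> locally_integrable a b f \<and> locally_integrable a b g \<and>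
    (\<forall>\<phi>::real \<Rightarrow> real. test_function a b \<phi> \<longrightarrow> integral {a..b} (\<lambda>x. (deriv ^^ m) \<phi> x *\<^sub>R f x) =
        (-1) ^ m *\<^sub>R integral {a..b} (\<lambda>x. \<phi> x *\<^sub>R g x))"
proof -
  have "(LINT x|lebesgue_on {a<..<b}. (deriv ^^ m) \<phi> x *\<^sub>R f x) = integral {a..b} (\<lambda>x. (deriv ^^ m) \<phi> x *\<^sub>R f x)"
    "(LINT x|lebesgue_on {a<..<b}. \<phi> x *\<^sub>R g x) = integral {a..b} (\<lambda>x. \<phi> x *\<^sub>R g x)"
    if "locally_integrable a b f" "locally_integrable a b g" "test_function a b \<phi>" for \<phi>
    using that by (auto intro!: test_function_times test_function_deriv_iter)
  then show ?thesis unfolding has_weak_derivative_def by (auto cong: conj_cong)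
qed

section \<open>The fundamental lemma and du Bois-Reymond's lemma\<close>

lemma locally_integrable_diff:
  fixes f :: "real \<Rightarrow> 'a::euclidean_space"
  assumes "locally_integrable a b f" "locally_integrable a b g"
  shows "locally_integrable a b (\<lambda>x. f x - g x)"
  using assms by (auto simp: locally_integrable_def intro: set_integral_diff)

lemma absolutely_integrable_imp_locally:
  fixes f :: "real \<Rightarrow> 'a::euclidean_space"
  assumes "f absolutely_integrable_on {a..b}" shows "locally_integrable a b f"
  unfolding locally_integrable_def
  by (auto intro!: set_integrable_subset[OF assms] dest: compact_imp_closed subsetD)

text \<open>Testing with \<open>bump\<close> and passing to the limit gives integral zero over every
  compact subinterval; the Lebesgue differentiation theorem then recovers \<open>f x\<close> as a
  limit of such averages.\<close>

lemma fundamental_lemma_variations: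
  fixes f :: "real \<Rightarrow> 'a::euclidean_space"
  assumes f: "locally_integrable a b f"
    and z: "\<And>\<phi>::real \<Rightarrow> real. test_function a b \<phi> \<Longrightarrow> integral {a..b} (\<lambda>x. \<phi> x *\<^sub>R f x) = 0"
  shows "AE x in lebesgue_on {a<..<b}. f x = 0"
proof -
  have int: "f absolutely_integrable_on {c..d}" if "a < c" "d < b" for c d
    using locally_integrable_Icc[OF f that] .
  have zero: "integral {c..d} f = 0" if cd: "a < c" "d < b" for c d
  proof -
    let ?g = "\<lambda>x. (if x \<in> {c<..<d} then 1 else 0) *\<^sub>R f x"
    have "(\<lambda>n. integral {c..d} (\<lambda>x. bump c d n x *\<^sub>R f x)) \<longlonglongrightarrow> integral {c..d} ?g"
    proof (rule dominated_convergence(2))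
      show "(\<lambda>x. bump c d n x *\<^sub>R f x) integrable_on {c..d}" for n
        using absolutely_integrable_on_subinterval[OF test_function_times(1)[OF f test_function_bump[OF cd]], of c d n] cd
        by (auto intro: set_lebesgue_integral_eq_integral(1))
      show "(\<lambda>x. norm (f x)) integrable_on {c..d}" using int[OF cd] by (simp add: absolutely_integrable_on_def)
      show "norm (bump c d n x *\<^sub>R f x) \<le> norm (f x)" for n x
        using bump_nonneg[of c d n x] bump_le_1[of c d n x] by (auto intro: mult_left_le_one_le)
      show "(\<lambda>n. bump c d n x *\<^sub>R f x) \<longlonglongrightarrow> ?g x" for x
        by (intro tendsto_intros bump_tendsto)
    qed
    moreover have "integral {c..d} (\<lambda>x. bump c d n x *\<^sub>R f x) = 0" for n
    proof -
      have "integral {c..d} (\<lambda>x. bump c d n x *\<^sub>R f x) = integral {a..b} (\<lambda>x. bump c d n x *\<^sub>R f x)"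
      proof (rule integral_spike_set)
        have 1: "{x \<in> {c..d} - {a..b}. bump c d n x *\<^sub>R f x \<noteq> 0} = {}" using cd by auto
        show "negligible {x \<in> {c..d} - {a..b}. bump c d n x *\<^sub>R f x \<noteq> 0}" unfolding 1 by simp
        have 2: "{x \<in> {a..b} - {c..d}. bump c d n x *\<^sub>R f x \<noteq> 0} = {}"
          unfolding Collect_empty_eq by (metis Diff_iff scaleR_zero_left bump_eq_0 greaterThanLessThan_subseteq_atLeastAtMost_iff order_refl subsetD)
        show "negligible {x \<in> {a..b} - {c..d}. bump c d n x *\<^sub>R f x \<noteq> 0}" unfolding 2 by simp
      qed
      then show ?thesis using z[OF test_function_bump[OF cd]] by simp
    qed
    moreover have "integral {c..d} ?g = integral {c..d} f"
      by (rule integral_spike[of "{c,d}"]) auto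
    ultimately show ?thesis by (simp add: LIMSEQ_const_iff)
  qed
  \<comment> \<open>The differentiation theorem asks for integrability on every box, which
    \<open>f\<close> has only away from the end points; hence countably many truncations
    \<open>F n\<close>, whose exceptional sets are united.\<close>
  define F where "F n x = (if x \<in> {a + 1 / real (Suc n)..b - 1 / real (Suc n)} then f x else 0)" for n x
  have "\<exists>N. negligible N \<and> (\<forall>x e. x \<notin> N \<longrightarrow> 0 < e \<longrightarrow>
      (\<exists>d>0. \<forall>h. 0 < h \<and> h < d \<longrightarrow> norm (integral {x..x+h} (F n) /\<^sub>R h - F n x) < e))" for n
  proof -
    have "F n integrable_on UNIV"
      unfolding F_def integrable_restrict_UNIV
      using int[of "a + 1 / real (Suc n)" "b - 1 / real (Suc n)"] by (auto intro: set_lebesgue_integral_eq_integral(1))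
    then have "F n integrable_on cbox c d" for c d by (rule integrable_on_subcbox) auto
    then show ?thesis by (rule integrable_ccontinuous_explicit[of "F n"]) (auto 4 4)
  qed
  then obtain N where N: "\<And>n. negligible (N n)" "\<And>n x e. x \<notin> N n \<Longrightarrow> 0 < e \<Longrightarrow>
      (\<exists>d>0. \<forall>h. 0 < h \<and> h < d \<longrightarrow> norm (integral {x..x+h} (F n) /\<^sub>R h - F n x) < e)" by metis
  have fx: "f x = 0" if "x \<in> {a<..<b} - (\<Union>n. N n)" for x
  proof -
    have ax: "a < x" "x < b" using that by auto
    obtain n where n: "inverse (real (Suc n)) < min (x - a) (b - x)"
      using reals_Archimedean[of "min (x - a) (b - x)"] ax by auto
    then have n': "a + 1 / real (Suc n) < x" "x < b - 1 / real (Suc n)" by (auto simp: inverse_eq_divide)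
    have "norm (f x) < e" if e: "e > 0" for e
    proof -
      obtain d where d: "d > 0" "\<And>h. 0 < h \<Longrightarrow> h < d \<Longrightarrow> norm (integral {x..x+h} (F n) /\<^sub>R h - F n x) < e"
        using N(2)[of x n e] e \<open>x \<in> _\<close> by auto
      define q where "q = b - 1 / real (Suc n) - x"
      define h where "h = min d q / 2"
      have "q > 0" using n' unfolding q_def by linarith
      then have h: "0 < h" "h < d" "h \<le> q" using d(1) by (auto simp: h_def min_def)
      then have xh: "x + h \<le> b - 1 / real (Suc n)" unfolding q_def by linarith
      have "integral {x..x+h} (F n) = integral {x..x+h} f"
        by (rule Henstock_Kurzweil_Integration.integral_cong) (use n' h xh in \<open>auto simp: F_def\<close>)
      also have "\<dots> = 0"
      proof (rule zero)
        have "1 / real (Suc n) > 0" by simp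
        then show "a < x" "x + h < b" using ax h xh by linarith+
      qed
      finally show ?thesis using d(2)[OF h(1,2)] n' by (simp add: F_def)
    qed
    then show ?thesis by (metis norm_eq_zero less_irrefl zero_less_norm_iff)
  qed
  have "negligible (\<Union>n. N n)" using N(1) by (intro negligible_countable_Union) auto
  then show ?thesis using fx by (rule AE_lebesgue_on_IooI)
qed

lemma AE_eq_if_test_integrals_eq:
  fixes f g :: "real \<Rightarrow> 'a::euclidean_space"
  assumes f: "locally_integrable a b f" and g: "locally_integrable a b g"
    and eq: "\<And>\<phi>::real \<Rightarrow> real. test_function a b \<phi> \<Longrightarrow>
      integral {a..b} (\<lambda>x. \<phi> x *\<^sub>R f x) = integral {a..b} (\<lambda>x. \<phi> x *\<^sub>R g x)"
  shows "AE x in lebesgue_on {a<..<b}. f x = g x"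
proof -
  have "AE x in lebesgue_on {a<..<b}. f x - g x = 0"
  proof (rule fundamental_lemma_variations[OF locally_integrable_diff[OF f g]])
    fix \<phi> :: "real \<Rightarrow> real" assume \<phi>: "test_function a b \<phi>"
    note * = test_function_times(1)[OF f \<phi>, THEN set_lebesgue_integral_eq_integral(1)]
      test_function_times(1)[OF g \<phi>, THEN set_lebesgue_integral_eq_integral(1)]
    then show "integral {a..b} (\<lambda>x. \<phi> x *\<^sub>R (f x - g x)) = 0"
      using eq[OF \<phi>] Henstock_Kurzweil_Integration.integral_diff[OF *] by (simp add: scaleR_diff_right)
  qed
  then show ?thesis by simp
qed

lemma has_weak_derivative_unique:
  assumes "has_weak_derivative a b m f g" "has_weak_derivative a b m f h"
  shows "AE x in lebesgue_on {a<..<b}. g x = h x"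
proof (rule AE_eq_if_test_integrals_eq)
  fix \<phi> :: "real \<Rightarrow> real" assume \<phi>: "test_function a b \<phi>"
  have "integral {a..b} (\<lambda>x. (deriv ^^ m) \<phi> x *\<^sub>R f x) = (-1) ^ m *\<^sub>R integral {a..b} (\<lambda>x. \<phi> x *\<^sub>R g x)"
    using assms(1) \<phi> unfolding has_weak_derivative_iff by blast
  moreover have "integral {a..b} (\<lambda>x. (deriv ^^ m) \<phi> x *\<^sub>R f x) = (-1) ^ m *\<^sub>R integral {a..b} (\<lambda>x. \<phi> x *\<^sub>R h x)"
    using assms(2) \<phi> unfolding has_weak_derivative_iff by blast
  ultimately show "integral {a..b} (\<lambda>x. \<phi> x *\<^sub>R g x) = integral {a..b} (\<lambda>x. \<phi> x *\<^sub>R h x)" by simp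
qed (use assms in \<open>simp_all add: has_weak_derivative_def\<close>)

text \<open>Makes the chosen representative computable: under an integral, any explicit weak
  derivative may replace \<open>weak_deriv\<close>.\<close>

lemma weak_deriv_AE_eq:
  assumes "has_weak_derivative a b m f g"
  shows "AE x in lebesgue_on {a<..<b}. weak_deriv a b m f x = g x"
proof (rule has_weak_derivative_unique)
  show "has_weak_derivative a b m f (weak_deriv a b m f)"
    unfolding weak_deriv_def using assms by (rule someI[of "has_weak_derivative a b m f"])
qed fact

text \<open>A test function is the derivative of a test function exactly when its integral vanishes;
  subtracting its mass times one fixed \<open>\<rho>\<close> is a projection onto these
  functions.\<close>

lemma test_function_unit_mass:
  assumes ab: "a < b"
  obtains \<rho> :: "real \<Rightarrow> real" where "test_function a b \<rho>"
    "\<And>\<phi>::real \<Rightarrow> real. test_function a b \<phi> \<Longrightarrow>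
      \<exists>\<psi>. test_function a b \<psi> \<and> deriv \<psi> = (\<lambda>x. \<phi> x - integral {a..b} \<phi> * \<rho> x)"
proof -
  define u v where "u = a + (b - a) / 3" and "v = b - (b - a) / 3"
  have uv: "a < u" "u < v" "v < b" using ab by (auto simp: u_def v_def field_simps)
  have tb: "test_function a b (bump u v 0)" by (rule test_function_bump) (use uv in auto)
  have int: "\<phi> integrable_on {a..b}" if "test_function a b \<phi>" for \<phi> :: "real \<Rightarrow> real"
    using that by (intro integrable_continuous_real test_function_continuous)
  define J where "J = integral {a..b} (bump u v 0)"
  have J0: "J \<noteq> 0"
  proof
    assume "J = 0"
    then have "\<forall>x\<in>{a..b}. bump u v 0 x = 0"
      unfolding J_def by (subst (asm) integral_eq_0_iff) (use ab in \<open>auto intro: test_function_continuous[OF tb] bump_nonneg\<close>)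
    moreover have "(u + v) / 2 \<in> {u<..<v}" "(u + v) / 2 \<in> {a..b}" using uv by auto
    ultimately show False using bump_pos[of "(u+v)/2" u v 0] by fastforce
  qed
  define \<rho> where "\<rho> x = bump u v 0 x / J" for x
  \<comment> \<open>\<open>bump / J\<close> is read as
    \<open>(bump - 1 * bump) - (- (1 / J)) * bump\<close>, so that closure under differences
    applies.\<close>
  have t\<rho>: "test_function a b \<rho>"
    using test_function_diff_cmult[OF test_function_diff_cmult[OF tb tb, of 1] tb, of "- (1 / J)"]
    by (simp add: \<rho>_def[abs_def])
  have i\<rho>: "integral {a..b} \<rho> = 1"
    using J0 unfolding \<rho>_def[abs_def] by (simp add: J_def)
  have "\<exists>\<psi>. test_function a b \<psi> \<and> deriv \<psi> = (\<lambda>x. \<phi> x - integral {a..b} \<phi> * \<rho> x)"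
    if \<phi>: "test_function a b \<phi>" for \<phi> :: "real \<Rightarrow> real"
  proof -
    let ?r = "integral {a..b} \<phi>"
    have "test_function a b (\<lambda>x. \<phi> x - ?r * \<rho> x)" by (rule test_function_diff_cmult[OF \<phi> t\<rho>])
    moreover have "integral {a..b} (\<lambda>x. \<phi> x - ?r * \<rho> x) = 0"
      using int[OF \<phi>] int[OF t\<rho>] i\<rho>
      by (subst Henstock_Kurzweil_Integration.integral_diff) (auto intro: integrable_on_mult_right)
    ultimately show ?thesis by (rule test_function_antiderivative) blast
  qed
  with t\<rho> show ?thesis by (rule that)
qed

lemma integral_test_diff_scaleR:
  fixes f :: "real \<Rightarrow> 'a::euclidean_space" and \<phi> \<rho> :: "real \<Rightarrow> real"
  assumes f: "locally_integrable a b f" and \<phi>: "test_function a b \<phi>" and \<rho>: "test_function a b \<rho>"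
  shows "integral {a..b} (\<lambda>x. (\<phi> x - r * \<rho> x) *\<^sub>R f x) =
    integral {a..b} (\<lambda>x. \<phi> x *\<^sub>R f x) - r *\<^sub>R integral {a..b} (\<lambda>x. \<rho> x *\<^sub>R f x)"
proof -
  have i: "(\<lambda>x. \<phi> x *\<^sub>R f x) integrable_on {a..b}" "(\<lambda>x. \<rho> x *\<^sub>R f x) integrable_on {a..b}"
    using test_function_times(1)[OF f \<phi>] test_function_times(1)[OF f \<rho>]
    by (auto intro: set_lebesgue_integral_eq_integral(1))
  from integral_unique[OF has_integral_diff[OF integrable_integral[OF i(1)] has_integral_cmul[OF integrable_integral[OF i(2)], of r]]]
  show ?thesis by (simp only: scaleR_diff_left scaleR_scaleR)
qed

text \<open>For arbitrary \<open>\<phi>\<close> the hypothesis applies to the primitive of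
  \<open>\<phi>\<close> minus its mass times \<open>\<rho>\<close>. Hence \<open>f\<close> pairs
  with \<open>\<phi>\<close> as its \<open>\<rho>\<close>-average, a constant, does.\<close>

lemma du_Bois_Reymond:
  fixes f :: "real \<Rightarrow> 'a::euclidean_space"
  assumes ab: "a < b" and f: "locally_integrable a b f"
    and z: "\<And>\<phi>::real \<Rightarrow> real. test_function a b \<phi> \<Longrightarrow> integral {a..b} (\<lambda>x. deriv \<phi> x *\<^sub>R f x) = 0"
  obtains c where "AE x in lebesgue_on {a<..<b}. f x = c"
proof -
  obtain \<rho> :: "real \<Rightarrow> real" where \<rho>: "test_function a b \<rho>"
    "\<And>\<phi>::real \<Rightarrow> real. test_function a b \<phi> \<Longrightarrow>
      \<exists>\<psi>. test_function a b \<psi> \<and> deriv \<psi> = (\<lambda>x. \<phi> x - integral {a..b} \<phi> * \<rho> x)"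
    using test_function_unit_mass[OF ab] by blast
  define c where "c = integral {a..b} (\<lambda>x. \<rho> x *\<^sub>R f x)"
  have cl: "locally_integrable a b (\<lambda>x. c)"
    by (rule absolutely_integrable_imp_locally) (simp add: absolutely_integrable_continuous_real)
  have "AE x in lebesgue_on {a<..<b}. f x = c"
  proof (rule AE_eq_if_test_integrals_eq[OF f cl])
    fix \<phi> :: "real \<Rightarrow> real" assume \<phi>: "test_function a b \<phi>"
    then obtain \<psi> where \<psi>: "test_function a b \<psi>" "deriv \<psi> = (\<lambda>x. \<phi> x - integral {a..b} \<phi> * \<rho> x)"
      using \<rho>(2) by blast
    have int: "\<phi> integrable_on {a..b}" 
      using \<phi> by (intro integrable_continuous_real test_function_continuous)
    have "integral {a..b} (\<lambda>x. \<phi> x *\<^sub>R f x) = integral {a..b} \<phi> *\<^sub>R c"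
      using z[OF \<psi>(1)] unfolding \<psi>(2) integral_test_diff_scaleR[OF f \<phi> \<rho>(1)] c_def by simp
    also have "\<dots> = integral {a..b} (\<lambda>x. \<phi> x *\<^sub>R c)"
      using has_integral_scaleR_left[OF integrable_integral[OF int], of c] by (simp add: integral_unique)
    finally show "integral {a..b} (\<lambda>x. \<phi> x *\<^sub>R f x) = integral {a..b} (\<lambda>x. \<phi> x *\<^sub>R c)" .
  qed
  then show ?thesis by (rule that)
qed

section \<open>Absolutely continuous functions\<close>

text \<open>\<open>f\<close> is absolutely continuous on \<open>[a,b]\<close> with derivative \<open>g\<close> almost everywhere.\<close>

definition AC_on :: "real \<Rightarrow> real \<Rightarrow> (real \<Rightarrow> 'a::euclidean_space) \<Rightarrow> (real \<Rightarrow> 'a) \<Rightarrow> bool" where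
  "AC_on a b f g \<longleftrightarrow> g absolutely_integrable_on {a..b} \<and> (\<forall>x\<in>{a..b}. f x = f a + integral {a..x} g)"

lemma AC_on_has_integral:
  assumes "AC_on a b f g" "a \<le> s" "s \<le> t" "t \<le> b"
  shows "(g has_integral f t - f s) {s..t}"
proof -
  have i: "g integrable_on {u..v}" if "a \<le> u" "v \<le> b" for u v
  proof -
    have "g integrable_on {a..b}"
      using assms(1) unfolding AC_on_def by (intro set_lebesgue_integral_eq_integral(1)) blast
    then show ?thesis by (rule integrable_on_subinterval) (use that in auto)
  qed
  have "f s = f a + integral {a..s} g" "f t = f a + integral {a..t} g"
    using assms unfolding AC_on_def by (meson atLeastAtMost_iff order_trans)+
  moreover have "integral {a..s} g + integral {s..t} g = integral {a..t} g"
    using assms i by (intro Henstock_Kurzweil_Integration.integral_combine) auto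
  ultimately have "f t - f s = integral {s..t} g" by (simp add: algebra_simps)
  then show ?thesis using integrable_integral[OF i[OF assms(2,4)]] by simp
qed

lemma AC_on_absolutely_integrable: "AC_on a b f g \<Longrightarrow> g absolutely_integrable_on {a..b}"
  by (simp add: AC_on_def)

lemma AC_onI:
  assumes "g absolutely_integrable_on {a..b}" "\<And>x. a \<le> x \<Longrightarrow> x \<le> b \<Longrightarrow> (g has_integral f x - f a) {a..x}"
  shows "AC_on a b f g"
proof -
  have "f x = f a + integral {a..x} g" if "x \<in> {a..b}" for x
    using integral_unique[OF assms(2)[of x]] that by simp
  with assms(1) show ?thesis unfolding AC_on_def by blast
qed

lemma AC_on_integral:
  assumes "g absolutely_integrable_on {a..b}" shows "AC_on a b (\<lambda>x. c + integral {a..x} g) g"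
  using assms by (simp add: AC_on_def)

lemma AC_on_continuous:
  assumes "AC_on a b f g" shows "continuous_on {a..b} f"
proof -
  have "g integrable_on {a..b}" using assms set_lebesgue_integral_eq_integral(1) unfolding AC_on_def by blast
  then have "continuous_on {a..b} (\<lambda>x. f a + integral {a..x} g)"
    by (intro continuous_intros indefinite_integral_continuous_1)
  moreover have "\<And>x. x \<in> {a..b} \<Longrightarrow> f a + integral {a..x} g = f x" using assms unfolding AC_on_def by metis
  ultimately show ?thesis using continuous_on_cong[of "{a..b}" "{a..b}" "\<lambda>x. f a + integral {a..x} g" f] by simp
qed

lemma AC_on_C1:
  assumes "\<And>x. x \<in> {a..b} \<Longrightarrow> (f has_vector_derivative g x) (at x within {a..b})" "continuous_on {a..b} g"
  shows "AC_on a b f g"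
proof (rule AC_onI)
  show "g absolutely_integrable_on {a..b}" by (rule absolutely_integrable_continuous_real) fact
  fix x assume "a \<le> x" "x \<le> b"
  then show "(g has_integral f x - f a) {a..x}"
    by (intro fundamental_theorem_of_calculus has_vector_derivative_within_subset[OF assms(1)]) auto
qed

lemma AC_on_cong_AE:
  assumes f: "AC_on a b f g" and ae: "AE x in lebesgue_on {a<..<b}. g x = g' x"
  shows "AC_on a b f g'"
proof -
  obtain N where N: "negligible N" "\<And>x. x \<in> {a<..<b} - N \<Longrightarrow> g x = g' x"
    using ae by (rule AE_lebesgue_on_IooE) blast
  have n: "negligible (N \<union> {a, b})" using N(1) by simp
  have eq: "g' x = g x" if "x \<in> {a..b} - (N \<union> {a, b})" for x using N(2)[of x] that by auto
  show ?thesis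
  proof (rule AC_onI)
    show "g' absolutely_integrable_on {a..b}"
      by (rule absolutely_integrable_spike[OF AC_on_absolutely_integrable[OF f] n]) (use eq in auto)
    fix x assume x: "a \<le> x" "x \<le> b"
    show "(g' has_integral f x - f a) {a..x}"
      by (rule has_integral_spike[OF n _ AC_on_has_integral[OF f]]) (use eq x in auto)
  qed
qed

lemma AC_on_add:
  assumes f: "AC_on a b f f'" and g: "AC_on a b g g'"
  shows "AC_on a b (\<lambda>x. f x + g x) (\<lambda>x. f' x + g' x)"
proof (rule AC_onI)
  show "(\<lambda>x. f' x + g' x) absolutely_integrable_on {a..b}"
    by (rule set_integral_add(1)[OF AC_on_absolutely_integrable[OF f] AC_on_absolutely_integrable[OF g]])
  fix x assume x: "a \<le> x" "x \<le> b"
  have "((\<lambda>x. f' x + g' x) has_integral (f x - f a) + (g x - g a)) {a..x}"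
    using x by (intro has_integral_add AC_on_has_integral[OF f] AC_on_has_integral[OF g]) auto
  then show "((\<lambda>x. f' x + g' x) has_integral f x + g x - (f a + g a)) {a..x}" by (simp add: algebra_simps)
qed

text \<open>Over a short interval the defect in the product rule is at most \<open>e\<close> times the integral of
  \<open>norm (g x) + \<bar>\<phi>' x\<bar>\<close>; the bisection principle \<open>Bolzano\<close> adds these estimates up.\<close>

lemma AC_on_scaleR:
  fixes \<phi> :: "real \<Rightarrow> real" and f :: "real \<Rightarrow> 'a::euclidean_space"
  assumes \<phi>: "\<And>x. x \<in> {a..b} \<Longrightarrow> (\<phi> has_vector_derivative \<phi>' x) (at x within {a..b})"
    and \<phi>': "continuous_on {a..b} \<phi>'" and f: "AC_on a b f g"
  shows "AC_on a b (\<lambda>x. \<phi> x *\<^sub>R f x) (\<lambda>x. \<phi>' x *\<^sub>R f x + \<phi> x *\<^sub>R g x)"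
proof (rule AC_onI)
  let ?h = "\<lambda>x. \<phi>' x *\<^sub>R f x + \<phi> x *\<^sub>R g x"
  have AC\<phi>: "AC_on a b \<phi> \<phi>'" by (rule AC_on_C1[OF \<phi> \<phi>'])
  note c\<phi> = AC_on_continuous[OF AC\<phi>] and cf = AC_on_continuous[OF f]
  note ig = AC_on_absolutely_integrable[OF f]
  have c1: "continuous_on {a..b} (\<lambda>x. \<phi>' x *\<^sub>R f x)" by (intro continuous_intros \<phi>' cf)
  show h: "?h absolutely_integrable_on {a..b}"
    by (rule set_integral_add(1)[OF absolutely_integrable_continuous_real[OF c1]
          absolutely_integrable_continuous_scaleR[OF c\<phi> ig]])
  define k where "k x = norm (g x) + \<bar>\<phi>' x\<bar>" for x
  have k: "k integrable_on {s..t}" if "a \<le> s" "t \<le> b" for s t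
  proof -
    have "(\<lambda>x. norm (g x)) integrable_on {a..b}" using ig by (simp add: absolutely_integrable_on_def)
    moreover have "(\<lambda>x. \<bar>\<phi>' x\<bar>) integrable_on {a..b}"
      by (intro integrable_continuous_real continuous_intros \<phi>')
    ultimately have "k integrable_on {a..b}" unfolding k_def[abs_def] by (rule integrable_add)
    then show ?thesis by (rule integrable_on_subinterval) (use that in auto)
  qed
  have hi: "?h integrable_on {s..t}" if "a \<le> s" "t \<le> b" for s t
    using set_lebesgue_integral_eq_integral(1)[OF h] by (rule integrable_on_subinterval) (use that in auto)
  define Q where "Q s t = \<phi> t *\<^sub>R f t - \<phi> s *\<^sub>R f s - integral {s..t} ?h" for s t
  have est: "norm (Q s t) \<le> e * integral {s..t} k" if "a \<le> s" "s \<le> t" "t \<le> b" "e > 0" for s t e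
  proof -
    \<comment> \<open>\<open>P\<close> carries its own bounds because the bisection principle
      quantifies over all short intervals around a point, also those that reach beyond
      \<open>{a..b}\<close>.\<close>
    define P where "P s t \<longleftrightarrow> a \<le> s \<longrightarrow> s \<le> t \<longrightarrow> t \<le> b \<longrightarrow> norm (Q s t) \<le> e * integral {s..t} k" for s t
    have "P s t" using that(2)
    proof (rule Bolzano)
      fix u v w assume P: "P u v" "P v w" and uvw: "u \<le> v" "v \<le> w"
      show "P u w" unfolding P_def
      proof (intro impI)
        assume w: "a \<le> u" "u \<le> w" "w \<le> b"
        have "integral {u..v} k + integral {v..w} k = integral {u..w} k"
          using uvw w by (intro Henstock_Kurzweil_Integration.integral_combine k)
        moreover have "integral {u..v} ?h + integral {v..w} ?h = integral {u..w} ?h"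
          using uvw w by (intro Henstock_Kurzweil_Integration.integral_combine hi)
        then have "Q u w = Q u v + Q v w" by (simp add: Q_def algebra_simps)
        moreover have "norm (Q u v) \<le> e * integral {u..v} k" "norm (Q v w) \<le> e * integral {v..w} k"
          using P uvw w by (simp_all add: P_def)
        ultimately show "norm (Q u w) \<le> e * integral {u..w} k"
          by (smt (verit) norm_triangle_ineq distrib_left)
      qed
    next
      fix x assume "s \<le> x" "x \<le> t"
      then have x: "x \<in> {a..b}" using that by auto
      have e2: "e / 2 > 0" using that by simp
      obtain d1 where d1: "d1 > 0" "\<And>y. y \<in> {a..b} \<Longrightarrow> dist y x < d1 \<Longrightarrow> dist (\<phi> y) (\<phi> x) < e / 2"
        using c\<phi> x e2 unfolding continuous_on_iff by blast
      obtain d2 where d2: "d2 > 0" "\<And>y. y \<in> {a..b} \<Longrightarrow> dist y x < d2 \<Longrightarrow> dist (f y) (f x) < e / 2"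
        using cf x e2 unfolding continuous_on_iff by blast
      show "\<exists>d>0. \<forall>u v. u \<le> x \<and> x \<le> v \<and> v - u < d \<longrightarrow> P u v"
      proof (intro exI[of _ "min d1 d2"] conjI allI impI)
        fix u v assume uv: "u \<le> x \<and> x \<le> v \<and> v - u < min d1 d2"
        show "P u v" unfolding P_def
        proof (intro impI)
          assume w: "a \<le> u" "u \<le> v" "v \<le> b"
          \<comment> \<open>With \<open>\<phi>\<close> frozen at the right end and \<open>f\<close>
            at the left end, the two integrals add up exactly to the increment of the product; only
            the deviation of the integrand from \<open>?h\<close> remains to be estimated.\<close>
          have i1: "((\<lambda>y. \<phi> v *\<^sub>R g y) has_integral \<phi> v *\<^sub>R (f v - f u)) {u..v}"
            by (intro has_integral_cmul AC_on_has_integral[OF f] w)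
          have i2: "((\<lambda>y. \<phi>' y *\<^sub>R f u) has_integral (\<phi> v - \<phi> u) *\<^sub>R f u) {u..v}"
            by (intro has_integral_scaleR_left AC_on_has_integral[OF AC\<phi>] w)
          have Q: "((\<lambda>y. (\<phi> v *\<^sub>R g y + \<phi>' y *\<^sub>R f u) - ?h y) has_integral Q u v) {u..v}"
            using has_integral_diff[OF has_integral_add[OF i1 i2] integrable_integral[OF hi[OF w(1,3)]]]
            by (simp add: Q_def algebra_simps)
          have "norm (Q u v) \<le> integral {u..v} (\<lambda>y. e * k y)"
            unfolding integral_unique[OF Q, symmetric]
          proof (rule integral_norm_bound_integral)
            show "(\<lambda>y. (\<phi> v *\<^sub>R g y + \<phi>' y *\<^sub>R f u) - ?h y) integrable_on {u..v}" using Q by blast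
            show "(\<lambda>y. e * k y) integrable_on {u..v}" by (intro integrable_on_mult_right k w)
            fix y assume y: "y \<in> {u..v}"
            have in_ab: "y \<in> {a..b}" "u \<in> {a..b}" "v \<in> {a..b}" using uv y w by auto
            have near: "dist y x < d1" "dist v x < d1" "dist y x < d2" "dist u x < d2"
              using uv y by (auto simp: dist_real_def)
            have "dist (\<phi> y) (\<phi> x) < e / 2" "dist (\<phi> v) (\<phi> x) < e / 2"
              using d1(2) in_ab near by blast+
            then have a1: "\<bar>\<phi> v - \<phi> y\<bar> \<le> e" unfolding dist_real_def by linarith
            have "dist (f y) (f x) < e / 2" "dist (f u) (f x) < e / 2"
              using d2(2) in_ab near by blast+
            then have "dist (f u) (f y) < e" by (metis dist_triangle_half_l dist_commute)
            then have a2: "norm (f u - f y) \<le> e" by (simp add: dist_norm)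
            have "(\<phi> v *\<^sub>R g y + \<phi>' y *\<^sub>R f u) - ?h y = (\<phi> v - \<phi> y) *\<^sub>R g y + \<phi>' y *\<^sub>R (f u - f y)"
              by (simp add: algebra_simps)
            also have "norm \<dots> \<le> \<bar>\<phi> v - \<phi> y\<bar> * norm (g y) + \<bar>\<phi>' y\<bar> * norm (f u - f y)"
              by (rule order_trans[OF norm_triangle_ineq]) simp
            also have "\<dots> \<le> e * norm (g y) + \<bar>\<phi>' y\<bar> * e"
              by (intro add_mono mult_right_mono mult_left_mono a1 a2) auto
            finally show "norm ((\<phi> v *\<^sub>R g y + \<phi>' y *\<^sub>R f u) - ?h y) \<le> e * k y"
              by (simp add: k_def algebra_simps)
          qed
          then show "norm (Q u v) \<le> e * integral {u..v} k" by simp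
        qed
      qed (use d1 d2 in auto)
    qed
    with that show ?thesis by (simp add: P_def)
  qed
  fix x assume x: "a \<le> x" "x \<le> b"
  have "norm (Q a x) \<le> 0"
  proof (rule field_le_epsilon)
    fix e :: real assume e: "e > 0"
    let ?I = "integral {a..x} k"
    have I: "?I \<ge> 0" by (rule Henstock_Kurzweil_Integration.integral_nonneg) (use k[of a x] x in \<open>auto simp: k_def\<close>)
    have "norm (Q a x) \<le> (e / (?I + 1)) * ?I" using est[of a x "e / (?I + 1)"] x e I by simp
    also have "\<dots> \<le> e" using e I by (simp add: field_simps)
    finally show "norm (Q a x) \<le> 0 + e" by simp
  qed
  then have "integral {a..x} ?h = \<phi> x *\<^sub>R f x - \<phi> a *\<^sub>R f a" by (simp add: Q_def)
  with integrable_integral[OF hi[of a x]] x show "(?h has_integral \<phi> x *\<^sub>R f x - \<phi> a *\<^sub>R f a) {a..x}" by simp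
qed

lemma AC_on_integration_by_parts:
  fixes \<phi> :: "real \<Rightarrow> real" and f :: "real \<Rightarrow> 'a::euclidean_space"
  assumes "AC_on a b f g" "test_function a b \<phi>" "a \<le> b"
  shows "integral {a..b} (\<lambda>x. deriv \<phi> x *\<^sub>R f x) = - integral {a..b} (\<lambda>x. \<phi> x *\<^sub>R g x)"
proof -
  note t = test_function_deriv[OF assms(2)]
  have "(\<phi> has_vector_derivative deriv \<phi> x) (at x within {a..b})" for x
    using test_function_has_derivative[OF assms(2), of x]
    by (auto simp: has_real_derivative_iff_has_vector_derivative intro: has_vector_derivative_at_within)
  from AC_on_scaleR[OF this test_function_continuous[OF t] assms(1)]
  have "((\<lambda>x. deriv \<phi> x *\<^sub>R f x + \<phi> x *\<^sub>R g x) has_integral \<phi> b *\<^sub>R f b - \<phi> a *\<^sub>R f a) {a..b}"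
    by (rule AC_on_has_integral) (use assms in auto)
  moreover have "\<phi> a = 0" "\<phi> b = 0" using assms(2) by (auto intro: test_function_zero_outside)
  ultimately have z: "integral {a..b} (\<lambda>x. deriv \<phi> x *\<^sub>R f x + \<phi> x *\<^sub>R g x) = 0"
    by (simp add: integral_unique)
  have i1: "(\<lambda>x. deriv \<phi> x *\<^sub>R f x) integrable_on {a..b}"
    by (intro integrable_continuous_real continuous_intros test_function_continuous[OF t] AC_on_continuous[OF assms(1)])
  have i2: "(\<lambda>x. \<phi> x *\<^sub>R g x) integrable_on {a..b}"
    by (rule set_lebesgue_integral_eq_integral(1)[OF absolutely_integrable_continuous_scaleR])
      (rule test_function_continuous[OF assms(2)] AC_on_absolutely_integrable[OF assms(1)])+
  from z show ?thesis
    unfolding Henstock_Kurzweil_Integration.integral_add[OF i1 i2] by (simp add: eq_neg_iff_add_eq_0)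
qed

section \<open>Weak derivatives of absolutely continuous functions\<close>

lemma has_weak_derivative_0:
  assumes "locally_integrable a b f" shows "has_weak_derivative a b 0 f f"
  using assms by (simp add: has_weak_derivative_def)

text \<open>Integration by parts moves one derivative from the test function to \<open>f\<close>.
  Weak derivatives of higher order of an explicit curve come from a chain of \<open>AC_on\<close>
  facts through this step.\<close>

lemma has_weak_derivative_Suc:
  assumes ab: "a \<le> b" and f: "AC_on a b f g" and g: "has_weak_derivative a b m g h"
  shows "has_weak_derivative a b (Suc m) f h"
  unfolding has_weak_derivative_iff
proof (intro conjI allI impI)
  show "locally_integrable a b f"
    by (intro absolutely_integrable_imp_locally absolutely_integrable_continuous_real AC_on_continuous[OF f])
  show "locally_integrable a b h" using g by (simp add: has_weak_derivative_def)
  fix \<phi> :: "real \<Rightarrow> real" assume \<phi>: "test_function a b \<phi>"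
  have "integral {a..b} (\<lambda>x. (deriv ^^ Suc m) \<phi> x *\<^sub>R f x) = - integral {a..b} (\<lambda>x. (deriv ^^ m) \<phi> x *\<^sub>R g x)"
    using AC_on_integration_by_parts[OF f test_function_deriv_iter[OF \<phi>, of m] ab] by simp
  also have "integral {a..b} (\<lambda>x. (deriv ^^ m) \<phi> x *\<^sub>R g x) = (-1) ^ m *\<^sub>R integral {a..b} (\<lambda>x. \<phi> x *\<^sub>R h x)"
    using g \<phi> unfolding has_weak_derivative_iff by blast
  finally show "integral {a..b} (\<lambda>x. (deriv ^^ Suc m) \<phi> x *\<^sub>R f x) =
     (-1) ^ Suc m *\<^sub>R integral {a..b} (\<lambda>x. \<phi> x *\<^sub>R h x)" by simp
qed

lemma has_weak_derivative_1:
  assumes "a \<le> b" "AC_on a b f g" shows "has_weak_derivative a b 1 f g"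
  using has_weak_derivative_Suc[OF assms has_weak_derivative_0]
    absolutely_integrable_imp_locally[OF AC_on_absolutely_integrable[OF assms(2)]] by simp

lemma integrable_lebesgue_on_Ioo_iff:
  fixes f :: "real \<Rightarrow> 'a::euclidean_space"
  shows "integrable (lebesgue_on {a<..<b}) f \<longleftrightarrow> f absolutely_integrable_on {a..b}"
proof -
  have "integrable (lebesgue_on {a<..<b}) f \<longleftrightarrow> f absolutely_integrable_on {a<..<b}"
    unfolding set_integrable_def by (rule integrable_restrict_space) simp
  then show ?thesis by (simp only: absolutely_integrable_on_Icc_iff_Ioo)
qed

lemma has_weak_derivative_1_same:
  fixes f :: "real \<Rightarrow> 'a::euclidean_space"
  assumes ab: "a < b" and f: "has_weak_derivative a b 1 f g" and h: "has_weak_derivative a b 1 h g"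
  obtains c where "AE x in lebesgue_on {a<..<b}. f x = c + h x"
proof -
  have l: "locally_integrable a b f" "locally_integrable a b h"
    using f h by (simp_all add: has_weak_derivative_def)
  have "integral {a..b} (\<lambda>x. deriv \<phi> x *\<^sub>R (f x - h x)) = 0" if \<phi>: "test_function a b \<phi>" for \<phi> :: "real \<Rightarrow> real"
  proof -
    note t = test_function_deriv[OF \<phi>]
    have "integral {a..b} (\<lambda>x. (deriv ^^ 1) \<phi> x *\<^sub>R f x) = (-1) ^ 1 *\<^sub>R integral {a..b} (\<lambda>x. \<phi> x *\<^sub>R g x)"
      using f \<phi> unfolding has_weak_derivative_iff by blast
    moreover have "integral {a..b} (\<lambda>x. (deriv ^^ 1) \<phi> x *\<^sub>R h x) = (-1) ^ 1 *\<^sub>R integral {a..b} (\<lambda>x. \<phi> x *\<^sub>R g x)"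
      using h \<phi> unfolding has_weak_derivative_iff by blast
    moreover note i = test_function_times(1)[OF l(1) t, THEN set_lebesgue_integral_eq_integral(1)]
      test_function_times(1)[OF l(2) t, THEN set_lebesgue_integral_eq_integral(1)]
    ultimately show ?thesis
      using Henstock_Kurzweil_Integration.integral_diff[OF i] by (simp add: scaleR_diff_right)
  qed
  with ab obtain c where c: "AE x in lebesgue_on {a<..<b}. f x - h x = c"
    using du_Bois_Reymond[OF ab locally_integrable_diff[OF l]] by blast
  have "AE x in lebesgue_on {a<..<b}. f x = c + h x" using c by eventually_elim (auto simp: algebra_simps)
  then show ?thesis by (rule that)
qed

text \<open>\<open>f\<close> and the indefinite integral of \<open>g\<close> have the same weak
  derivative, so they differ by a constant almost everywhere; the constant is absorbed into the
  representative \<open>h\<close>.\<close>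

lemma has_weak_derivative_1_AC:
  fixes f :: "real \<Rightarrow> 'a::euclidean_space"
  assumes ab: "a < b" and f: "has_weak_derivative a b 1 f g" and g: "g absolutely_integrable_on {a..b}"
  obtains h where "AC_on a b h g" "AE x in lebesgue_on {a<..<b}. f x = h x"
proof -
  have "has_weak_derivative a b 1 (\<lambda>x. 0 + integral {a..x} g) g"
    using ab by (intro has_weak_derivative_1 AC_on_integral g) simp
  from has_weak_derivative_1_same[OF ab f this] obtain c
    where "AE x in lebesgue_on {a<..<b}. f x = c + (0 + integral {a..x} g)" by blast
  with AC_on_integral[OF g, of c] show ?thesis by (intro that[of "\<lambda>x. c + integral {a..x} g"]) auto
qed

text \<open>The continuous function \<open>norm (f x - g x)\<close> is nonnegative with integral 0,
  hence vanishes everywhere, the end points included.\<close>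

lemma continuous_AE_eq_imp_eq:
  fixes f g :: "real \<Rightarrow> 'a::euclidean_space"
  assumes "a < b" "continuous_on {a..b} f" "continuous_on {a..b} g"
    "AE x in lebesgue_on {a<..<b}. f x = g x" "x \<in> {a..b}"
  shows "f x = g x"
proof -
  obtain N where N: "negligible N" "\<And>x. x \<in> {a<..<b} - N \<Longrightarrow> f x = g x"
    using assms(4) by (rule AE_lebesgue_on_IooE) blast
  have "integral {a..b} (\<lambda>x. norm (f x - g x)) = integral {a..b} (\<lambda>x. 0)"
  proof (rule integral_spike)
    show "negligible (N \<union> {a, b})" using N(1) by simp
    show "\<And>x. x \<in> {a..b} - (N \<union> {a, b}) \<Longrightarrow> 0 = norm (f x - g x)" using N(2) by force
  qed
  then have z: "integral {a..b} (\<lambda>x. norm (f x - g x)) = 0" by simp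
  have "continuous_on {a..b} (\<lambda>x. norm (f x - g x))" by (intro continuous_intros assms)
  from integral_eq_0_iff[OF this assms(1)] z have "\<forall>x\<in>{a..b}. norm (f x - g x) = 0" by simp
  with assms(5) show ?thesis by simp
qed

text \<open>On a bounded interval the elementary bound \<open>r \<le> 1 + r powr p\<close>
  suffices.\<close>

lemma Lp_fun_imp_absolutely_integrable:
  fixes f :: "real \<Rightarrow> 'a::euclidean_space"
  assumes "Lp_fun a b p f" "1 \<le> p" shows "f absolutely_integrable_on {a..b}"
proof -
  have "integrable (lebesgue_on {a<..<b}) f"
  proof (rule Bochner_Integration.integrable_bound)
    have "(\<lambda>x. 1::real) absolutely_integrable_on {a..b}"
      by (intro absolutely_integrable_continuous_real continuous_intros)
    then show "integrable (lebesgue_on {a<..<b}) (\<lambda>x. 1 + norm (f x) powr p)"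
      using assms by (intro Bochner_Integration.integrable_add) (auto simp: integrable_lebesgue_on_Ioo_iff Lp_fun_def)
    show "f \<in> borel_measurable (lebesgue_on {a<..<b})" using assms by (simp add: Lp_fun_def)
    have "r \<le> 1 + r powr p" if "r \<ge> 0" for r
    proof (cases "r \<le> 1")
      case False
      then have "r powr 1 \<le> r powr p" using assms by (intro powr_mono) auto
      with False show ?thesis by simp
    qed (use powr_ge_zero[of r p] in linarith)
    then show "AE x in lebesgue_on {a<..<b}. norm (f x) \<le> norm (1 + norm (f x) powr p)"
      by (intro AE_I2) (simp add: add_nonneg_nonneg)
  qed
  then show ?thesis by (simp add: integrable_lebesgue_on_Ioo_iff)
qed

text \<open>Testing the first-order identity with \<open>deriv \<phi>\<close> shows that the second
  weak derivative is the weak derivative of the first. Two integrations then give absolutely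
  continuous representatives, and the continuous \<open>f\<close> equals its own at every
  point.\<close>

lemma sobolev_2_AC:
  fixes f :: "real \<Rightarrow> 'a::euclidean_space"
  assumes ab: "a < b" and p: "1 \<le> p" and f: "sobolev a b 2 p f" "continuous_on {a..b} f"
  obtains f' f'' where "AC_on a b f f'" "AC_on a b f' f''" "Lp_fun a b p f''"
proof -
  obtain g1 where g1: "has_weak_derivative a b 1 f g1" using f(1) unfolding sobolev_def by (metis one_le_numeral)
  obtain g2 where g2: "has_weak_derivative a b 2 f g2" "Lp_fun a b p g2" using f(1) unfolding sobolev_def by blast
  have ig2: "g2 absolutely_integrable_on {a..b}" by (rule Lp_fun_imp_absolutely_integrable[OF g2(2) p])
  have "has_weak_derivative a b 1 g1 g2"
    unfolding has_weak_derivative_iff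
  proof (intro conjI allI impI)
    fix \<phi> :: "real \<Rightarrow> real" assume \<phi>: "test_function a b \<phi>"
    have "integral {a..b} (\<lambda>x. (deriv ^^ 1) (deriv \<phi>) x *\<^sub>R f x) = (-1) ^ 1 *\<^sub>R integral {a..b} (\<lambda>x. deriv \<phi> x *\<^sub>R g1 x)"
      using g1 test_function_deriv[OF \<phi>] unfolding has_weak_derivative_iff by blast
    moreover have "integral {a..b} (\<lambda>x. (deriv ^^ 2) \<phi> x *\<^sub>R f x) = (-1) ^ 2 *\<^sub>R integral {a..b} (\<lambda>x. \<phi> x *\<^sub>R g2 x)"
      using g2 \<phi> unfolding has_weak_derivative_iff by blast
    ultimately have *: "- integral {a..b} (\<lambda>x. deriv \<phi> x *\<^sub>R g1 x) = integral {a..b} (\<lambda>x. \<phi> x *\<^sub>R g2 x)"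
      by (simp add: numeral_2_eq_2)
    show "integral {a..b} (\<lambda>x. (deriv ^^ 1) \<phi> x *\<^sub>R g1 x) = (-1) ^ 1 *\<^sub>R integral {a..b} (\<lambda>x. \<phi> x *\<^sub>R g2 x)"
      unfolding *[symmetric] by simp
  qed (use g1 g2 in \<open>simp_all add: has_weak_derivative_def\<close>)
  then obtain f' where f': "AC_on a b f' g2" "AE x in lebesgue_on {a<..<b}. g1 x = f' x"
    using has_weak_derivative_1_AC[OF ab _ ig2] by blast
  have cf': "continuous_on {a..b} f'" by (rule AC_on_continuous[OF f'(1)])
  have "has_weak_derivative a b 1 f f'"
    unfolding has_weak_derivative_iff
  proof (intro conjI allI impI)
    fix \<phi> :: "real \<Rightarrow> real" assume \<phi>: "test_function a b \<phi>"
    obtain N where N: "negligible N" "\<And>x. x \<in> {a<..<b} - N \<Longrightarrow> g1 x = f' x"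
      using f'(2) by (rule AE_lebesgue_on_IooE) blast
    have "integral {a..b} (\<lambda>x. \<phi> x *\<^sub>R f' x) = integral {a..b} (\<lambda>x. \<phi> x *\<^sub>R g1 x)"
    proof (rule integral_spike)
      show "negligible (N \<union> {a, b})" using N(1) by simp
      show "\<And>x. x \<in> {a..b} - (N \<union> {a, b}) \<Longrightarrow> \<phi> x *\<^sub>R g1 x = \<phi> x *\<^sub>R f' x" using N(2) by force
    qed
    moreover have "integral {a..b} (\<lambda>x. (deriv ^^ 1) \<phi> x *\<^sub>R f x) = (-1) ^ 1 *\<^sub>R integral {a..b} (\<lambda>x. \<phi> x *\<^sub>R g1 x)"
      using g1 \<phi> unfolding has_weak_derivative_iff by blast
    ultimately show "integral {a..b} (\<lambda>x. (deriv ^^ 1) \<phi> x *\<^sub>R f x) = (-1) ^ 1 *\<^sub>R integral {a..b} (\<lambda>x. \<phi> x *\<^sub>R f' x)"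
      by simp
  qed (use g1 cf' in \<open>simp_all add: has_weak_derivative_def absolutely_integrable_imp_locally absolutely_integrable_continuous_real\<close>)
  from has_weak_derivative_1_AC[OF ab this absolutely_integrable_continuous_real[OF cf']]
  obtain h where h: "AC_on a b h f'" "AE x in lebesgue_on {a<..<b}. f x = h x" by blast
  have eq: "f x = h x" if "x \<in> {a..b}" for x
    by (rule continuous_AE_eq_imp_eq[OF ab f(2) AC_on_continuous[OF h(1)] h(2) that])
  have "AC_on a b f f'"
  proof -
    have "f a = h a" using eq ab by simp
    then show ?thesis
      using AC_on_has_integral[OF h(1), of a] AC_on_absolutely_integrable[OF h(1)] eq by (intro AC_onI) auto
  qed
  then show ?thesis by (rule that[OF _ f'(1) g2(2)])
qed

text \<open>Only mean-zero functions \<open>deriv \<psi>\<close> are available for testing, so the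
  weak derivative of \<open>F\<close> is \<open>B\<close> up to an additive constant
  \<open>C\<close>, fixed by the pairing with \<open>\<rho>\<close>. Applied to the two components
  of the curve it yields the vector \<open>(c1, c2)\<close> of the Euler-Lagrange equation.\<close>

lemma du_Bois_Reymond_second_order:
  fixes F B :: "real \<Rightarrow> 'a::euclidean_space"
  assumes ab: "a < b" and F: "F absolutely_integrable_on {a..b}" and B: "B absolutely_integrable_on {a..b}"
    and z: "\<And>\<phi>::real \<Rightarrow> real. test_function a b \<phi> \<Longrightarrow>
      integral {a..b} (\<lambda>x. deriv (deriv \<phi>) x *\<^sub>R F x) + integral {a..b} (\<lambda>x. deriv \<phi> x *\<^sub>R B x) = 0"
  obtains M C where "AC_on a b M (\<lambda>x. B x + C)" "AE x in lebesgue_on {a<..<b}. F x = M x"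
proof -
  obtain \<rho> :: "real \<Rightarrow> real" where \<rho>: "test_function a b \<rho>"
    "\<And>\<phi>::real \<Rightarrow> real. test_function a b \<phi> \<Longrightarrow>
      \<exists>\<psi>. test_function a b \<psi> \<and> deriv \<psi> = (\<lambda>x. \<phi> x - integral {a..b} \<phi> * \<rho> x)"
    using test_function_unit_mass[OF ab] by blast
  note lF = absolutely_integrable_imp_locally[OF F] and lB = absolutely_integrable_imp_locally[OF B]
  define C where "C = - integral {a..b} (\<lambda>x. deriv \<rho> x *\<^sub>R F x) - integral {a..b} (\<lambda>x. \<rho> x *\<^sub>R B x)"
  have cC: "(\<lambda>x. C) absolutely_integrable_on {a..b}"
    by (intro absolutely_integrable_continuous_real continuous_intros)
  have BC: "(\<lambda>x. B x + C) absolutely_integrable_on {a..b}" by (rule set_integral_add(1)[OF B cC])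
  have "has_weak_derivative a b 1 F (\<lambda>x. B x + C)"
    unfolding has_weak_derivative_iff
  proof (intro conjI allI impI)
    fix \<phi> :: "real \<Rightarrow> real" assume \<phi>: "test_function a b \<phi>"
    let ?r = "integral {a..b} \<phi>"
    obtain \<psi> where \<psi>: "test_function a b \<psi>" "deriv \<psi> = (\<lambda>x. \<phi> x - ?r * \<rho> x)" using \<rho>(2)[OF \<phi>] by blast
    have "deriv (\<lambda>x. \<phi> x - ?r * \<rho> x) x = deriv \<phi> x - ?r * deriv \<rho> x" for x
      by (intro DERIV_imp_deriv) (auto intro!: derivative_eq_intros test_function_has_derivative[OF \<phi>] test_function_has_derivative[OF \<rho>(1)])
    then have d: "deriv (deriv \<psi>) = (\<lambda>x. deriv \<phi> x - ?r * deriv \<rho> x)" unfolding \<psi>(2) by blast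
    have int: "\<phi> integrable_on {a..b}" 
      using \<phi> by (intro integrable_continuous_real test_function_continuous)
    have iC: "((\<lambda>x. \<phi> x *\<^sub>R C) has_integral ?r *\<^sub>R C) {a..b}"
      by (rule has_integral_scaleR_left[OF integrable_integral[OF int]])
    have iB: "((\<lambda>x. \<phi> x *\<^sub>R B x) has_integral integral {a..b} (\<lambda>x. \<phi> x *\<^sub>R B x)) {a..b}"
      by (intro integrable_integral set_lebesgue_integral_eq_integral(1) test_function_times(1)[OF lB \<phi>])
    have s: "integral {a..b} (\<lambda>x. \<phi> x *\<^sub>R (B x + C)) = integral {a..b} (\<lambda>x. \<phi> x *\<^sub>R B x) + ?r *\<^sub>R C"
      using integral_unique[OF has_integral_add[OF iB iC]] by (simp only: scaleR_add_right)
    have vec: "(y1 - r *\<^sub>R y2) + (y3 - r *\<^sub>R y4) = 0 \<Longrightarrow> y1 = - (y3 + r *\<^sub>R (- y2 - y4))"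
      for y1 y2 y3 y4 :: 'a and r :: real
      by (simp add: algebra_simps eq_neg_iff_add_eq_0)
    have "integral {a..b} (\<lambda>x. deriv \<phi> x *\<^sub>R F x) = - (integral {a..b} (\<lambda>x. \<phi> x *\<^sub>R B x) + ?r *\<^sub>R C)"
      unfolding C_def
    proof (rule vec)
      show "integral {a..b} (\<lambda>x. deriv \<phi> x *\<^sub>R F x) - ?r *\<^sub>R integral {a..b} (\<lambda>x. deriv \<rho> x *\<^sub>R F x) +
          (integral {a..b} (\<lambda>x. \<phi> x *\<^sub>R B x) - ?r *\<^sub>R integral {a..b} (\<lambda>x. \<rho> x *\<^sub>R B x)) = 0"
        using z[OF \<psi>(1)] unfolding d unfolding \<psi>(2)
          integral_test_diff_scaleR[OF lF test_function_deriv[OF \<phi>] test_function_deriv[OF \<rho>(1)]]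
          integral_test_diff_scaleR[OF lB \<phi> \<rho>(1)] .
    qed
    then show "integral {a..b} (\<lambda>x. (deriv ^^ 1) \<phi> x *\<^sub>R F x) = (-1) ^ 1 *\<^sub>R integral {a..b} (\<lambda>x. \<phi> x *\<^sub>R (B x + C))"
      unfolding s by simp
  qed (rule lF absolutely_integrable_imp_locally[OF BC])+
  with BC obtain M where "AC_on a b M (\<lambda>x. B x + C)" "AE x in lebesgue_on {a<..<b}. F x = M x"
    using has_weak_derivative_1_AC[OF ab] by blast
  then show ?thesis by (rule that)
qed

section \<open>Integrability of the derivative of the curvature\<close>

lemma sgn_abs_powr_has_derivative:
  fixes v q :: real
  assumes "v \<noteq> 0"
  shows "((\<lambda>v. sgn v * \<bar>v\<bar> powr q) has_real_derivative q * \<bar>v\<bar> powr (q - 1)) (at v)"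
proof (cases "v > 0")
  case True
  have "((\<lambda>v. v powr q) has_real_derivative q * \<bar>v\<bar> powr (q - 1)) (at v)"
    using True by (auto intro!: derivative_eq_intros)
  then show ?thesis
    by (rule has_field_derivative_transform_within_open[of _ _ _ "{0<..}"]) (use True in auto)
next
  case False
  with assms have v: "v < 0" by simp
  have "((\<lambda>v. - ((- v) powr q)) has_real_derivative q * \<bar>v\<bar> powr (q - 1)) (at v)"
    using v by (auto intro!: derivative_eq_intros)
  then show ?thesis
    by (rule has_field_derivative_transform_within_open[of _ _ _ "{..<0}"]) (use v in auto)
qed

lemma sgn_abs_powr_inverse:
  fixes k q :: real
  assumes "q > 0"
  shows "k = sgn (sgn k * \<bar>k\<bar> powr q) * \<bar>sgn k * \<bar>k\<bar> powr q\<bar> powr (1 / q)"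
proof (cases "k = 0")
  case False
  have "sgn (sgn k * \<bar>k\<bar> powr q) = sgn k" using False by (simp add: sgn_mult)
  moreover have "\<bar>sgn k * \<bar>k\<bar> powr q\<bar> powr (1 / q) = \<bar>k\<bar>"
    using False assms by (simp add: abs_mult powr_powr)
  ultimately show ?thesis by (simp add: sgn_mult_abs)
qed simp

text \<open>The interface between the variational part and the study of an ordinary differential
  system: Frenet's equations for the tangent \<open>(X, Y)\<close> with continuous curvature, and
  the tangential and normal components of the integrated Euler-Lagrange equation,
  \<open>energy\<close> and \<open>w_deriv\<close>.\<close>

locale elastica_system =
  fixes p L l c1 c2 :: real and k X Y :: "real \<Rightarrow> real"
  assumes p: "1 < p" and L: "0 < L"
    and k_cont: "continuous_on {0..L} k"
    and X_deriv: "\<And>x. x \<in> {0..L} \<Longrightarrow> (X has_real_derivative - k x * Y x) (at x within {0..L})"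
    and Y_deriv: "\<And>x. x \<in> {0..L} \<Longrightarrow> (Y has_real_derivative k x * X x) (at x within {0..L})"
    and unit: "\<And>x. x \<in> {0..L} \<Longrightarrow> (X x)\<^sup>2 + (Y x)\<^sup>2 = 1"
    and energy: "\<And>x. x \<in> {0..L} \<Longrightarrow> (p - 1) * \<bar>k x\<bar> powr p = l + c1 * X x + c2 * Y x"
    and w_deriv: "\<And>x. x \<in> {0..L} \<Longrightarrow>
      ((\<lambda>x. sgn (k x) * \<bar>k x\<bar> powr (p - 1)) has_real_derivative (c2 * X x - c1 * Y x) / p) (at x within {0..L})"
begin

text \<open>\<open>n\<close> and \<open>t\<close> are the components of the constant vector \<open>C = (c1, c2)\<close> along the normal
  \<open>(- Y, X)\<close> and the tangent \<open>(X, Y)\<close>.\<close>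

definition n :: "real \<Rightarrow> real" where "n x = c2 * X x - c1 * Y x"
definition t :: "real \<Rightarrow> real" where "t x = c1 * X x + c2 * Y x"
text \<open>Off the zeros of \<open>k\<close> this is the chain rule applied to
  \<open>w_deriv\<close>; the exponent \<open>2 - p\<close> comes from inverting the power
  \<open>p - 1\<close>. For \<open>p > 2\<close> the factor is unbounded near zeros of
  \<open>k\<close>. The value 0 is the true derivative wherever \<open>k\<close> vanishes on an
  interval.\<close>

definition k' :: "real \<Rightarrow> real" where
  "k' x = (if k x = 0 then 0 else \<bar>k x\<bar> powr (2 - p) * n x / (p * (p - 1)))"

lemma X_cont: "continuous_on {0..L} X" and Y_cont: "continuous_on {0..L} Y"
  by (rule DERIV_continuous_on[OF X_deriv], assumption) (rule DERIV_continuous_on[OF Y_deriv], assumption)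

lemma n_cont: "continuous_on {0..L} n" and t_cont: "continuous_on {0..L} t"
  unfolding n_def[abs_def] t_def[abs_def] by (intro continuous_intros X_cont Y_cont)+

lemma t_deriv: "x \<in> {0..L} \<Longrightarrow> (t has_real_derivative k x * n x) (at x within {0..L})"
  unfolding t_def[abs_def] n_def
  by (auto intro!: derivative_eq_intros X_deriv Y_deriv simp: algebra_simps)

lemma n_t_square: "x \<in> {0..L} \<Longrightarrow> (n x)\<^sup>2 + (t x)\<^sup>2 = c1\<^sup>2 + c2\<^sup>2"
proof -
  assume "x \<in> {0..L}"
  have "(n x)\<^sup>2 + (t x)\<^sup>2 = (c1\<^sup>2 + c2\<^sup>2) * ((X x)\<^sup>2 + (Y x)\<^sup>2)"
    by (simp add: n_def t_def power2_eq_square algebra_simps)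
  with unit[OF \<open>x \<in> {0..L}\<close>] show ?thesis by simp
qed

lemma k_eq_0_iff: "x \<in> {0..L} \<Longrightarrow> k x = 0 \<longleftrightarrow> t x = - l"
  using energy[of x] p by (auto simp: t_def add.assoc)

text \<open>By \<open>energy\<close>, the excess of \<open>t\<close> over \<open>- l\<close> is
  \<open>(p - 1) * \<bar>k\<bar> powr p\<close>. So the zeros of \<open>k\<close> are exactly the
  points where \<open>t\<close> attains this lower bound, which drives the later maximum
  argument.\<close>

lemma t_ge: "x \<in> {0..L} \<Longrightarrow> - l \<le> t x"
  using energy[of x] p mult_nonneg_nonneg[of "p - 1" "\<bar>k x\<bar> powr p"] by (simp add: t_def)

lemma k_deriv:
  assumes x: "x \<in> {0..L}" and "k x \<noteq> 0"
  shows "(k has_real_derivative k' x) (at x within {0..L})"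
proof -
  define w where "w x = sgn (k x) * \<bar>k x\<bar> powr (p - 1)" for x
  have w0: "w x \<noteq> 0" using assms by (simp add: w_def sgn_if)
  have "((\<lambda>x. sgn (w x) * \<bar>w x\<bar> powr (1 / (p - 1))) has_real_derivative
      (1 / (p - 1)) * \<bar>w x\<bar> powr (1 / (p - 1) - 1) * (n x / p)) (at x within {0..L})"
    using DERIV_chain2[OF sgn_abs_powr_has_derivative[OF w0] w_deriv[OF x, folded w_def n_def]] .
  moreover have "(\<lambda>x. sgn (w x) * \<bar>w x\<bar> powr (1 / (p - 1))) = k"
    unfolding w_def using sgn_abs_powr_inverse[of "p - 1"] p by auto
  moreover have "\<bar>w x\<bar> powr (1 / (p - 1) - 1) = \<bar>k x\<bar> powr (2 - p)"
  proof -
    have "\<bar>w x\<bar> = \<bar>k x\<bar> powr (p - 1)" using assms by (simp add: w_def abs_mult)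
    moreover have "(p - 1) * (1 / (p - 1) - 1) = 2 - p" using p by (simp add: field_simps)
    ultimately show ?thesis by (simp add: powr_powr)
  qed
  moreover have "(1 / (p - 1)) * \<bar>k x\<bar> powr (2 - p) * (n x / p) = k' x"
    using assms by (simp add: k'_def)
  ultimately show ?thesis by simp
qed

text \<open>A gauge integral of \<open>k'\<close> alone would not put \<open>k'\<close> into L^1, so
  absolute integrability is carried along. Both parts are additive over adjacent intervals, as the
  bisection principle requires.\<close>

definition prim :: "real \<Rightarrow> real \<Rightarrow> bool" where
  "prim a b \<longleftrightarrow> k' absolutely_integrable_on {a..b} \<and> (k' has_integral k b - k a) {a..b}"

lemma prim_combine:
  assumes "prim a b" "prim b c" "a \<le> b" "b \<le> c" shows "prim a c"
proof -
  have "(k' has_integral (k b - k a) + (k c - k b)) {a..c}"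
    using assms by (intro has_integral_combine[of a b c]) (auto simp: prim_def)
  then show ?thesis
    using assms absolutely_integrable_on_combine[where f = k' and a = a and c = b and b = c]
    by (simp add: prim_def)
qed

lemma prim_nonzero:
  assumes ab: "0 \<le> a" "a \<le> b" "b \<le> L" and nz: "\<And>x. x \<in> {a..b} \<Longrightarrow> k x \<noteq> 0"
  shows "prim a b"
proof -
  have s: "{a..b} \<subseteq> {0..L}" using ab by auto
  have "continuous_on {a..b} (\<lambda>x. \<bar>k x\<bar> powr (2 - p) * n x / (p * (p - 1)))"
    using nz p by (intro continuous_intros continuous_on_subset[OF k_cont s] continuous_on_subset[OF n_cont s]) auto
  then have "continuous_on {a..b} k'"
    by (rule continuous_on_eq) (use nz in \<open>simp add: k'_def\<close>)
  moreover have "(k has_vector_derivative k' x) (at x within {a..b})" if "x \<in> {a..b}" for x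
    using k_deriv[of x] nz[OF that] that s
    by (auto simp: has_real_derivative_iff_has_vector_derivative intro: has_vector_derivative_within_subset)
  ultimately show ?thesis using ab unfolding prim_def
    by (auto intro: absolutely_integrable_continuous_real fundamental_theorem_of_calculus)
qed

lemma prim_zero:
  assumes "\<And>x. x \<in> {a..b} \<Longrightarrow> k x = 0" "a \<le> b"
  shows "prim a b"
proof -
  have 0: "((\<lambda>x. 0) has_integral (0::real)) {a..b}" by simp
  have "(k' has_integral 0) {a..b}"
    by (rule has_integral_eq[OF _ 0]) (use assms in \<open>simp add: k'_def\<close>)
  moreover have "k' absolutely_integrable_on {a..b}"
    using calculation assms by (intro nonnegative_absolutely_integrable_1) (auto simp: k'_def)
  ultimately show ?thesis using assms by (simp add: prim_def)
qed

lemma constant_sign: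
  fixes f :: "real \<Rightarrow> real"
  assumes "continuous_on {a<..<b} f" "\<And>x. x \<in> {a<..<b} \<Longrightarrow> f x \<noteq> (0::real)"
  shows "(\<forall>x\<in>{a<..<b}. 0 < f x) \<or> (\<forall>x\<in>{a<..<b}. f x < 0)"
proof (rule ccontr)
  assume "\<not> ?thesis"
  then obtain x y where xy: "x \<in> {a<..<b}" "y \<in> {a<..<b}" "f x < 0" "0 < f y"
    using assms(2) by (metis linorder_neqE_linordered_idom)
  have "connected (f ` {a<..<b})" by (intro connected_continuous_image assms(1) connected_Ioo)
  then have "0 \<in> f ` {a<..<b}"
    using xy connectedD_interval[of "f ` {a<..<b}" "f x" "f y" 0] by auto
  then show False using assms(2) by auto
qed

text \<open>The interior form of the fundamental theorem gives a gauge integral of \<open>k'\<close>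
  even when \<open>k'\<close> is unbounded at the ends. Since \<open>n\<close> has no zero inside,
  \<open>k'\<close> has one sign there, and for a function of one sign gauge integrability is
  absolute.\<close>

lemma prim_monotone:
  assumes ab: "0 \<le> a" "a \<le> b" "b \<le> L" and nz: "\<And>x. x \<in> {a<..<b} \<Longrightarrow> k x \<noteq> 0 \<and> n x \<noteq> 0"
  shows "prim a b"
proof -
  have s: "{a..b} \<subseteq> {0..L}" "{a<..<b} \<subseteq> {0..L}" using ab by auto
  have d: "(k has_vector_derivative k' x) (at x)" if "x \<in> {a<..<b}" for x
  proof -
    have "x \<in> {0..L}" "0 < x" "x < L" using that ab by auto
    then show ?thesis
      using k_deriv[of x] nz[OF that]
      by (simp add: has_real_derivative_iff_has_vector_derivative at_within_Icc_at)
  qed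
  have hi: "(k' has_integral k b - k a) {a..b}"
    by (rule fundamental_theorem_of_calculus_interior) (use ab d continuous_on_subset[OF k_cont s(1)] in auto)
  then have i: "k' integrable_on {a<..<b}"
    using integrable_on_Icc_iff_Ioo[of k' a b] by blast
  have pos: "0 < \<bar>k x\<bar> powr (2 - p) / (p * (p - 1))" if "x \<in> {a<..<b}" for x
    using nz[OF that] p by simp
  have k'n: "k' x = (\<bar>k x\<bar> powr (2 - p) / (p * (p - 1))) * n x" if "x \<in> {a<..<b}" for x
    using nz[OF that] by (simp add: k'_def)
  have "k' absolutely_integrable_on {a<..<b}"
  proof (cases "\<forall>x\<in>{a<..<b}. 0 < n x")
    case True
    show ?thesis
    proof (intro nonnegative_absolutely_integrable_1 i)
      show "0 \<le> k' x" if "x \<in> {a<..<b}" for x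
        unfolding k'n[OF that] by (rule mult_nonneg_nonneg[OF less_imp_le[OF pos[OF that]] less_imp_le])
          (use True that in blast)
    qed
  next
    case False
    then have neg: "\<forall>x\<in>{a<..<b}. n x < 0"
      using constant_sign[of a b n] continuous_on_subset[OF n_cont s(2)] nz by blast
    have "(\<lambda>x. - k' x) absolutely_integrable_on {a<..<b}"
    proof (rule nonnegative_absolutely_integrable_1)
      show "(\<lambda>x. - k' x) integrable_on {a<..<b}" using i by (rule integrable_neg)
      show "0 \<le> - k' x" if "x \<in> {a<..<b}" for x
        unfolding k'n[OF that] neg_0_le_iff_le
        by (rule mult_nonneg_nonpos[OF less_imp_le[OF pos[OF that]] less_imp_le]) (use neg that in blast)
    qed
    then show ?thesis
      using absolutely_integrable_on_scaleR_iff[where c = "-1" and f = k' and S = "{a<..<b}"] by simp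
  qed
  then have "k' absolutely_integrable_on {a..b}" by (simp only: absolutely_integrable_on_Icc_iff_Ioo)
  with hi show ?thesis by (simp add: prim_def)
qed

text \<open>Between the extreme zeros \<open>u\<close> and \<open>v\<close> of \<open>k\<close>, a
  maximum of \<open>t\<close> sits at an end or at a point where \<open>t' = k * n\<close> is 0.
  Either way \<open>k\<close> vanishes there, so the maximum of \<open>t\<close> equals its lower
  bound \<open>- l\<close> and \<open>k\<close> vanishes on all of \<open>{u..v}\<close>. Outside,
  neither \<open>k\<close> nor \<open>n\<close> vanishes.\<close>

lemma prim_local:
  assumes ab: "0 \<le> a" "a \<le> b" "b \<le> L" and nk: "\<And>x. x \<in> {a..b} \<Longrightarrow> n x = 0 \<Longrightarrow> k x = 0"
  shows "prim a b"
proof (cases "\<exists>x\<in>{a..b}. k x = 0")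
  case False
  then show ?thesis using ab by (intro prim_nonzero) auto
next
  case True
  define Z where "Z = {x \<in> {a..b}. k x = 0}"
  have s: "{a..b} \<subseteq> {0..L}" using ab by auto
  have "closed Z"
    unfolding Z_def by (intro continuous_closed_preimage_constant continuous_on_subset[OF k_cont s] closed_atLeastAtMost)
  moreover have "bounded Z" unfolding Z_def by (rule bounded_subset[OF bounded_closed_interval[of a b]]) auto
  ultimately have Z: "compact Z" "Z \<noteq> {}" using True by (auto simp: compact_eq_bounded_closed Z_def)
  obtain u where u: "u \<in> Z" "\<And>x. x \<in> Z \<Longrightarrow> u \<le> x" using compact_attains_inf[OF Z] by auto
  obtain v where v: "v \<in> Z" "\<And>x. x \<in> Z \<Longrightarrow> x \<le> v" using compact_attains_sup[OF Z] by auto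
  have uv: "a \<le> u" "u \<le> v" "v \<le> b" "k u = 0" "k v = 0" using u v by (auto simp: Z_def)
  have "k x = 0" if x: "x \<in> {u..v}" for x
  proof -
    have suv: "{u..v} \<subseteq> {0..L}" using uv ab by auto
    obtain y where y: "y \<in> {u..v}" "\<And>x. x \<in> {u..v} \<Longrightarrow> t x \<le> t y"
      using continuous_attains_sup[of "{u..v}" t] continuous_on_subset[OF t_cont suv] uv by auto
    have "k y = 0"
    proof (cases "y = u \<or> y = v")
      case False
      with y(1) have y': "u < y" "y < v" "0 < y" "y < L" "y \<in> {0..L}" using uv ab by auto
      have "(t has_real_derivative k y * n y) (at y)"
        using t_deriv[OF y'(5)] y' by (simp add: at_within_Icc_at)
      then have "k y * n y = 0"
      proof (rule DERIV_local_max)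
        show "0 < min (y - u) (v - y)" using y' by simp
        show "\<forall>z. \<bar>y - z\<bar> < min (y - u) (v - y) \<longrightarrow> t z \<le> t y"
          by (intro allI impI y(2)) auto
      qed
      then show ?thesis using nk[of y] y(1) uv by auto
    qed (use uv in auto)
    then have "t x \<le> - l" using y(2)[OF x] k_eq_0_iff[of y] y(1) suv by auto
    then show ?thesis using t_ge[of x] k_eq_0_iff[of x] x suv by force
  qed
  then have "prim u v" using uv by (intro prim_zero) auto
  moreover have "prim a u"
  proof (rule prim_monotone)
    show "k x \<noteq> 0 \<and> n x \<noteq> 0" if "x \<in> {a<..<u}" for x
      using that u(2)[of x] nk[of x] uv by (force simp: Z_def)
  qed (use uv ab in auto)
  moreover have "prim v b"
  proof (rule prim_monotone)
    show "k x \<noteq> 0 \<and> n x \<noteq> 0" if "x \<in> {v<..<b}" for x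
      using that v(2)[of x] nk[of x] uv by (force simp: Z_def)
  qed (use uv ab in auto)
  ultimately show ?thesis using uv prim_combine by (meson order_trans)
qed

text \<open>If \<open>n x \<noteq> 0\<close>, continuity suffices. Otherwise
  \<open>n_t_square\<close> gives \<open>t y = t x\<close> or \<open>t y = - t x\<close> at any zero
  \<open>y\<close> of \<open>n\<close>; near \<open>x\<close> continuity excludes the second value
  unless the two coincide. Hence \<open>t y = - l\<close>, that is, \<open>k y = 0\<close>.\<close>

lemma locally_n_imp_k:
  assumes x: "x \<in> {0..L}" "k x = 0"
  shows "\<exists>d>0. \<forall>y\<in>{0..L}. \<bar>y - x\<bar> < d \<longrightarrow> n y = 0 \<longrightarrow> k y = 0"
proof (cases "n x = 0")
  case False
  then have "\<bar>n x\<bar> > 0" by simp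
  then obtain d where d: "d > 0" "\<And>y. y \<in> {0..L} \<Longrightarrow> dist y x < d \<Longrightarrow> dist (n y) (n x) < \<bar>n x\<bar>"
    using n_cont x(1) unfolding continuous_on_iff by blast
  have "n y \<noteq> 0" if "y \<in> {0..L}" "\<bar>y - x\<bar> < d" for y
    using d(2)[of y] that by (auto simp: dist_real_def)
  with d(1) show ?thesis by blast
next
  case True
  have sq: "(t y)\<^sup>2 = (t x)\<^sup>2" if "y \<in> {0..L}" "n y = 0" for y
    using n_t_square[OF that(1)] n_t_square[OF x(1)] that(2) True by simp
  have tx: "t x = - l" using k_eq_0_iff x by simp
  show ?thesis
  proof (cases "t x = 0")
    case True
    have "k y = 0" if "y \<in> {0..L}" "n y = 0" for y
      using sq[OF that] True tx k_eq_0_iff[OF that(1)] by simp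
    then show ?thesis by (intro exI[of _ 1]) auto
  next
    case False
    then have "\<bar>t x\<bar> > 0" by simp
    then obtain d where d: "d > 0" "\<And>y. y \<in> {0..L} \<Longrightarrow> dist y x < d \<Longrightarrow> dist (t y) (t x) < \<bar>t x\<bar>"
      using t_cont x(1) unfolding continuous_on_iff by blast
    have "k y = 0" if "y \<in> {0..L}" "\<bar>y - x\<bar> < d" "n y = 0" for y
    proof -
      have "\<bar>t y - t x\<bar> < \<bar>t x\<bar>" using d(2)[of y] that by (simp add: dist_real_def)
      moreover have "t y = t x \<or> t y = - t x" using sq[OF that(1,3)] by (simp add: power2_eq_iff)
      ultimately have "t y = t x" by auto
      then show ?thesis using tx k_eq_0_iff[OF that(1)] by simp
    qed
    with d(1) show ?thesis by blast
  qed
qed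

text \<open>\<open>prim_local\<close> works near zeros of \<open>k\<close> and
  \<open>prim_nonzero\<close> near all other points; the bisection principle joins the
  pieces.\<close>

lemma AC_on_k: "AC_on 0 L k k'"
proof (rule AC_onI)
  have P: "prim a b" if ab: "0 \<le> a" "a \<le> b" "b \<le> L" for a b
  proof -
    define P where "P u v \<longleftrightarrow> a \<le> u \<longrightarrow> u \<le> v \<longrightarrow> v \<le> b \<longrightarrow> prim u v" for u v
    have "P a b" using ab(2)
    proof (rule Bolzano)
      show "P u w" if "P u v" "P v w" "u \<le> v" "v \<le> w" for u v w
        using that prim_combine[of u v w] by (auto simp: P_def)
    next
      fix x assume "a \<le> x" "x \<le> b"
      then have x: "x \<in> {0..L}" using ab by auto
      show "\<exists>d>0. \<forall>u v. u \<le> x \<and> x \<le> v \<and> v - u < d \<longrightarrow> P u v"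
      proof (cases "k x = 0")
        case True
        then obtain d where d: "d > 0" "\<And>y. y \<in> {0..L} \<Longrightarrow> \<bar>y - x\<bar> < d \<Longrightarrow> n y = 0 \<Longrightarrow> k y = 0"
          using locally_n_imp_k[OF x] by blast
        have "P u v" if "u \<le> x \<and> x \<le> v \<and> v - u < d" for u v
          unfolding P_def using that ab by (intro impI prim_local d(2)) auto
        with d(1) show ?thesis by blast
      next
        case False
        then have "\<bar>k x\<bar> > 0" by simp
        then obtain d where d: "d > 0" "\<And>y. y \<in> {0..L} \<Longrightarrow> dist y x < d \<Longrightarrow> dist (k y) (k x) < \<bar>k x\<bar>"
          using k_cont x unfolding continuous_on_iff by blast
        have nz: "k y \<noteq> 0" if "y \<in> {0..L}" "\<bar>y - x\<bar> < d" for y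
          using d(2)[of y] that by (auto simp: dist_real_def)
        have "P u v" if "u \<le> x \<and> x \<le> v \<and> v - u < d" for u v
          unfolding P_def using that ab by (intro impI prim_nonzero nz) auto
        with d(1) show ?thesis by blast
      qed
    qed
    with ab show ?thesis by (simp add: P_def)
  qed
  show "k' absolutely_integrable_on {0..L}" using P[of 0 L] L by (simp add: prim_def)
  show "(k' has_integral k x - k 0) {0..x}" if "0 \<le> x" "x \<le> L" for x
    using P[of 0 x] that by (simp add: prim_def)
qed

end

section \<open>Analyticity\<close>

lemma open_ball_within_IccE:
  fixes f :: "real \<Rightarrow> 'a::metric_space"
  assumes "continuous_on S f" "x \<in> S" "open U" "f x \<in> U"
  obtains d where "d > 0" "\<And>y. y \<in> S \<Longrightarrow> \<bar>y - x\<bar> < d \<Longrightarrow> f y \<in> U"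
proof -
  obtain e where e: "e > 0" "ball (f x) e \<subseteq> U" using assms(3,4) open_contains_ball by blast
  obtain d where "d > 0" "\<And>y. y \<in> S \<Longrightarrow> dist y x < d \<Longrightarrow> dist (f y) (f x) < e"
    using assms(1,2) e(1) unfolding continuous_on_iff by blast
  with e that[of d] show ?thesis by (auto simp: dist_real_def dist_commute subset_eq)
qed

lemma vector_derivative_eq_imp_diff_const:
  fixes f g :: "real \<Rightarrow> 'a::real_normed_vector"
  assumes "convex S" "x0 \<in> S" "x \<in> S"
    and "\<And>x. x \<in> S \<Longrightarrow> (f has_vector_derivative h x) (at x within S)"
    and "\<And>x. x \<in> S \<Longrightarrow> (g has_vector_derivative h x) (at x within S)"
  shows "f x = g x + (f x0 - g x0)"
proof -
  have "((\<lambda>x. f x - g x) has_vector_derivative 0) (at x within S)" if "x \<in> S" for x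
    using has_vector_derivative_diff[OF assms(4,5)[OF that]] by simp
  from has_vector_derivative_zero_constant[OF assms(1) this]
  obtain c where "\<And>x. x \<in> S \<Longrightarrow> f x - g x = c" by blast
  then show ?thesis using assms(2,3) by (metis add.commute diff_add_cancel)
qed

lemma of_real_diff_has_vector_derivative:
  "((\<lambda>x. of_real (x - c)) has_vector_derivative (1::complex)) (at x within S)"
proof -
  have "((\<lambda>x. x - c) has_real_derivative 1) (at x within S)" by (auto intro!: derivative_eq_intros)
  from has_vector_derivative_of_real[OF this] show ?thesis by simp
qed

context elastica_system
begin

text \<open>Along the curve the primitive \<open>F\<close> of \<open>1 / f\<close> satisfies
  \<open>F (T x) = x + const\<close>: arclength is a holomorphic function of the tangent. Inverting
  it and integrating once more extends \<open>\<Gamma>\<close> to a disc around \<open>x0\<close>.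
  Identities are compared only on \<open>S\<close>, the part of \<open>{0..L}\<close> near
  \<open>x0\<close>, so an end point is treated like an interior one.\<close>

lemma analytic_where_k_nonzero:
  fixes \<Gamma> :: "real \<Rightarrow> complex"
  assumes \<Gamma>': "\<And>x. x \<in> {0..L} \<Longrightarrow> (\<Gamma> has_vector_derivative Complex (X x) (Y x)) (at x within {0..L})"
    and x0: "x0 \<in> {0..L}" "k x0 \<noteq> 0"
  shows "\<exists>r>0. \<exists>c. \<forall>x\<in>{0..L}. \<bar>x - x0\<bar> < r \<longrightarrow> (\<lambda>n. c n * of_real (x - x0) ^ n) sums \<Gamma> x"
proof -
  define T where "T x = Complex (X x) (Y x)" for x
  have T': "(T has_vector_derivative \<i> * of_real (k x) * T x) (at x within {0..L})" if "x \<in> {0..L}" for x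
  proof -
    have "((\<lambda>x. of_real (X x) + \<i> * of_real (Y x)) has_vector_derivative
        of_real (- k x * Y x) + \<i> * of_real (k x * X x)) (at x within {0..L})"
      using X_deriv[OF that] Y_deriv[OF that]
      by (intro has_vector_derivative_add has_vector_derivative_mult_right has_vector_derivative_of_real)
    then show ?thesis by (simp add: T_def[abs_def] Complex_eq algebra_simps)
  qed
  have T_cont: "continuous_on {0..L} T"
    using T' by (intro continuous_on_vector_derivative)
  have T_norm: "cmod (T x) = 1" if "x \<in> {0..L}" for x using unit[OF that] by (simp add: T_def cmod_def)
  \<comment> \<open>Near \<open>x0\<close> the sign of \<open>k\<close> is constant, so
    \<open>k\<close> is \<open>\<sigma>\<close> times the \<open>p\<close>-th root of
    \<open>E (T x)\<close>, an expression free of absolute values.\<close>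
  define \<sigma> where "\<sigma> = sgn (k x0)"
  define c where "c = Complex c1 c2"
  \<comment> \<open>On the unit circle \<open>Re (cnj c * z) = (cnj c * z + c / z) / 2\<close>, and the right-hand side is
    holomorphic in \<open>z\<close>.\<close>
  define E where "E z = (of_real l + (cnj c * z + c / z) / 2) / of_real (p - 1)" for z
  define f where "f z = \<i> * of_real \<sigma> * z * E z powr of_real (1 / p)" for z
  have ET: "E (T x) = of_real (\<bar>k x\<bar> powr p)" if x: "x \<in> {0..L}" for x
  proof -
    have "c / T x = c * cnj (T x)" using T_norm[OF x] complex_div_cnj[of c "T x"] by simp
    then have "(cnj c * T x + c / T x) / 2 = of_real (c1 * X x + c2 * Y x)"
      by (simp add: c_def T_def complex_eq_iff)
    then have "E (T x) = of_real (l + c1 * X x + c2 * Y x) / of_real (p - 1)"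
      by (simp only: E_def of_real_add add.assoc)
    also have "\<dots> = of_real ((p - 1) * \<bar>k x\<bar> powr p) / of_real (p - 1)" by (simp only: energy[OF x])
    also have "\<dots> = of_real (\<bar>k x\<bar> powr p)" using p by (simp add: of_real_mult)
    finally show ?thesis .
  qed
  \<comment> \<open>Positive real part keeps \<open>E z\<close> off the branch cut of the complex
    power, and \<open>z \<noteq> 0\<close> keeps \<open>c / z\<close> holomorphic; together they
    also make \<open>f\<close> zero-free.\<close>
  define U where "U = {z. z \<noteq> 0 \<and> 0 < Re (E z)}"
  have Econt: "continuous_on {z. z \<noteq> 0} (\<lambda>z. Re (E z))"
    unfolding E_def using p by (intro continuous_intros) auto
  have "U = {z. z \<noteq> 0} \<inter> (\<lambda>z. Re (E z)) -` {0<..}" by (auto simp: U_def)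
  moreover have "open ({z. z \<noteq> 0} \<inter> (\<lambda>z. Re (E z)) -` {0<..})"
  proof (rule continuous_open_preimage[OF Econt])
    have e: "{z::complex. z \<noteq> 0} = - {0}" by auto
    show "open {z::complex. z \<noteq> 0}" unfolding e by (rule open_Compl) simp
  qed simp
  ultimately have "open U" by simp
  moreover have Tx0: "T x0 \<in> U" using ET[OF x0(1)] x0(2) T_norm[OF x0(1)] by (auto simp: U_def)
  ultimately obtain e where e: "e > 0" "ball (T x0) e \<subseteq> U" using open_contains_ball by blast
  have f0: "f z \<noteq> 0" if "z \<in> U" for z using that x0(2) by (auto simp: f_def U_def \<sigma>_def sgn_if)
  have E_hol: "E holomorphic_on U" unfolding E_def[abs_def] using p by (intro holomorphic_intros) (auto simp: U_def)
  have "(\<lambda>z. 1 / f z) holomorphic_on U"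
    unfolding f_def
  proof (intro holomorphic_intros E_hol)
    show "E z \<notin> \<real>\<^sub>\<le>\<^sub>0" if "z \<in> U" for z using that by (auto simp: U_def complex_nonpos_Reals_iff)
    show "\<i> * of_real \<sigma> * z * E z powr of_real (1 / p) \<noteq> 0" if "z \<in> U" for z using f0[OF that] by (simp add: f_def)
  qed
  then have "(\<lambda>z. 1 / f z) holomorphic_on ball (T x0) e" using e(2) holomorphic_on_subset by blast
  from holomorphic_convex_primitive'[OF convex_ball open_ball this] obtain F
    where F: "\<And>z. z \<in> ball (T x0) e \<Longrightarrow> (F has_field_derivative 1 / f z) (at z within ball (T x0) e)" by blast
  then have F': "(F has_field_derivative 1 / f z) (at z)" if "z \<in> ball (T x0) e" for z
    using that by (metis at_within_open open_ball)
  have F_hol: "F holomorphic_on ball (T x0) e" unfolding holomorphic_on_open[OF open_ball] using F' by blast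
  have "deriv F (T x0) \<noteq> 0" using DERIV_imp_deriv[OF F'[of "T x0"]] e(1) f0[OF Tx0] by simp
  from has_complex_derivative_locally_injective[OF F_hol _ open_ball this] e(1)
  obtain s where s: "s > 0" "ball (T x0) s \<subseteq> ball (T x0) e" "inj_on F (ball (T x0) s)" by auto
  have F_hol_s: "F holomorphic_on ball (T x0) s" using F_hol s(2) holomorphic_on_subset by blast
  obtain g where g: "g holomorphic_on (F ` ball (T x0) s)" "\<And>z. z \<in> ball (T x0) s \<Longrightarrow> g (F z) = z"
    using holomorphic_has_inverse[OF F_hol_s open_ball s(3)] by metis
  have "open (F ` ball (T x0) s)" by (rule open_mapping_thm3[OF F_hol_s open_ball s(3)])
  then obtain q where q: "q > 0" "ball (F (T x0)) q \<subseteq> F ` ball (T x0) s"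
    using s(1) open_contains_ball[of "F ` ball (T x0) s"] by (metis centre_in_ball imageI)
  \<comment> \<open>The shift by \<open>F (T x0)\<close> centres the inverse at 0, so that its
    argument along the curve is \<open>x - x0\<close>.\<close>
  have "(\<lambda>z. g (F (T x0) + z)) holomorphic_on ball 0 q"
  proof (rule holomorphic_on_compose_gen[of "\<lambda>z. F (T x0) + z" _ g, unfolded o_def, OF _ g(1)])
    show "(\<lambda>z. F (T x0) + z) ` ball 0 q \<subseteq> F ` ball (T x0) s" using q(2) by (auto simp: dist_norm)
  qed (intro holomorphic_intros)
  note gF_hol = this
  from holomorphic_convex_primitive'[OF convex_ball open_ball this] obtain G
    where G: "\<And>z. z \<in> ball 0 q \<Longrightarrow> (G has_field_derivative g (F (T x0) + z)) (at z within ball 0 q)" by blast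
  then have G': "(G has_field_derivative g (F (T x0) + z)) (at z)" if "z \<in> ball 0 q" for z
    using that by (metis at_within_open open_ball)
  obtain d1 where d1: "d1 > 0" "\<And>y. y \<in> {0..L} \<Longrightarrow> \<bar>y - x0\<bar> < d1 \<Longrightarrow> T y \<in> ball (T x0) s"
    using open_ball_within_IccE[OF T_cont x0(1) open_ball, of "T x0" s] s(1) by auto
  have "open {v. 0 < \<sigma> * v}" by (intro open_Collect_less continuous_intros)
  moreover have "k x0 \<in> {v. 0 < \<sigma> * v}" using x0(2) by (simp add: \<sigma>_def sgn_mult_self_eq abs_sgn_eq sgn_if)
  ultimately obtain d2 where d2: "d2 > 0" "\<And>y. y \<in> {0..L} \<Longrightarrow> \<bar>y - x0\<bar> < d2 \<Longrightarrow> k y \<in> {v. 0 < \<sigma> * v}"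
    using open_ball_within_IccE[OF k_cont x0(1)] by blast
  \<comment> \<open>\<open>q\<close> is the radius on which the extension is holomorphic,
    \<open>d1\<close> keeps \<open>T\<close> where \<open>g\<close> inverts \<open>F\<close>, and
    \<open>d2\<close> keeps the sign of \<open>k\<close>.\<close>
  define r where "r = min q (min d1 d2)"
  define S where "S = {0..L} \<inter> {x0 - r<..<x0 + r}"
  have r: "r > 0" using q d1 d2 by (simp add: r_def)
  have S: "convex S" "S \<subseteq> {0..L}" "x0 \<in> S" using x0(1) r by (auto simp: S_def intro: convex_Int)
  have Snear: "x \<in> {0..L}" "\<bar>x - x0\<bar> < q" "\<bar>x - x0\<bar> < d1" "\<bar>x - x0\<bar> < d2" if "x \<in> S" for x
    using that by (auto simp: S_def r_def)
  have fT: "f (T x) = \<i> * of_real (k x) * T x" if "x \<in> S" for x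
  proof -
    have "0 < \<sigma> * k x" using d2(2)[OF Snear(1,4)[OF that]] by simp
    then have "\<sigma> * \<bar>k x\<bar> = k x" by (auto simp: \<sigma>_def sgn_if zero_less_mult_iff split: if_splits)
    moreover have "E (T x) powr of_real (1 / p) = of_real \<bar>k x\<bar>"
      unfolding ET[OF Snear(1)[OF that]] using p by (subst powr_of_real) (auto simp: powr_powr)
    ultimately show ?thesis unfolding f_def by (metis (no_types, lifting) mult.assoc mult.commute of_real_mult)
  qed
  have FT: "F (T x) = of_real x + (F (T x0) - of_real x0)" if "x \<in> S" for x
  proof (rule vector_derivative_eq_imp_diff_const[OF S(1,3) that])
    fix x assume x: "x \<in> S"
    have Tx: "T x \<in> ball (T x0) e" using d1(2)[OF Snear(1,3)[OF x]] s(2) by blast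
    have "((F \<circ> T) has_vector_derivative (\<i> * of_real (k x) * T x) * (1 / f (T x))) (at x within S)"
      by (rule field_vector_diff_chain_within[OF has_vector_derivative_within_subset[OF T'[OF Snear(1)[OF x]] S(2)]])
        (use F'[OF Tx] has_field_derivative_at_within in blast)
    moreover have "(\<i> * of_real (k x) * T x) * (1 / f (T x)) = 1"
      using fT[OF x] f0[OF subsetD[OF e(2) Tx]] by simp
    ultimately show "((\<lambda>x. F (T x)) has_vector_derivative 1) (at x within S)" by (simp add: o_def)
    show "(of_real has_vector_derivative (1::complex)) (at x within S)"
      using of_real_diff_has_vector_derivative[of 0 x S] by simp
  qed
  have \<Gamma>_eq: "\<Gamma> x = G (of_real (x - x0)) + (\<Gamma> x0 - G (of_real (x0 - x0)))" if "x \<in> S" for x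
  proof (rule vector_derivative_eq_imp_diff_const[OF S(1,3) that, where h = T])
    fix x assume x: "x \<in> S"
    show "(\<Gamma> has_vector_derivative T x) (at x within S)"
      using \<Gamma>'[OF Snear(1)[OF x]] S(2) has_vector_derivative_within_subset unfolding T_def by blast
    have "of_real (x - x0) \<in> ball (0::complex) q" using Snear(2)[OF x] by (simp add: dist_norm flip: of_real_diff)
    from G'[OF this] have G'': "(G has_field_derivative g (F (T x0) + of_real (x - x0)))
        (at (of_real (x - x0)) within (\<lambda>x. of_real (x - x0)) ` S)"
      by (rule has_field_derivative_at_within)
    have "((\<lambda>x. of_real (x - x0)) has_vector_derivative (1::complex)) (at x within S)"
      by (rule of_real_diff_has_vector_derivative)
    from field_vector_diff_chain_within[OF this G'']
    have "((\<lambda>x. G (of_real (x - x0))) has_vector_derivative g (F (T x0) + of_real (x - x0))) (at x within S)"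
      by (simp add: o_def)
    moreover have "g (F (T x0) + of_real (x - x0)) = T x"
    proof -
      have "F (T x0) + of_real (x - x0) = F (T x)" using FT[OF x] by simp
      then show ?thesis using g(2)[OF d1(2)[OF Snear(1,3)[OF x]]] by simp
    qed
    ultimately show "((\<lambda>x. G (of_real (x - x0))) has_vector_derivative T x) (at x within S)" by simp
  qed
  define H where "H z = G z + (\<Gamma> x0 - G (of_real (x0 - x0)))" for z
  have H: "H holomorphic_on ball 0 q"
  proof -
    have "G holomorphic_on ball 0 q" unfolding holomorphic_on_open[OF open_ball] using G' by blast
    then show ?thesis unfolding H_def[abs_def] by (intro holomorphic_intros)
  qed
  have sums: "(\<lambda>n. (deriv ^^ n) H 0 / fact n * of_real (x - x0) ^ n) sums \<Gamma> x" if "x \<in> {0..L}" "\<bar>x - x0\<bar> < r" for x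
  proof -
    have x: "x \<in> S" using that by (auto simp: S_def)
    have "of_real (x - x0) \<in> ball (0::complex) q" using Snear(2)[OF x] by (simp add: dist_norm flip: of_real_diff)
    from holomorphic_power_series[OF H this] show ?thesis
      unfolding H_def using \<Gamma>_eq[OF x] by simp
  qed
  show ?thesis
    by (rule exI[of _ r], rule conjI[OF r], rule exI[of _ "\<lambda>n. (deriv ^^ n) H 0 / fact n"]) (use sums in blast)
qed

lemma affine_where_k_zero:
  fixes \<Gamma> :: "real \<Rightarrow> complex"
  assumes \<Gamma>': "\<And>x. x \<in> {0..L} \<Longrightarrow> (\<Gamma> has_vector_derivative Complex (X x) (Y x)) (at x within {0..L})"
    and x0: "x0 \<in> {0..L}" and r: "r > 0" "\<And>x. x \<in> {0..L} \<Longrightarrow> \<bar>x - x0\<bar> < r \<Longrightarrow> k x = 0"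
    and x: "x \<in> {0..L}" "\<bar>x - x0\<bar> < r"
  shows "\<Gamma> x = \<Gamma> x0 + of_real (x - x0) * Complex (X x0) (Y x0)"
proof -
  define S where "S = {0..L} \<inter> {x0 - r<..<x0 + r}"
  have S: "convex S" "S \<subseteq> {0..L}" "x0 \<in> S" "x \<in> S" using x0 x r by (auto simp: S_def intro: convex_Int)
  have kS: "k y = 0" if "y \<in> S" for y using that r(2)[of y] by (auto simp: S_def)
  have const: "X y = 0 + (X x0 - 0)" "Y y = 0 + (Y x0 - 0)" if "y \<in> S" for y
  proof -
    have XY: "(X has_vector_derivative 0) (at z within S)" "(Y has_vector_derivative 0) (at z within S)" if "z \<in> S" for z
    proof -
      have "z \<in> {0..L}" using that S(2) by blast
      from X_deriv[OF this] Y_deriv[OF this] kS[OF that]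
      have "(X has_vector_derivative 0) (at z within {0..L})" "(Y has_vector_derivative 0) (at z within {0..L})"
        by (simp_all add: has_real_derivative_iff_has_vector_derivative)
      then show "(X has_vector_derivative 0) (at z within S)" "(Y has_vector_derivative 0) (at z within S)"
        using S(2) has_vector_derivative_within_subset by blast+
    qed
    show "X y = 0 + (X x0 - 0)"
      by (rule vector_derivative_eq_imp_diff_const[OF S(1,3) that, of X "\<lambda>_. 0" "\<lambda>_. 0"]) (use XY in auto)
    show "Y y = 0 + (Y x0 - 0)"
      by (rule vector_derivative_eq_imp_diff_const[OF S(1,3) that, of Y "\<lambda>_. 0" "\<lambda>_. 0"]) (use XY in auto)
  qed
  have "\<Gamma> x = of_real (x - x0) * Complex (X x0) (Y x0) + (\<Gamma> x0 - of_real (x0 - x0) * Complex (X x0) (Y x0))"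
  proof (rule vector_derivative_eq_imp_diff_const[OF S(1,3,4), where h = "\<lambda>_. Complex (X x0) (Y x0)"])
    fix y assume y: "y \<in> S"
    show "(\<Gamma> has_vector_derivative Complex (X x0) (Y x0)) (at y within S)"
      using has_vector_derivative_within_subset[OF \<Gamma>' S(2), of y] y S(2) const[OF y] by auto
    have "((\<lambda>x. of_real (x - x0)) has_vector_derivative (1::complex)) (at y within S)"
      by (rule of_real_diff_has_vector_derivative)
    from has_vector_derivative_mult_left[OF this]
    show "((\<lambda>x. of_real (x - x0) * Complex (X x0) (Y x0)) has_vector_derivative Complex (X x0) (Y x0)) (at y within S)"
      by simp
  qed
  then show ?thesis by simp
qed

end

section \<open>The first variation\<close>

text \<open>The exponent \<open>p > 1\<close> makes this hold at 0 too, where the quotient is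
  bounded by \<open>\<bar>h\<bar> powr (p - 1)\<close>; zeros of the curvature thus do not disturb
  the first variation.\<close>

lemma abs_powr_has_derivative:
  fixes v p :: real
  assumes "1 < p"
  shows "((\<lambda>v. \<bar>v\<bar> powr p) has_real_derivative p * \<bar>v\<bar> powr (p - 1) * sgn v) (at v)"
proof -
  consider "v > 0" | "v < 0" | "v = 0" by linarith
  then show ?thesis
  proof cases
    case 1
    have "((\<lambda>v. v powr p) has_real_derivative p * \<bar>v\<bar> powr (p - 1) * sgn v) (at v)"
      using 1 by (auto intro!: derivative_eq_intros)
    then show ?thesis
      by (rule has_field_derivative_transform_within_open[of _ _ _ "{0<..}"]) (use 1 in auto)
  next
    case 2
    have "((\<lambda>v. (- v) powr p) has_real_derivative p * \<bar>v\<bar> powr (p - 1) * sgn v) (at v)"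
      using 2 by (auto intro!: derivative_eq_intros)
    then show ?thesis
      by (rule has_field_derivative_transform_within_open[of _ _ _ "{..<0}"]) (use 2 in auto)
  next
    case 3
  have "((\<lambda>h::real. \<bar>h\<bar> powr (p - 1)) \<longlongrightarrow> 0) (at 0)"
    using assms by (intro tendsto_zero_powrI[where b = "p - 1"] tendsto_rabs_zero) auto
  then have "((\<lambda>h::real. \<bar>h\<bar> powr p / h) \<longlongrightarrow> 0) (at 0)"
  proof (rule Lim_null_comparison[rotated])
    show "\<forall>\<^sub>F h in at 0. norm (\<bar>h\<bar> powr p / h) \<le> \<bar>h\<bar> powr (p - 1)"
      by (auto simp: eventually_at_filter powr_diff)
  qed
  with 3 show ?thesis by (simp add: has_field_derivative_iff)
  qed
qed

section \<open>Differentiation under the integral sign\<close>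

lemma powr_le_2_powr_abs:
  fixes q s :: real
  assumes "1 / 2 \<le> q" "q \<le> 2" shows "q powr s \<le> 2 powr \<bar>s\<bar>"
proof (cases "s \<ge> 0")
  case True
  then show ?thesis using assms by (simp add: powr_mono2)
next
  case False
  have "q powr s \<le> (1 / 2) powr s" using False assms by (intro powr_mono2') auto
  also have "\<dots> = 2 powr \<bar>s\<bar>" using False by (simp add: powr_divide powr_minus_divide)
  finally show ?thesis .
qed

text \<open>\<open>K * \<bar>\<epsilon>\<bar> \<le> 1 / 4\<close> bounds the linear and the
  quadratic term by 1/4 each, so the squared speed stays within 1/2 of 1, uniformly along the
  curve.\<close>

lemma quadratic_near_1:
  fixes K :: real
  assumes K: "1 \<le> K" "\<bar>b1\<bar> \<le> K" "\<bar>b2\<bar> \<le> K" and e: "\<bar>\<epsilon>\<bar> \<le> 1 / (4 * K)"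
  shows "1 / 2 \<le> 1 + b1 * \<epsilon> + b2 * \<epsilon>\<^sup>2" "1 + b1 * \<epsilon> + b2 * \<epsilon>\<^sup>2 \<le> 2" "\<bar>\<epsilon>\<bar> \<le> 1" "\<bar>b1 + 2 * b2 * \<epsilon>\<bar> \<le> 3 * K"
proof -
  have e1: "K * \<bar>\<epsilon>\<bar> \<le> 1 / 4" using K e by (simp add: field_simps)
  have "\<bar>\<epsilon>\<bar> \<le> K * \<bar>\<epsilon>\<bar>" using K by (simp add: mult_le_cancel_right1)
  with e1 show e2: "\<bar>\<epsilon>\<bar> \<le> 1" by linarith
  have "\<bar>b1 * \<epsilon>\<bar> \<le> K * \<bar>\<epsilon>\<bar>" using K by (simp add: abs_mult mult_right_mono)
  moreover have "\<bar>b2 * \<epsilon>\<^sup>2\<bar> \<le> K * \<bar>\<epsilon>\<bar>"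
  proof -
    have "\<bar>b2 * \<epsilon>\<^sup>2\<bar> = \<bar>b2\<bar> * (\<bar>\<epsilon>\<bar> * \<bar>\<epsilon>\<bar>)" by (simp add: abs_mult power2_eq_square)
    also have "\<dots> \<le> K * (\<bar>\<epsilon>\<bar> * 1)" using K e2 by (intro mult_mono) auto
    finally show ?thesis by simp
  qed
  ultimately show "1 / 2 \<le> 1 + b1 * \<epsilon> + b2 * \<epsilon>\<^sup>2" "1 + b1 * \<epsilon> + b2 * \<epsilon>\<^sup>2 \<le> 2"
    using e1 by linarith+
  have "\<bar>b2 * \<epsilon>\<bar> \<le> K * 1" unfolding abs_mult using K e2 by (intro mult_mono) auto
  then show "\<bar>b1 + 2 * b2 * \<epsilon>\<bar> \<le> 3 * K" using K by linarith
qed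

text \<open>For a curve perturbed by \<open>\<epsilon> \<eta>\<close>, the determinant of the first two derivatives is
  \<open>a0 + a1 \<epsilon>\<close> when \<open>\<eta>\<close> has a fixed direction, and the squared speed is
  \<open>1 + b1 \<epsilon> + b2 \<epsilon>\<^sup>2\<close>. The bending density is \<open>bend\<close> with \<open>s = (1 - 3 p) / 2\<close>, the length density
  is \<open>bend\<close> with \<open>s = 1 / 2\<close>, \<open>a0 = 1\<close>, \<open>a1 = 0\<close>.\<close>

definition bend :: "real \<Rightarrow> real \<Rightarrow> real \<Rightarrow> real \<Rightarrow> real \<Rightarrow> real \<Rightarrow> real \<Rightarrow> real" where
  "bend p s a0 a1 b1 b2 \<epsilon> = \<bar>a0 + a1 * \<epsilon>\<bar> powr p * (1 + b1 * \<epsilon> + b2 * \<epsilon>\<^sup>2) powr s"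

lemma bend_has_derivative:
  assumes p: "1 < p" and q: "0 < 1 + b1 * \<epsilon> + b2 * \<epsilon>\<^sup>2"
  shows "(bend p s a0 a1 b1 b2 has_real_derivative
     p * \<bar>a0 + a1 * \<epsilon>\<bar> powr (p - 1) * sgn (a0 + a1 * \<epsilon>) * a1 * (1 + b1 * \<epsilon> + b2 * \<epsilon>\<^sup>2) powr s +
     \<bar>a0 + a1 * \<epsilon>\<bar> powr p * (s * (1 + b1 * \<epsilon> + b2 * \<epsilon>\<^sup>2) powr (s - 1) * (b1 + 2 * b2 * \<epsilon>))) (at \<epsilon>)"
proof -
  have "((\<lambda>\<epsilon>. a0 + a1 * \<epsilon>) has_real_derivative a1) (at \<epsilon>)" by (auto intro!: derivative_eq_intros)
  note d1 = DERIV_chain2[OF abs_powr_has_derivative[OF p] this]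
  have "((\<lambda>\<epsilon>. 1 + b1 * \<epsilon> + b2 * \<epsilon>\<^sup>2) has_real_derivative b1 + 2 * b2 * \<epsilon>) (at \<epsilon>)"
    by (auto intro!: derivative_eq_intros)
  note dq = this
  have dp: "((\<lambda>q. q powr s) has_real_derivative s * (1 + b1 * \<epsilon> + b2 * \<epsilon>\<^sup>2) powr (s - 1)) (at (1 + b1 * \<epsilon> + b2 * \<epsilon>\<^sup>2))"
    using q by (rule has_real_derivative_powr)
  have d2: "((\<lambda>\<epsilon>. (1 + b1 * \<epsilon> + b2 * \<epsilon>\<^sup>2) powr s) has_real_derivative
      s * (1 + b1 * \<epsilon> + b2 * \<epsilon>\<^sup>2) powr (s - 1) * (b1 + 2 * b2 * \<epsilon>)) (at \<epsilon>)"
    by (rule DERIV_chain2[OF dp dq])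
  show ?thesis using DERIV_mult'[OF d1 d2] unfolding bend_def[abs_def] by (simp add: algebra_simps)
qed

text \<open>A mean value estimate whose bound is homogeneous of degree \<open>p\<close> in
  \<open>m\<close>, so that \<open>m powr p\<close> can serve as integrable majorant. In the
  constant, \<open>2 powr p\<close> comes from
  \<open>\<bar>a0 + a1 * \<epsilon>\<bar> \<le> 2 * m\<close>, \<open>2 powr \<bar>s\<bar>\<close>
  from the squared speed lying in [1/2, 2], and \<open>6 * K\<close> is \<open>3 * K\<close> times
  the extra factor 2 due to the exponent \<open>s - 1\<close>.\<close>

lemma bend_Lipschitz:
  assumes p: "1 < p" and m: "\<bar>a0\<bar> \<le> m" "\<bar>a1\<bar> \<le> m" and K: "1 \<le> K" "\<bar>b1\<bar> \<le> K" "\<bar>b2\<bar> \<le> K"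
    and e: "\<bar>\<epsilon>\<bar> \<le> 1 / (4 * K)"
  shows "\<bar>bend p s a0 a1 b1 b2 \<epsilon> - bend p s a0 a1 b1 b2 0\<bar> \<le>
    ((p + 6 * K * \<bar>s\<bar>) * 2 powr \<bar>s\<bar> * 2 powr p) * m powr p * \<bar>\<epsilon>\<bar>"
proof -
  let ?q = "\<lambda>\<epsilon>. 1 + b1 * \<epsilon> + b2 * \<epsilon>\<^sup>2" and ?a = "\<lambda>\<epsilon>. a0 + a1 * \<epsilon>"
  let ?h' = "\<lambda>\<epsilon>. p * \<bar>?a \<epsilon>\<bar> powr (p - 1) * sgn (?a \<epsilon>) * a1 * ?q \<epsilon> powr s +
     \<bar>?a \<epsilon>\<bar> powr p * (s * ?q \<epsilon> powr (s - 1) * (b1 + 2 * b2 * \<epsilon>))"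
  define S where "S = {- (1 / (4 * K))..1 / (4 * K)}"
  have m0: "0 \<le> m" using m(1) by linarith
  have "norm (bend p s a0 a1 b1 b2 \<epsilon> - bend p s a0 a1 b1 b2 0) \<le>
    (((p + 6 * K * \<bar>s\<bar>) * 2 powr \<bar>s\<bar> * 2 powr p) * m powr p) * norm (\<epsilon> - 0)"
  proof (rule field_differentiable_bound[of S])
    show "convex S" by (simp add: S_def)
    show "\<epsilon> \<in> S" "0 \<in> S" using e K by (auto simp: S_def abs_le_iff)
    fix z assume "z \<in> S"
    then have z: "\<bar>z\<bar> \<le> 1 / (4 * K)" by (auto simp: S_def abs_le_iff)
    note q = quadratic_near_1[OF K z]
    show "(bend p s a0 a1 b1 b2 has_real_derivative ?h' z) (at z within S)"
    proof -
      have "0 < ?q z" using q(1) by linarith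
      from bend_has_derivative[OF p this, of s a0 a1] show ?thesis by (rule has_field_derivative_at_within)
    qed
    have a: "\<bar>?a z\<bar> \<le> 2 * m"
    proof -
      have "\<bar>a1 * z\<bar> \<le> m * 1" unfolding abs_mult using m q(3) m0 by (intro mult_mono) auto
      then show ?thesis using m(1) by linarith
    qed
    have pw: "\<bar>?a z\<bar> powr (p - 1) \<le> (2 * m) powr (p - 1)" "\<bar>?a z\<bar> powr p \<le> (2 * m) powr p"
      using a p by (auto intro!: powr_mono2)
    have "\<bar>p * \<bar>?a z\<bar> powr (p - 1) * sgn (?a z) * a1 * ?q z powr s\<bar> \<le> p * (2 * m) powr (p - 1) * 1 * (2 * m) * 2 powr \<bar>s\<bar>"
      unfolding abs_mult using p pw(1) m m0 powr_le_2_powr_abs[OF q(1,2), of s]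
      by (intro mult_mono mult_nonneg_nonneg) (auto simp: abs_sgn_eq)
    also have "\<dots> = p * (2 * m) powr p * 2 powr \<bar>s\<bar>"
    proof (cases "m = 0")
      case False
      then have "(2 * m) powr (p - 1) * (2 * m) = (2 * m) powr p" using m0 by (simp add: powr_diff)
      then show ?thesis by (simp add: mult_ac)
    qed simp
    finally have t1: "\<bar>p * \<bar>?a z\<bar> powr (p - 1) * sgn (?a z) * a1 * ?q z powr s\<bar> \<le> p * (2 * m) powr p * 2 powr \<bar>s\<bar>" .
    have "?q z powr (s - 1) \<le> 2 powr (\<bar>s\<bar> + 1)"
      by (rule order_trans[OF powr_le_2_powr_abs[OF q(1,2)]]) (intro powr_mono, auto)
    then have "\<bar>\<bar>?a z\<bar> powr p * (s * ?q z powr (s - 1) * (b1 + 2 * b2 * z))\<bar> \<le>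
        (2 * m) powr p * (\<bar>s\<bar> * 2 powr (\<bar>s\<bar> + 1) * (3 * K))"
      unfolding abs_mult using p pw(2) q(4) K
      by (intro mult_mono mult_nonneg_nonneg) auto
    also have "\<dots> = (2 * m) powr p * 2 powr \<bar>s\<bar> * (6 * K * \<bar>s\<bar>)" by (simp add: powr_add)
    finally have t2: "\<bar>\<bar>?a z\<bar> powr p * (s * ?q z powr (s - 1) * (b1 + 2 * b2 * z))\<bar> \<le> (2 * m) powr p * 2 powr \<bar>s\<bar> * (6 * K * \<bar>s\<bar>)" .
    have "norm (?h' z) \<le> p * (2 * m) powr p * 2 powr \<bar>s\<bar> + (2 * m) powr p * 2 powr \<bar>s\<bar> * (6 * K * \<bar>s\<bar>)"
      unfolding real_norm_def by (rule order_trans[OF abs_triangle_ineq add_mono[OF t1 t2]])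
    also have "(2 * m) powr p = 2 powr p * m powr p" using m0 by (simp add: powr_mult)
    finally show "norm (?h' z) \<le> ((p + 6 * K * \<bar>s\<bar>) * 2 powr \<bar>s\<bar> * 2 powr p) * m powr p"
      by (simp add: algebra_simps)
  qed
  then show ?thesis by simp
qed

text \<open>The difference quotients at 0 converge pointwise to \<open>V\<close> and are dominated
  by a multiple of \<open>m powr p\<close>, so dominated convergence applies along every null
  sequence in a fixed interval around 0.\<close>

lemma bend_integral_has_derivative:
  fixes a0 a1 b1 b2 m :: "real \<Rightarrow> real" and p s K a b :: real
  assumes p: "1 < p"
    and meas: "a0 \<in> borel_measurable (lebesgue_on {a..b})" "a1 \<in> borel_measurable (lebesgue_on {a..b})"
      "b1 \<in> borel_measurable (lebesgue_on {a..b})" "b2 \<in> borel_measurable (lebesgue_on {a..b})"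
    and m: "\<And>x. x \<in> {a..b} \<Longrightarrow> \<bar>a0 x\<bar> \<le> m x" "\<And>x. x \<in> {a..b} \<Longrightarrow> \<bar>a1 x\<bar> \<le> m x"
      "(\<lambda>x. m x powr p) integrable_on {a..b}"
    and K: "1 \<le> K" "\<And>x. x \<in> {a..b} \<Longrightarrow> \<bar>b1 x\<bar> \<le> K" "\<And>x. x \<in> {a..b} \<Longrightarrow> \<bar>b2 x\<bar> \<le> K"
  defines "V \<equiv> \<lambda>x. p * \<bar>a0 x\<bar> powr (p - 1) * sgn (a0 x) * a1 x + \<bar>a0 x\<bar> powr p * (s * b1 x)"
  shows "\<And>\<epsilon>. \<bar>\<epsilon>\<bar> \<le> 1 / (4 * K) \<Longrightarrow> (\<lambda>x. bend p s (a0 x) (a1 x) (b1 x) (b2 x) \<epsilon>) absolutely_integrable_on {a..b}"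
    and "V integrable_on {a..b}"
    and "((\<lambda>\<epsilon>. integral {a..b} (\<lambda>x. bend p s (a0 x) (a1 x) (b1 x) (b2 x) \<epsilon>)) has_real_derivative integral {a..b} V) (at 0)"
proof -
  let ?J = "\<lambda>\<epsilon> x. bend p s (a0 x) (a1 x) (b1 x) (b2 x) \<epsilon>"
  let ?C = "(p + 6 * K * \<bar>s\<bar>) * 2 powr \<bar>s\<bar> * 2 powr p"
  define \<delta> where "\<delta> = 1 / (4 * K)"
  have \<delta>: "\<delta> > 0" using K by (simp add: \<delta>_def)
  note meas [measurable]
  have mJ: "?J \<epsilon> \<in> borel_measurable (lebesgue_on {a..b})" for \<epsilon>
    unfolding bend_def by measurable
  have lip: "\<bar>?J \<epsilon> x - ?J 0 x\<bar> \<le> ?C * m x powr p * \<bar>\<epsilon>\<bar>" if "x \<in> {a..b}" "\<bar>\<epsilon>\<bar> \<le> \<delta>" for \<epsilon> x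
    using that by (intro bend_Lipschitz p m K) (auto simp: \<delta>_def)
  have J0: "\<bar>?J 0 x\<bar> \<le> m x powr p" if "x \<in> {a..b}" for x
    using m(1)[OF that] p by (simp add: bend_def powr_mono2)
  show int: "?J \<epsilon> absolutely_integrable_on {a..b}" if "\<bar>\<epsilon>\<bar> \<le> 1 / (4 * K)" for \<epsilon>
  proof (rule measurable_bounded_by_integrable_imp_absolutely_integrable[OF mJ])
    show "(\<lambda>x. (?C * \<bar>\<epsilon>\<bar> + 1) * m x powr p) integrable_on {a..b}" by (intro integrable_on_mult_right m)
    show "norm (?J \<epsilon> x) \<le> (?C * \<bar>\<epsilon>\<bar> + 1) * m x powr p" if x: "x \<in> {a..b}" for x
    proof -
      have "\<bar>?J \<epsilon> x - ?J 0 x\<bar> \<le> (?C * \<bar>\<epsilon>\<bar>) * m x powr p"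
        using lip[OF x, of \<epsilon>] \<open>\<bar>\<epsilon>\<bar> \<le> 1 / (4 * K)\<close> by (simp add: \<delta>_def mult_ac)
      with J0[OF x] have "\<bar>?J \<epsilon> x\<bar> \<le> (?C * \<bar>\<epsilon>\<bar>) * m x powr p + m x powr p" by linarith
      then show ?thesis by (simp add: distrib_right)
    qed
  qed simp
  have intH: "?J \<epsilon> integrable_on {a..b}" if "\<bar>\<epsilon>\<bar> \<le> \<delta>" for \<epsilon>
    using set_lebesgue_integral_eq_integral(1)[OF int] that unfolding \<delta>_def by blast
  have lim: "((\<lambda>\<epsilon>. (?J \<epsilon> x - ?J 0 x) / \<epsilon>) \<longlongrightarrow> V x) (at 0)" for x
    using bend_has_derivative[OF p, of "b1 x" 0 "b2 x" s "a0 x" "a1 x"]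
    by (simp add: has_field_derivative_iff V_def)
  have conv: "V integrable_on {a..b} \<and>
      (\<lambda>n. integral {a..b} (\<lambda>x. (?J (\<xi> n) x - ?J 0 x) / \<xi> n)) \<longlonglongrightarrow> integral {a..b} V"
    if \<xi>: "\<And>n. \<xi> n \<in> {-\<delta>..\<delta>} - {0}" "\<xi> \<longlonglongrightarrow> 0" for \<xi>
  proof -
    have \<xi>': "\<bar>\<xi> n\<bar> \<le> \<delta>" "\<xi> n \<noteq> 0" for n using \<xi>(1)[of n] by auto
    have i: "(\<lambda>x. (?J (\<xi> n) x - ?J 0 x) / \<xi> n) integrable_on {a..b}" for n
      using integrable_diff[OF intH[OF \<xi>'(1)] intH[of 0]] \<delta> by (intro integrable_on_divide) auto
    have h: "(\<lambda>x. ?C * m x powr p) integrable_on {a..b}" by (intro integrable_on_mult_right m)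
    have bd: "norm ((?J (\<xi> n) x - ?J 0 x) / \<xi> n) \<le> ?C * m x powr p" if "x \<in> {a..b}" for n x
      using lip[OF that \<xi>'(1)] \<xi>'(2) by (simp add: divide_le_eq mult_ac)
    have l: "(\<lambda>n. (?J (\<xi> n) x - ?J 0 x) / \<xi> n) \<longlonglongrightarrow> V x" for x
      by (rule filterlim_compose[OF lim]) (use \<xi> \<xi>' in \<open>auto simp: filterlim_at\<close>)
    show ?thesis using dominated_convergence[OF i h bd l] by blast
  qed
  \<comment> \<open>Integrability of the limit \<open>V\<close> is part of the conclusion of
    dominated convergence, so one concrete sequence yields it.\<close>
  have "(\<lambda>n. \<delta> / real (Suc n)) \<longlonglongrightarrow> 0"
    using tendsto_mult_right_zero[OF LIMSEQ_inverse_real_of_nat, of \<delta>] by (simp add: field_simps)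
  moreover have "\<delta> / real (Suc n) \<in> {-\<delta>..\<delta>} - {0}" for n
    using \<delta> by (auto simp: field_simps)
  ultimately show "V integrable_on {a..b}" using conv[of "\<lambda>n. \<delta> / real (Suc n)"] by blast
  have "((\<lambda>\<epsilon>. (integral {a..b} (?J \<epsilon>) - integral {a..b} (?J 0)) / (\<epsilon> - 0)) \<longlongrightarrow> integral {a..b} V) (at 0 within {-\<delta>..\<delta>})"
    unfolding tendsto_at_iff_sequentially
  proof (intro allI impI)
    fix \<xi> assume \<xi>: "\<forall>i. \<xi> i \<in> {-\<delta>..\<delta>} - {0}" "\<xi> \<longlonglongrightarrow> 0"
    have "integral {a..b} (\<lambda>x. (?J (\<xi> n) x - ?J 0 x) / \<xi> n) = (integral {a..b} (?J (\<xi> n)) - integral {a..b} (?J 0)) / \<xi> n" for n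
    proof -
      have "\<bar>\<xi> n\<bar> \<le> \<delta>" using \<xi>(1) by (auto simp: abs_le_iff minus_le_iff)
      from Henstock_Kurzweil_Integration.integral_diff[OF intH[OF this] intH[of 0]] \<delta> show ?thesis
        by (simp add: integral_divide)
    qed
    with conv[of \<xi>] \<xi> show "((\<lambda>\<epsilon>. (integral {a..b} (?J \<epsilon>) - integral {a..b} (?J 0)) / (\<epsilon> - 0)) \<circ> \<xi>) \<longlonglongrightarrow> integral {a..b} V"
      by (simp add: o_def)
  qed
  moreover have "at 0 within {-\<delta>..\<delta>} = at 0" using \<delta> by (intro at_within_Icc_at) auto
  ultimately show "((\<lambda>\<epsilon>. integral {a..b} (?J \<epsilon>)) has_real_derivative integral {a..b} V) (at 0)"
    by (simp add: has_field_derivative_iff)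
qed

section \<open>Absolutely continuous unit vector fields\<close>

lemma AC_on_AE_right_derivative:
  fixes f :: "real \<Rightarrow> 'a::euclidean_space"
  assumes f: "AC_on a b f g"
  shows "AE x in lebesgue_on {a<..<b}. ((\<lambda>h. (f (x + h) - f x) /\<^sub>R h) \<longlongrightarrow> g x) (at_right 0)"
proof -
  define G where "G x = (if x \<in> {a..b} then g x else 0)" for x
  have "G integrable_on UNIV"
    unfolding G_def integrable_restrict_UNIV
    using AC_on_absolutely_integrable[OF f] set_lebesgue_integral_eq_integral(1) by blast
  then have "G integrable_on cbox c d" for c d by (rule integrable_on_subcbox) auto
  then obtain N where N: "negligible N" "\<And>x e. x \<notin> N \<Longrightarrow> 0 < e \<Longrightarrow>
      (\<exists>d>0. \<forall>h. 0 < h \<and> h < d \<longrightarrow> norm (integral {x..x+h} G /\<^sub>R h - G x) < e)"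
    by (rule integrable_ccontinuous_explicit[of G]) auto
  show ?thesis
  proof (rule AE_lebesgue_on_IooI[OF N(1)])
    fix x assume x: "x \<in> {a<..<b} - N"
    show "((\<lambda>h. (f (x + h) - f x) /\<^sub>R h) \<longlongrightarrow> g x) (at_right 0)"
    proof (rule tendstoI)
      fix e :: real assume e: "e > 0"
      obtain d where d: "d > 0" "\<And>h. 0 < h \<Longrightarrow> h < d \<Longrightarrow> norm (integral {x..x+h} G /\<^sub>R h - G x) < e"
        using N(2)[of x e] x e by auto
      have "dist ((f (x + h) - f x) /\<^sub>R h) (g x) < e" if h: "0 < h" "h < min d (b - x)" for h
      proof -
        have "integral {x..x+h} G = integral {x..x+h} g"
          by (rule Henstock_Kurzweil_Integration.integral_cong) (use x h in \<open>auto simp: G_def\<close>)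
        also have "\<dots> = f (x + h) - f x"
          by (rule integral_unique[OF AC_on_has_integral[OF f]]) (use x h in auto)
        finally show ?thesis using d(2)[of h] h x by (simp add: dist_norm G_def)
      qed
      then show "\<forall>\<^sub>F h in at_right 0. dist ((f (x + h) - f x) /\<^sub>R h) (g x) < e"
        using d(1) x unfolding eventually_at_right_field by (intro exI[of _ "min d (b - x)"]) auto
    qed
  qed
qed

text \<open>\<open>(f (x + h) + f x) \<bullet> (f (x + h) - f x)\<close> is a difference of squared
  norms, hence 0. Dividing by \<open>h\<close> and letting \<open>h\<close> decrease to 0 uses only
  the one-sided derivative, which exists almost everywhere.\<close>

lemma AC_on_unit_orthogonal:
  fixes f :: "real \<Rightarrow> 'a::euclidean_space"
  assumes f: "AC_on a b f g" and u: "\<And>x. x \<in> {a..b} \<Longrightarrow> norm (f x) = 1"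
  shows "AE x in lebesgue_on {a<..<b}. f x \<bullet> g x = 0"
proof -
  obtain N where N: "negligible N" "\<And>x. x \<in> {a<..<b} - N \<Longrightarrow> ((\<lambda>h. (f (x + h) - f x) /\<^sub>R h) \<longlongrightarrow> g x) (at_right 0)"
    using AC_on_AE_right_derivative[OF f] by (rule AE_lebesgue_on_IooE) blast
  show ?thesis
  proof (rule AE_lebesgue_on_IooI[OF N(1)])
    fix x assume x: "x \<in> {a<..<b} - N"
    have h0: "((\<lambda>h. h) \<longlongrightarrow> 0) (at_right (0::real))" by (rule tendsto_ident_at)
    have ev: "\<forall>\<^sub>F h in at_right 0. 0 < h \<and> h < b - x"
      using x unfolding eventually_at_right_field by (intro exI[of _ "b - x"]) auto
    have lim1: "((\<lambda>h. h *\<^sub>R ((f (x + h) - f x) /\<^sub>R h) + f x) \<longlongrightarrow> 0 *\<^sub>R g x + f x) (at_right 0)"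
      by (intro tendsto_intros h0 N(2)[OF x])
    have "\<forall>\<^sub>F h in at_right 0. h *\<^sub>R ((f (x + h) - f x) /\<^sub>R h) + f x = f (x + h)"
      using ev by eventually_elim simp
    from Lim_transform_eventually[OF lim1 this] have "((\<lambda>h. f (x + h)) \<longlongrightarrow> f x) (at_right 0)" by simp
    then have "((\<lambda>h. (f (x + h) + f x) \<bullet> ((f (x + h) - f x) /\<^sub>R h)) \<longlongrightarrow> (f x + f x) \<bullet> g x) (at_right 0)"
      by (intro tendsto_intros N(2)[OF x])
    moreover have "((\<lambda>h. (f (x + h) + f x) \<bullet> ((f (x + h) - f x) /\<^sub>R h)) \<longlongrightarrow> 0) (at_right 0)"
    proof (rule tendsto_eventually, use ev in eventually_elim)
      case (elim h)
      have "norm (f (x + h)) = 1" "norm (f x) = 1" using x elim by (auto intro!: u)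
      then have "(f (x + h) + f x) \<bullet> (f (x + h) - f x) = 0"
        by (simp add: inner_simps inner_commute[of "f x" "f (x + h)"] norm_eq_1)
      then show ?case by simp
    qed
    ultimately have "(f x + f x) \<bullet> g x = 0" by (rule tendsto_unique[OF trivial_limit_at_right_real])
    then show "f x \<bullet> g x = 0" by (simp add: inner_add_left)
  qed
qed

lemma AC_on_has_vector_derivative:
  assumes f: "AC_on a b f g" and g: "continuous_on {a..b} g" and x: "x \<in> {a..b}"
  shows "(f has_vector_derivative g x) (at x within {a..b})"
proof -
  have d: "((\<lambda>u. f a + integral {a..u} g) has_vector_derivative 0 + g x) (at x within {a..b})"
    by (intro has_vector_derivative_add has_vector_derivative_const integral_has_vector_derivative g x)
  have "f u = f a + integral {a..u} g" if "u \<in> {a..b}" for u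
    using f that unfolding AC_on_def by blast
  from has_vector_derivative_transform[OF x this d] show ?thesis by simp
qed

lemma AC_on_bounded_linear:
  assumes f: "AC_on a b f g" and h: "bounded_linear h"
  shows "AC_on a b (\<lambda>x. h (f x)) (\<lambda>x. h (g x))"
proof (rule AC_onI)
  show "(\<lambda>x. h (g x)) absolutely_integrable_on {a..b}"
    using absolutely_integrable_linear[OF AC_on_absolutely_integrable[OF f] h] by (simp add: o_def)
  fix x assume "a \<le> x" "x \<le> b"
  then have "(g has_integral f x - f a) {a..x}" by (intro AC_on_has_integral[OF f]) auto
  from has_integral_linear[OF this h] show "((\<lambda>x. h (g x)) has_integral h (f x) - h (f a)) {a..x}"
    by (simp add: o_def bounded_linear.linear[OF h] linear_diff)
qed

lemma LINT_eq_integral_AE: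
  fixes f g :: "real \<Rightarrow> real"
  assumes g: "g absolutely_integrable_on {a..b}" and ae: "AE x in lebesgue_on {a<..<b}. f x = g x"
  shows "(LINT x|lebesgue_on {a<..<b}. f x) = integral {a..b} g"
proof -
  obtain N where N: "negligible N" "\<And>x. x \<in> {a<..<b} - N \<Longrightarrow> f x = g x"
    using ae by (rule AE_lebesgue_on_IooE) blast
  have n: "negligible (N \<union> {a, b})" using N(1) by simp
  have eq: "f x = g x" if "x \<in> {a..b} - (N \<union> {a, b})" for x using N(2)[of x] that by auto
  have f: "f absolutely_integrable_on {a..b}"
    by (rule absolutely_integrable_spike[OF g n]) (use eq in auto)
  then have "integrable (lebesgue_on {a<..<b}) f" by (simp only: integrable_lebesgue_on_Ioo_iff)
  then have "(LINT x|lebesgue_on {a<..<b}. f x) = integral {a<..<b} f" by (rule lebesgue_integral_eq_integral) simp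
  also have "\<dots> = integral {a..b} f" by (rule integral_open_interval_real[symmetric])
  also have "\<dots> = integral {a..b} g" by (rule integral_spike[OF n]) (use eq in auto)
  finally show ?thesis .
qed

section \<open>Energies of a perturbed unit-speed curve\<close>

lemma norm_real2: "norm (v :: real^2) = sqrt ((v $ 1)\<^sup>2 + (v $ 2)\<^sup>2)"
  by (simp add: norm_vec_def L2_set_def UNIV_2)

lemma AC_on_perturbation:
  fixes f :: "real \<Rightarrow> 'a::euclidean_space" and \<phi> :: "real \<Rightarrow> real"
  assumes f: "AC_on a b f g" and \<phi>: "test_function a b \<phi>"
  shows "AC_on a b (\<lambda>x. f x + \<epsilon> *\<^sub>R (\<phi> x *\<^sub>R e)) (\<lambda>x. g x + \<epsilon> *\<^sub>R (deriv \<phi> x *\<^sub>R e))"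
proof (rule AC_on_add[OF f AC_on_C1])
  show "continuous_on {a..b} (\<lambda>x. \<epsilon> *\<^sub>R (deriv \<phi> x *\<^sub>R e))"
    by (intro continuous_intros test_function_continuous[OF test_function_deriv[OF \<phi>]])
  fix x
  have "(\<phi> has_real_derivative deriv \<phi> x) (at x within {a..b})"
    by (rule has_field_derivative_at_within[OF test_function_has_derivative[OF \<phi>]])
  then have "((\<lambda>x. \<phi> x *\<^sub>R e) has_vector_derivative \<phi> x *\<^sub>R 0 + deriv \<phi> x *\<^sub>R e) (at x within {a..b})"
    by (intro has_vector_derivative_scaleR has_vector_derivative_const)
  from bounded_linear.has_vector_derivative[OF bounded_linear_scaleR_right this, of \<epsilon>]
  show "((\<lambda>x. \<epsilon> *\<^sub>R (\<phi> x *\<^sub>R e)) has_vector_derivative \<epsilon> *\<^sub>R (deriv \<phi> x *\<^sub>R e)) (at x within {a..b})"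
    by simp
qed

text \<open>\<open>d\<close> is the determinant of the first two derivatives and \<open>N\<close>
  the speed. The density is expressed through \<open>N\<^sup>2\<close> because the squared speed is
  polynomial in the perturbation parameter; \<open>1 - 3 * p\<close> collects the line element and
  the cube in the curvature.\<close>

lemma curvature_density_eq:
  fixes N d p :: real
  assumes "N > 0"
  shows "\<bar>d / N ^ 3\<bar> powr p * N = \<bar>d\<bar> powr p * (N\<^sup>2) powr ((1 - 3 * p) / 2)"
proof -
  have N: "N ^ n = N powr real n" for n using assms by (simp add: powr_realpow)
  have "\<bar>d / N ^ 3\<bar> powr p = \<bar>d\<bar> powr p / N powr (3 * p)"
    using assms by (simp add: abs_divide powr_divide N powr_powr del: powr_numeral)
  moreover have "(N\<^sup>2) powr ((1 - 3 * p) / 2) = N powr (1 - 3 * p)"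
  proof -
    have "2 * ((1 - 3 * p) / 2) = 1 - 3 * p" by simp
    then show ?thesis unfolding N by (simp only: powr_powr of_nat_numeral)
  qed
  moreover have "N powr (1 - 3 * p) = N / N powr (3 * p)" using assms by (simp add: powr_diff)
  ultimately show ?thesis by simp
qed

locale unit_speed_W2p =
  fixes p L :: real and \<gamma> T A :: "real \<Rightarrow> real^2"
  assumes p: "1 < p" and L: "0 < L"
    and \<gamma>: "AC_on 0 L \<gamma> T" and T: "AC_on 0 L T A" and A: "Lp_fun 0 L p A"
    and unit: "\<And>x. x \<in> {0..L} \<Longrightarrow> norm (T x) = 1"
begin

definition X :: "real \<Rightarrow> real" where "X x = T x $ 1"
definition Y :: "real \<Rightarrow> real" where "Y x = T x $ 2"
definition A1 :: "real \<Rightarrow> real" where "A1 x = A x $ 1"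
definition A2 :: "real \<Rightarrow> real" where "A2 x = A x $ 2"
definition \<kappa> :: "real \<Rightarrow> real" where "\<kappa> x = X x * A2 x - Y x * A1 x"
definition w :: "real \<Rightarrow> real" where "w x = sgn (\<kappa> x) * \<bar>\<kappa> x\<bar> powr (p - 1)"

lemma X_AC: "AC_on 0 L X A1" and Y_AC: "AC_on 0 L Y A2"
  using AC_on_bounded_linear[OF T bounded_linear_vec_nth]
  unfolding X_def[abs_def] Y_def[abs_def] A1_def[abs_def] A2_def[abs_def] by blast+

lemma X_cont: "continuous_on {0..L} X" and Y_cont: "continuous_on {0..L} Y"
  by (rule AC_on_continuous[OF X_AC]) (rule AC_on_continuous[OF Y_AC])

lemma XY: "x \<in> {0..L} \<Longrightarrow> (X x)\<^sup>2 + (Y x)\<^sup>2 = 1"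
  using unit[of x] by (simp add: norm_real2 X_def Y_def)

lemma XY_le: "x \<in> {0..L} \<Longrightarrow> \<bar>X x\<bar> \<le> 1" "x \<in> {0..L} \<Longrightarrow> \<bar>Y x\<bar> \<le> 1"
  using XY[of x] by (simp_all add: abs_le_square_iff[of _ 1, simplified] flip: abs_square_le_1)
    (smt (verit) zero_le_power2)+

text \<open>\<open>A\<close> is normal to the unit vector \<open>T\<close> almost everywhere, and
  \<open>\<kappa>\<close> is its coefficient along \<open>(- Y, X)\<close>: Frenet's equations
  before the curvature is known to be continuous.\<close>

lemma orthogonal: "AE x in lebesgue_on {0<..<L}. A1 x = - \<kappa> x * Y x \<and> A2 x = \<kappa> x * X x"
proof -
  obtain N where N: "negligible N" "\<And>x. x \<in> {0<..<L} - N \<Longrightarrow> T x \<bullet> A x = 0"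
    using AC_on_unit_orthogonal[OF T unit] by (rule AE_lebesgue_on_IooE) blast+
  show ?thesis
  proof (rule AE_lebesgue_on_IooI[OF N(1)])
    fix x assume x: "x \<in> {0<..<L} - N"
    have o: "X x * A1 x + Y x * A2 x = 0"
      using N(2)[OF x] by (simp add: inner_vec_def UNIV_2 X_def Y_def A1_def A2_def)
    have u: "X x * X x + Y x * Y x = 1" using XY[of x] x by (simp add: power2_eq_square)
    have "A1 x = A1 x * (X x * X x + Y x * Y x) - X x * (X x * A1 x + Y x * A2 x)" using o u by simp
    also have "\<dots> = - \<kappa> x * Y x" by (simp add: \<kappa>_def algebra_simps)
    finally have 1: "A1 x = - \<kappa> x * Y x" .
    have "A2 x = A2 x * (X x * X x + Y x * Y x) - Y x * (X x * A1 x + Y x * A2 x)" using o u by simp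
    also have "\<dots> = \<kappa> x * X x" by (simp add: \<kappa>_def algebra_simps)
    finally show "A1 x = - \<kappa> x * Y x \<and> A2 x = \<kappa> x * X x" using 1 by simp
  qed
qed

lemma measurable_XYA:
  "X \<in> borel_measurable (lebesgue_on {0..L})" "Y \<in> borel_measurable (lebesgue_on {0..L})"
  "A1 \<in> borel_measurable (lebesgue_on {0..L})" "A2 \<in> borel_measurable (lebesgue_on {0..L})"
  using X_cont Y_cont AC_on_absolutely_integrable[OF X_AC] AC_on_absolutely_integrable[OF Y_AC]
  by (auto intro: continuous_imp_measurable_on_sets_lebesgue absolutely_integrable_imp_borel_measurable)

text \<open>The summand 1 absorbs the terms of the perturbed curvature that do not contain
  \<open>A\<close>, and gives \<open>m powr (p - 1) \<le> m powr p\<close>.\<close>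

definition m :: "real \<Rightarrow> real" where "m x = 1 + \<bar>A1 x\<bar> + \<bar>A2 x\<bar>"

lemma m_powr_integrable: "(\<lambda>x. (c * m x) powr p) integrable_on {0..L}" if "0 \<le> c"
proof -
  have "integrable (lebesgue_on {0<..<L}) (\<lambda>x. norm (A x) powr p)" using A by (simp add: Lp_fun_def)
  then have "(\<lambda>x. norm (A x) powr p) integrable_on {0..L}"
    by (intro set_lebesgue_integral_eq_integral(1)) (simp only: integrable_lebesgue_on_Ioo_iff)
  then have i: "(\<lambda>x. (c * 3) powr p * (1 + norm (A x) powr p)) integrable_on {0..L}"
    by (intro integrable_on_mult_right integrable_add integrable_const_ivl)
  have "(\<lambda>x. (c * m x) powr p) absolutely_integrable_on {0..L}"
  proof (rule measurable_bounded_by_integrable_imp_absolutely_integrable[OF _ _ i])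
    note measurable_XYA [measurable]
    show "(\<lambda>x. (c * m x) powr p) \<in> borel_measurable (lebesgue_on {0..L})"
      unfolding m_def by measurable
    fix x assume "x \<in> {0..L}"
    have "m x \<le> 1 + 2 * norm (A x)"
      using component_le_norm_cart[of "A x" 1] component_le_norm_cart[of "A x" 2] by (simp add: m_def A1_def A2_def)
    also have "\<dots> \<le> 3 * max 1 (norm (A x))" by simp
    finally have "(c * m x) powr p \<le> (c * (3 * max 1 (norm (A x)))) powr p"
      using that p by (intro powr_mono2 mult_left_mono mult_nonneg_nonneg) (auto simp: m_def)
    also have "\<dots> = (c * 3) powr p * max 1 (norm (A x)) powr p"
      using that by (simp add: powr_mult mult.assoc)
    also have "\<dots> \<le> (c * 3) powr p * (1 + norm (A x) powr p)"
      by (intro mult_left_mono) (auto simp: max_def)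
    finally show "norm ((c * m x) powr p) \<le> (c * 3) powr p * (1 + norm (A x) powr p)" by simp
  qed simp
  then show ?thesis by (rule set_lebesgue_integral_eq_integral(1))
qed

lemma \<kappa>_le: "x \<in> {0..L} \<Longrightarrow> \<bar>\<kappa> x\<bar> \<le> m x"
proof -
  assume x: "x \<in> {0..L}"
  have "\<bar>X x * A2 x\<bar> \<le> 1 * \<bar>A2 x\<bar>" "\<bar>Y x * A1 x\<bar> \<le> 1 * \<bar>A1 x\<bar>"
    unfolding abs_mult using XY_le[OF x] by (intro mult_right_mono, simp, simp)+
  then show ?thesis unfolding \<kappa>_def m_def by linarith
qed

lemma measurable_\<kappa>: "\<kappa> \<in> borel_measurable (lebesgue_on {0..L})"
proof -
  note measurable_XYA [measurable]
  show ?thesis unfolding \<kappa>_def[abs_def] by measurable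
qed

lemma \<kappa>_powr_integrable: "(\<lambda>x. \<bar>\<kappa> x\<bar> powr p) absolutely_integrable_on {0..L}"
proof (rule measurable_bounded_by_integrable_imp_absolutely_integrable)
  note measurable_\<kappa> [measurable]
  show "(\<lambda>x. \<bar>\<kappa> x\<bar> powr p) \<in> borel_measurable (lebesgue_on {0..L})" by measurable
  show "(\<lambda>x. (1 * m x) powr p) integrable_on {0..L}" by (rule m_powr_integrable) simp
  show "norm (\<bar>\<kappa> x\<bar> powr p) \<le> (1 * m x) powr p" if "x \<in> {0..L}" for x
    using \<kappa>_le[OF that] p by (simp add: powr_mono2)
qed simp

lemma w_integrable: "w absolutely_integrable_on {0..L}"
proof (rule measurable_bounded_by_integrable_imp_absolutely_integrable)
  note measurable_\<kappa> [measurable]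
  show "w \<in> borel_measurable (lebesgue_on {0..L})" unfolding w_def[abs_def] by measurable
  show "(\<lambda>x. (1 * m x) powr p) integrable_on {0..L}" by (rule m_powr_integrable) simp
  show "norm (w x) \<le> (1 * m x) powr p" if "x \<in> {0..L}" for x
  proof -
    have "norm (w x) \<le> \<bar>\<kappa> x\<bar> powr (p - 1)" by (simp add: w_def abs_mult abs_sgn_eq)
    also have "\<dots> \<le> m x powr (p - 1)" using \<kappa>_le[OF that] p by (simp add: powr_mono2)
    also have "\<dots> \<le> m x powr p" by (rule powr_mono) (auto simp: m_def)
    finally show ?thesis by simp
  qed
qed simp

lemma signed_curvature_AE: "AE x in lebesgue_on {0<..<L}. signed_curvature 0 L \<gamma> x = \<kappa> x"
proof -
  have 1: "has_weak_derivative 0 L 1 \<gamma> T" using L by (intro has_weak_derivative_1 \<gamma>) simp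
  have 2: "has_weak_derivative 0 L 2 \<gamma> A"
    using has_weak_derivative_Suc[OF _ \<gamma> has_weak_derivative_1[OF _ T]] L by (simp add: numeral_2_eq_2)
  obtain N where N: "negligible N" "\<And>x. x \<in> {0<..<L} - N \<Longrightarrow> weak_deriv 0 L 1 \<gamma> x = T x"
    using weak_deriv_AE_eq[OF 1] by (rule AE_lebesgue_on_IooE) blast
  obtain N' where N': "negligible N'" "\<And>x. x \<in> {0<..<L} - N' \<Longrightarrow> weak_deriv 0 L 2 \<gamma> x = A x"
    using weak_deriv_AE_eq[OF 2] by (rule AE_lebesgue_on_IooE) blast
  show ?thesis
  proof (rule AE_lebesgue_on_IooI)
    show "negligible (N \<union> N')" using N N' by simp
    fix x assume x: "x \<in> {0<..<L} - (N \<union> N')"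
    then have "norm (T x) = 1" by (intro unit) auto
    with N(2)[of x] N'(2)[of x] x show "signed_curvature 0 L \<gamma> x = \<kappa> x"
      by (simp add: signed_curvature_def Let_def \<kappa>_def X_def Y_def A1_def A2_def)
  qed
qed

context
  fixes \<phi> :: "real \<Rightarrow> real" and e :: "real^2"
  assumes \<phi>: "test_function 0 L \<phi>"
begin

text \<open>The coefficient of \<open>\<epsilon>\<close> in the determinant of
  \<open>T + \<epsilon> \<phi>' e\<close> and \<open>A + \<epsilon> \<phi>'' e\<close>; the
  quadratic term vanishes because both increments are parallel to \<open>e\<close>. Likewise
  \<open>b1\<close> and \<open>b2\<close> expand the squared speed.\<close>

definition a1 :: "real \<Rightarrow> real" where
  "a1 x = deriv \<phi> x * (e $ 1 * A2 x - e $ 2 * A1 x) + deriv (deriv \<phi>) x * (X x * e $ 2 - Y x * e $ 1)"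
definition b1 :: "real \<Rightarrow> real" where "b1 x = 2 * deriv \<phi> x * (X x * e $ 1 + Y x * e $ 2)"
definition b2 :: "real \<Rightarrow> real" where "b2 x = (deriv \<phi> x)\<^sup>2 * ((e $ 1)\<^sup>2 + (e $ 2)\<^sup>2)"

lemma cont_deriv: "continuous_on S (deriv \<phi>)" "continuous_on S (deriv (deriv \<phi>))"
  by (rule test_function_continuous test_function_deriv \<phi>)+

lemma measurable_ab:
  "a1 \<in> borel_measurable (lebesgue_on {0..L})" "b1 \<in> borel_measurable (lebesgue_on {0..L})"
  "b2 \<in> borel_measurable (lebesgue_on {0..L})"
proof -
  have "deriv \<phi> \<in> borel_measurable (lebesgue_on {0..L})" "deriv (deriv \<phi>) \<in> borel_measurable (lebesgue_on {0..L})"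
    by (rule continuous_imp_measurable_on_sets_lebesgue[OF cont_deriv(1)], simp)
      (rule continuous_imp_measurable_on_sets_lebesgue[OF cont_deriv(2)], simp)
  note [measurable] = this measurable_XYA
  show "a1 \<in> borel_measurable (lebesgue_on {0..L})" unfolding a1_def[abs_def] by measurable
  show "b1 \<in> borel_measurable (lebesgue_on {0..L})" unfolding b1_def[abs_def] by measurable
  show "b2 \<in> borel_measurable (lebesgue_on {0..L})" unfolding b2_def[abs_def] by measurable
qed

lemma ab_bounds:
  obtains c K where "1 \<le> c" "1 \<le> K" "\<And>x. x \<in> {0..L} \<Longrightarrow> \<bar>a1 x\<bar> \<le> c * m x"
    "\<And>x. x \<in> {0..L} \<Longrightarrow> \<bar>b1 x\<bar> \<le> K" "\<And>x. x \<in> {0..L} \<Longrightarrow> \<bar>b2 x\<bar> \<le> K"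
proof -
  have "bounded (deriv \<phi> ` {0..L})" "bounded (deriv (deriv \<phi>) ` {0..L})"
    by (intro compact_imp_bounded compact_continuous_image cont_deriv compact_Icc)+
  then obtain U1 U2 where U1: "\<And>x. x \<in> {0..L} \<Longrightarrow> \<bar>deriv \<phi> x\<bar> \<le> U1"
    and U2: "\<And>x. x \<in> {0..L} \<Longrightarrow> \<bar>deriv (deriv \<phi>) x\<bar> \<le> U2"
    unfolding bounded_iff by fastforce
  define U where "U = U1 + U2"
  have "0 \<in> {0..L}" using L by simp
  then have pos: "0 \<le> U1" "0 \<le> U2" using U1 U2 abs_ge_zero order_trans by blast+
  have U: "\<bar>deriv \<phi> x\<bar> \<le> U" "\<bar>deriv (deriv \<phi>) x\<bar> \<le> U" if "x \<in> {0..L}" for x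
    using U1[OF that] U2[OF that] pos by (auto simp: U_def)
  define E where "E = \<bar>e $ 1\<bar> + \<bar>e $ 2\<bar>"
  have E: "0 \<le> E" "0 \<le> U" using pos by (auto simp: E_def U_def)
  show ?thesis
  proof (rule that[of "1 + U * E" "1 + 2 * U * E + U\<^sup>2 * E\<^sup>2"])
    show "1 \<le> 1 + U * E" "1 \<le> 1 + 2 * U * E + U\<^sup>2 * E\<^sup>2" using E by auto
    fix x assume x: "x \<in> {0..L}"
    have m1: "\<bar>e $ 1 * A2 x - e $ 2 * A1 x\<bar> \<le> E * (\<bar>A1 x\<bar> + \<bar>A2 x\<bar>)"
    proof -
      have "\<bar>e $ 1 * A2 x - e $ 2 * A1 x\<bar> \<le> \<bar>e $ 1\<bar> * \<bar>A2 x\<bar> + \<bar>e $ 2\<bar> * \<bar>A1 x\<bar>"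
        by (metis abs_mult abs_triangle_ineq4)
      also have "\<dots> \<le> E * \<bar>A2 x\<bar> + E * \<bar>A1 x\<bar>"
        by (intro add_mono mult_right_mono) (auto simp: E_def)
      finally show ?thesis by (simp add: algebra_simps)
    qed
    have XYe: "\<bar>X x * r\<bar> \<le> \<bar>r\<bar>" "\<bar>Y x * r\<bar> \<le> \<bar>r\<bar>" for r
      unfolding abs_mult
      by (rule mult_left_le_one_le[OF abs_ge_zero abs_ge_zero XY_le(1)[OF x]],
          rule mult_left_le_one_le[OF abs_ge_zero abs_ge_zero XY_le(2)[OF x]])
    have m2: "\<bar>X x * e $ 2 - Y x * e $ 1\<bar> \<le> E" "\<bar>X x * e $ 1 + Y x * e $ 2\<bar> \<le> E"
      using XYe(1)[of "e $ 2"] XYe(2)[of "e $ 1"] XYe(1)[of "e $ 1"] XYe(2)[of "e $ 2"]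
      unfolding E_def by linarith+
    have "\<bar>a1 x\<bar> \<le> \<bar>deriv \<phi> x\<bar> * \<bar>e $ 1 * A2 x - e $ 2 * A1 x\<bar> + \<bar>deriv (deriv \<phi>) x\<bar> * \<bar>X x * e $ 2 - Y x * e $ 1\<bar>"
      unfolding a1_def abs_mult[symmetric] by (rule abs_triangle_ineq)
    also have "\<dots> \<le> U * (E * (\<bar>A1 x\<bar> + \<bar>A2 x\<bar>)) + U * E"
      using U[OF x] E m1 m2 by (intro add_mono mult_mono) auto
    also have "\<dots> \<le> (1 + U * E) * m x" using E by (simp add: m_def algebra_simps)
    finally show "\<bar>a1 x\<bar> \<le> (1 + U * E) * m x" .
    have "\<bar>b1 x\<bar> \<le> 2 * (U * E)"
      unfolding b1_def abs_mult mult.assoc using U[OF x] m2(2) E by (intro mult_mono) auto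
    then show "\<bar>b1 x\<bar> \<le> 1 + 2 * U * E + U\<^sup>2 * E\<^sup>2" by (simp add: add_increasing2)
    have "\<bar>b2 x\<bar> = \<bar>deriv \<phi> x\<bar>\<^sup>2 * ((e $ 1)\<^sup>2 + (e $ 2)\<^sup>2)" by (simp add: b2_def)
    also have "\<dots> \<le> U\<^sup>2 * E\<^sup>2"
    proof (intro mult_mono power_mono U[OF x])
      show "(e $ 1)\<^sup>2 + (e $ 2)\<^sup>2 \<le> E\<^sup>2" by (simp add: E_def power2_sum)
    qed auto
    finally have "\<bar>b2 x\<bar> \<le> U\<^sup>2 * E\<^sup>2" .
    moreover have "0 \<le> 2 * U * E" using E by simp
    ultimately show "\<bar>b2 x\<bar> \<le> 1 + 2 * U * E + U\<^sup>2 * E\<^sup>2" by linarith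
  qed
qed

text \<open>The perturbed curve and its derivative are again absolutely continuous, so the chosen
  weak derivatives agree almost everywhere with explicit ones; positive squared speed permits the
  division in the curvature.\<close>

lemma perturbed_energies:
  assumes i1: "(\<lambda>x. bend p ((1 - 3 * p) / 2) (\<kappa> x) (a1 x) (b1 x) (b2 x) \<epsilon>) absolutely_integrable_on {0..L}"
    and i2: "(\<lambda>x. bend p (1 / 2) 1 0 (b1 x) (b2 x) \<epsilon>) absolutely_integrable_on {0..L}"
    and q: "\<And>x. x \<in> {0..L} \<Longrightarrow> 0 < 1 + b1 x * \<epsilon> + b2 x * \<epsilon>\<^sup>2"
  shows "bending_energy p 0 L (\<lambda>x. \<gamma> x + \<epsilon> *\<^sub>R (\<phi> x *\<^sub>R e)) =
      integral {0..L} (\<lambda>x. bend p ((1 - 3 * p) / 2) (\<kappa> x) (a1 x) (b1 x) (b2 x) \<epsilon>)"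
    and "curve_length 0 L (\<lambda>x. \<gamma> x + \<epsilon> *\<^sub>R (\<phi> x *\<^sub>R e)) =
      integral {0..L} (\<lambda>x. bend p (1 / 2) 1 0 (b1 x) (b2 x) \<epsilon>)"
proof -
  let ?\<gamma> = "\<lambda>x. \<gamma> x + \<epsilon> *\<^sub>R (\<phi> x *\<^sub>R e)"
  let ?T = "\<lambda>x. T x + \<epsilon> *\<^sub>R (deriv \<phi> x *\<^sub>R e)" and ?A = "\<lambda>x. A x + \<epsilon> *\<^sub>R (deriv (deriv \<phi>) x *\<^sub>R e)"
  have AC: "AC_on 0 L ?\<gamma> ?T" "AC_on 0 L ?T ?A"
    by (rule AC_on_perturbation[OF \<gamma> \<phi>]) (rule AC_on_perturbation[OF T test_function_deriv[OF \<phi>]])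
  have 1: "has_weak_derivative 0 L 1 ?\<gamma> ?T" using L by (intro has_weak_derivative_1 AC) simp
  have 2: "has_weak_derivative 0 L 2 ?\<gamma> ?A"
    using has_weak_derivative_Suc[OF _ AC(1) has_weak_derivative_1[OF _ AC(2)]] L by (simp add: numeral_2_eq_2)
  obtain N where N: "negligible N" "\<And>x. x \<in> {0<..<L} - N \<Longrightarrow> weak_deriv 0 L 1 ?\<gamma> x = ?T x"
    using weak_deriv_AE_eq[OF 1] by (rule AE_lebesgue_on_IooE) blast
  obtain N' where N': "negligible N'" "\<And>x. x \<in> {0<..<L} - N' \<Longrightarrow> weak_deriv 0 L 2 ?\<gamma> x = ?A x"
    using weak_deriv_AE_eq[OF 2] by (rule AE_lebesgue_on_IooE) blast
  have n: "negligible (N \<union> N')" using N N' by simp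
  have sq: "(norm (?T x))\<^sup>2 = 1 + b1 x * \<epsilon> + b2 x * \<epsilon>\<^sup>2" if "x \<in> {0..L}" for x
  proof -
    have "(norm (?T x))\<^sup>2 = (X x + \<epsilon> * (deriv \<phi> x * e $ 1))\<^sup>2 + (Y x + \<epsilon> * (deriv \<phi> x * e $ 2))\<^sup>2"
      by (simp add: norm_real2 X_def Y_def mult.assoc)
    also have "\<dots> = ((X x)\<^sup>2 + (Y x)\<^sup>2) + b1 x * \<epsilon> + b2 x * \<epsilon>\<^sup>2"
      by (simp add: b1_def b2_def power2_eq_square algebra_simps)
    finally show ?thesis using XY[OF that] by simp
  qed
  have pos: "norm (?T x) > 0" if "x \<in> {0..L}" for x
    using sq[OF that] q[OF that] by (metis norm_eq_zero norm_ge_zero order_less_le power_zero_numeral)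
  have det: "?T x $ 1 * ?A x $ 2 - ?T x $ 2 * ?A x $ 1 = \<kappa> x + a1 x * \<epsilon>" for x
    by (simp add: \<kappa>_def a1_def X_def Y_def A1_def A2_def algebra_simps)
  show "bending_energy p 0 L ?\<gamma> = integral {0..L} (\<lambda>x. bend p ((1 - 3 * p) / 2) (\<kappa> x) (a1 x) (b1 x) (b2 x) \<epsilon>)"
    unfolding bending_energy_def
  proof (rule LINT_eq_integral_AE[OF i1 AE_lebesgue_on_IooI[OF n]])
    fix x assume x: "x \<in> {0<..<L} - (N \<union> N')"
    then have x': "x \<in> {0..L}" by auto
    have sc: "signed_curvature 0 L ?\<gamma> x = (\<kappa> x + a1 x * \<epsilon>) / norm (?T x) ^ 3"
      unfolding signed_curvature_def Let_def using N(2)[of x] N'(2)[of x] x det[of x] by simp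
    have "\<bar>signed_curvature 0 L ?\<gamma> x\<bar> powr p * norm (weak_deriv 0 L 1 ?\<gamma> x) =
        \<bar>(\<kappa> x + a1 x * \<epsilon>) / norm (?T x) ^ 3\<bar> powr p * norm (?T x)"
      unfolding sc using N(2)[of x] x by simp
    also have "\<dots> = bend p ((1 - 3 * p) / 2) (\<kappa> x) (a1 x) (b1 x) (b2 x) \<epsilon>"
      unfolding curvature_density_eq[OF pos[OF x']] sq[OF x'] bend_def ..
    finally show "\<bar>signed_curvature 0 L ?\<gamma> x\<bar> powr p * norm (weak_deriv 0 L 1 ?\<gamma> x) =
        bend p ((1 - 3 * p) / 2) (\<kappa> x) (a1 x) (b1 x) (b2 x) \<epsilon>" .
  qed
  show "curve_length 0 L ?\<gamma> = integral {0..L} (\<lambda>x. bend p (1 / 2) 1 0 (b1 x) (b2 x) \<epsilon>)"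
    unfolding curve_length_def
  proof (rule LINT_eq_integral_AE[OF i2 AE_lebesgue_on_IooI[OF n]])
    fix x assume x: "x \<in> {0<..<L} - (N \<union> N')"
    then have x': "x \<in> {0..L}" by auto
    have "norm (weak_deriv 0 L 1 ?\<gamma> x) = sqrt ((norm (?T x))\<^sup>2)" using N(2)[of x] x by simp
    also have "\<dots> = bend p (1 / 2) 1 0 (b1 x) (b2 x) \<epsilon>"
      unfolding sq[OF x'] bend_def using q[OF x'] by (simp add: powr_half_sqrt)
    finally show "norm (weak_deriv 0 L 1 ?\<gamma> x) = bend p (1 / 2) 1 0 (b1 x) (b2 x) \<epsilon>" .
  qed
qed

text \<open>The coefficient \<open>1 - 2 * p\<close> is the sum of \<open>p\<close>, from the
  tangential part of the determinant via \<open>\<kappa> * w = \<bar>\<kappa>\<bar> powr p\<close>,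
  and \<open>1 - 3 * p\<close>, from the squared speed raised to half that power.\<close>

lemma first_variation:
  assumes d: "((\<lambda>\<epsilon>. bending_energy p 0 L (\<lambda>x. \<gamma> x + \<epsilon> *\<^sub>R (\<phi> x *\<^sub>R e))
      + l * curve_length 0 L (\<lambda>x. \<gamma> x + \<epsilon> *\<^sub>R (\<phi> x *\<^sub>R e))) has_real_derivative 0) (at 0)"
  shows "integral {0..L} (\<lambda>x. deriv (deriv \<phi>) x * (p * w x * (X x * e $ 2 - Y x * e $ 1)) +
     deriv \<phi> x * (((1 - 2 * p) * \<bar>\<kappa> x\<bar> powr p + l) * (X x * e $ 1 + Y x * e $ 2))) = 0"
proof -
  obtain c K where c: "1 \<le> c" "\<And>x. x \<in> {0..L} \<Longrightarrow> \<bar>a1 x\<bar> \<le> c * m x"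
    and K: "1 \<le> K" "\<And>x. x \<in> {0..L} \<Longrightarrow> \<bar>b1 x\<bar> \<le> K" "\<And>x. x \<in> {0..L} \<Longrightarrow> \<bar>b2 x\<bar> \<le> K"
    by (rule ab_bounds) blast
  have \<kappa>c: "\<bar>\<kappa> x\<bar> \<le> c * m x" if "x \<in> {0..L}" for x
  proof -
    have "m x \<le> c * m x" using c(1) by (simp add: mult_le_cancel_right1 m_def)
    with \<kappa>_le[OF that] show ?thesis by linarith
  qed
  have cm: "(\<lambda>x. (c * m x) powr p) integrable_on {0..L}" using c(1) by (intro m_powr_integrable) simp
  let ?s = "(1 - 3 * p) / 2"
  let ?V1 = "\<lambda>x. p * \<bar>\<kappa> x\<bar> powr (p - 1) * sgn (\<kappa> x) * a1 x + \<bar>\<kappa> x\<bar> powr p * (?s * b1 x)"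
  let ?V2 = "\<lambda>x. p * \<bar>1\<bar> powr (p - 1) * sgn 1 * 0 + \<bar>1\<bar> powr p * (1 / 2 * b1 x)"
  note B1 = bend_integral_has_derivative[where s = ?s, OF p measurable_\<kappa> measurable_ab \<kappa>c c(2) cm K]
  have i1: "(\<lambda>x. bend p ?s (\<kappa> x) (a1 x) (b1 x) (b2 x) \<epsilon>) absolutely_integrable_on {0..L}" if "\<bar>\<epsilon>\<bar> \<le> 1 / (4 * K)" for \<epsilon>
    by (rule B1(1)) (use that in auto)
  have V1: "?V1 integrable_on {0..L}" by (rule B1(2)) auto
  have D1: "((\<lambda>\<epsilon>. integral {0..L} (\<lambda>x. bend p ?s (\<kappa> x) (a1 x) (b1 x) (b2 x) \<epsilon>)) has_real_derivative integral {0..L} ?V1) (at 0)"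
    by (rule B1(3)) auto
  have one: "(\<lambda>x. 1) \<in> borel_measurable (lebesgue_on {0..L})" "(\<lambda>x. 0) \<in> borel_measurable (lebesgue_on {0..L})"
    by simp_all
  note B2 = bend_integral_has_derivative[where s = "1 / 2" and m = "\<lambda>_. 1" and ?a0.0 = "\<lambda>_. 1" and ?a1.0 = "\<lambda>_. 0",
      OF p one measurable_ab(2,3) _ _ _ K]
  have i2: "(\<lambda>x. bend p (1 / 2) 1 0 (b1 x) (b2 x) \<epsilon>) absolutely_integrable_on {0..L}" if "\<bar>\<epsilon>\<bar> \<le> 1 / (4 * K)" for \<epsilon>
    by (rule B2(1)) (use that in auto)
  have V2: "?V2 integrable_on {0..L}" by (rule B2(2)) auto
  have D2: "((\<lambda>\<epsilon>. integral {0..L} (\<lambda>x. bend p (1 / 2) 1 0 (b1 x) (b2 x) \<epsilon>)) has_real_derivative integral {0..L} ?V2) (at 0)"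
    by (rule B2(3)) auto
  have D: "((\<lambda>\<epsilon>. integral {0..L} (\<lambda>x. bend p ?s (\<kappa> x) (a1 x) (b1 x) (b2 x) \<epsilon>) +
      l * integral {0..L} (\<lambda>x. bend p (1 / 2) 1 0 (b1 x) (b2 x) \<epsilon>)) has_real_derivative
      integral {0..L} ?V1 + l * integral {0..L} ?V2) (at 0)"
    by (intro DERIV_add DERIV_cmult D1 D2)
  have eq: "bending_energy p 0 L (\<lambda>x. \<gamma> x + \<epsilon> *\<^sub>R (\<phi> x *\<^sub>R e)) + l * curve_length 0 L (\<lambda>x. \<gamma> x + \<epsilon> *\<^sub>R (\<phi> x *\<^sub>R e)) =
      integral {0..L} (\<lambda>x. bend p ?s (\<kappa> x) (a1 x) (b1 x) (b2 x) \<epsilon>) +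
      l * integral {0..L} (\<lambda>x. bend p (1 / 2) 1 0 (b1 x) (b2 x) \<epsilon>)" if "\<epsilon> \<in> {- (1 / (4 * K))<..<1 / (4 * K)}" for \<epsilon>
  proof -
    have \<epsilon>: "\<bar>\<epsilon>\<bar> \<le> 1 / (4 * K)" using that by (simp add: abs_le_iff)
    have "0 < 1 + b1 x * \<epsilon> + b2 x * \<epsilon>\<^sup>2" if "x \<in> {0..L}" for x
      using quadratic_near_1(1)[OF K(1) K(2,3)[OF that] \<epsilon>] by linarith
    then show ?thesis using perturbed_energies[OF i1[OF \<epsilon>] i2[OF \<epsilon>]] by simp
  qed
  have "((\<lambda>\<epsilon>. integral {0..L} (\<lambda>x. bend p ?s (\<kappa> x) (a1 x) (b1 x) (b2 x) \<epsilon>) +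
      l * integral {0..L} (\<lambda>x. bend p (1 / 2) 1 0 (b1 x) (b2 x) \<epsilon>)) has_real_derivative 0) (at 0)"
    by (rule has_field_derivative_transform_within_open[OF d, of "{- (1 / (4 * K))<..<1 / (4 * K)}"])
      (use K(1) eq in auto)
  from DERIV_unique[OF this D] have z: "integral {0..L} ?V1 + l * integral {0..L} ?V2 = 0" by simp
  have "integral {0..L} (\<lambda>x. ?V1 x + l * ?V2 x) = integral {0..L} ?V1 + l * integral {0..L} ?V2"
    using integral_unique[OF has_integral_add[OF integrable_integral[OF V1]
          has_integral_mult_right[OF integrable_integral[OF V2], of l]]] .
  also note z
  finally have z': "integral {0..L} (\<lambda>x. ?V1 x + l * ?V2 x) = 0" .
  obtain N where N: "negligible N" "\<And>x. x \<in> {0<..<L} - N \<Longrightarrow> A1 x = - \<kappa> x * Y x \<and> A2 x = \<kappa> x * X x"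
    using orthogonal by (rule AE_lebesgue_on_IooE) blast
  have "integral {0..L} (\<lambda>x. deriv (deriv \<phi>) x * (p * w x * (X x * e $ 2 - Y x * e $ 1)) +
     deriv \<phi> x * (((1 - 2 * p) * \<bar>\<kappa> x\<bar> powr p + l) * (X x * e $ 1 + Y x * e $ 2))) =
     integral {0..L} (\<lambda>x. ?V1 x + l * ?V2 x)"
  proof (rule integral_spike)
    show "negligible (N \<union> {0, L})" using N(1) by simp
    fix x assume x: "x \<in> {0..L} - (N \<union> {0, L})"
    then have x': "x \<in> {0<..<L} - N" by auto
    have AA: "A1 x = - \<kappa> x * Y x" "A2 x = \<kappa> x * X x" using N(2)[OF x'] by auto
    have wk: "\<bar>\<kappa> x\<bar> powr (p - 1) * sgn (\<kappa> x) * \<kappa> x = \<bar>\<kappa> x\<bar> powr p"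
    proof (cases "\<kappa> x = 0")
      case False
      have "\<bar>\<kappa> x\<bar> powr (p - 1) * sgn (\<kappa> x) * \<kappa> x = \<bar>\<kappa> x\<bar> powr (p - 1) * \<bar>\<kappa> x\<bar>"
        by (simp add: abs_sgn mult_ac)
      also have "\<dots> = \<bar>\<kappa> x\<bar> powr p" using False by (simp add: powr_diff)
      finally show ?thesis .
    qed simp
    have a1: "a1 x = deriv \<phi> x * (\<kappa> x * (X x * e $ 1 + Y x * e $ 2)) + deriv (deriv \<phi>) x * (X x * e $ 2 - Y x * e $ 1)"
      unfolding a1_def AA by (simp add: algebra_simps)
    have V1: "?V1 x = p * (\<bar>\<kappa> x\<bar> powr (p - 1) * sgn (\<kappa> x) * \<kappa> x) * deriv \<phi> x * (X x * e $ 1 + Y x * e $ 2) +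
      p * w x * deriv (deriv \<phi>) x * (X x * e $ 2 - Y x * e $ 1) + \<bar>\<kappa> x\<bar> powr p * (?s * b1 x)"
      unfolding a1 w_def by (simp add: algebra_simps)
    show "?V1 x + l * ?V2 x = deriv (deriv \<phi>) x * (p * w x * (X x * e $ 2 - Y x * e $ 1)) +
     deriv \<phi> x * (((1 - 2 * p) * \<bar>\<kappa> x\<bar> powr p + l) * (X x * e $ 1 + Y x * e $ 2))"
    proof -
      have s: "?s * b1 x = (1 - 3 * p) * deriv \<phi> x * (X x * e $ 1 + Y x * e $ 2)" by (simp add: b1_def)
      have V2: "?V2 x = deriv \<phi> x * (X x * e $ 1 + Y x * e $ 2)" by (simp add: b1_def)
      show ?thesis unfolding V1 V2 unfolding wk s by (simp add: algebra_simps)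
    qed
  qed
  with z' show ?thesis by simp
qed

end

end

section \<open>Regularity\<close>

lemma continuous_sgn_abs_powr:
  fixes q :: real
  assumes q: "0 < q" shows "continuous_on UNIV (\<lambda>v. sgn v * \<bar>v\<bar> powr q)"
proof -
  have "isCont (\<lambda>v. sgn v * \<bar>v\<bar> powr q) v" for v
  proof (cases "v = 0")
    case False
    then show ?thesis using sgn_abs_powr_has_derivative DERIV_isCont by blast
  next
    case True
    have "((\<lambda>h::real. \<bar>h\<bar> powr q) \<longlongrightarrow> 0) (at 0)"
      using q by (intro tendsto_zero_powrI[where b = q] tendsto_rabs_zero) auto
    then have "((\<lambda>h::real. sgn h * \<bar>h\<bar> powr q) \<longlongrightarrow> 0) (at 0)"
      by (rule Lim_null_comparison[rotated]) (simp add: abs_mult abs_sgn_eq)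
    with True show ?thesis by (simp add: isCont_def)
  qed
  then show ?thesis by (simp add: continuous_on_eq_continuous_at)
qed

lemma Lp_fun_1:
  fixes f :: "real \<Rightarrow> 'a::euclidean_space"
  assumes "f absolutely_integrable_on {a..b}" shows "Lp_fun a b 1 f"
proof -
  have "integrable (lebesgue_on {a<..<b}) f" using assms by (simp only: integrable_lebesgue_on_Ioo_iff)
  then show ?thesis by (auto simp: Lp_fun_def)
qed

lemma real2_eq_axis: "(v :: real^2) = (v $ 1) *\<^sub>R axis 1 1 + (v $ 2) *\<^sub>R axis 2 1"
  by (simp add: vec_eq_iff forall_2 axis_def)

context unit_speed_W2p
begin

text \<open>\<open>M = (M1, M2)\<close> is the continuous representative of \<open>p w N\<close>.
  Differentiating its normal component gives \<open>w_deriv\<close>; its tangential component is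
  identically 0, and differentiating that gives \<open>energy\<close>.\<close>

lemma elastica_imp_system:
  assumes el: "\<And>\<phi> e. test_function 0 L \<phi> \<Longrightarrow>
     ((\<lambda>\<epsilon>. bending_energy p 0 L (\<lambda>x. \<gamma> x + \<epsilon> *\<^sub>R (\<phi> x *\<^sub>R e))
        + l * curve_length 0 L (\<lambda>x. \<gamma> x + \<epsilon> *\<^sub>R (\<phi> x *\<^sub>R e))) has_real_derivative 0) (at 0)"
  obtains c1 c2 k where "elastica_system p L l c1 c2 k X Y"
    "AE x in lebesgue_on {0<..<L}. k x = \<kappa> x"
    "AE x in lebesgue_on {0<..<L}. A1 x = - k x * Y x \<and> A2 x = k x * X x"
proof -
  define \<beta> where "\<beta> x = (1 - 2 * p) * \<bar>\<kappa> x\<bar> powr p + l" for x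
  have iw: "(\<lambda>x. u x * (p * w x)) absolutely_integrable_on {0..L}" if "continuous_on {0..L} u" for u
    using absolutely_integrable_continuous_scaleR[OF that, of "\<lambda>x. p * w x"] w_integrable
      absolutely_integrable_on_scaleR_iff[where c = p and f = w and S = "{0..L}"] by simp
  have i\<beta>: "(\<lambda>x. u x * \<beta> x) absolutely_integrable_on {0..L}" if u: "continuous_on {0..L} u" for u
  proof -
    have 1: "(\<lambda>x. (1 - 2 * p) *\<^sub>R \<bar>\<kappa> x\<bar> powr p) absolutely_integrable_on {0..L}"
      by (rule absolutely_integrable_on_scaleR_iff[THEN iffD2, OF disjI2[OF \<kappa>_powr_integrable]])
    have 2: "(\<lambda>x. l) absolutely_integrable_on {0..L}"
      by (intro absolutely_integrable_continuous_real continuous_intros)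
    from set_integral_add(1)[OF 1 2] have "\<beta> absolutely_integrable_on {0..L}"
      by (simp only: \<beta>_def[abs_def] real_scaleR_def)
    from absolutely_integrable_continuous_scaleR[OF u this] show ?thesis by simp
  qed
  have eq: "integral {0..L} (\<lambda>x. deriv (deriv \<phi>) x *\<^sub>R ((X x * e $ 2 - Y x * e $ 1) * (p * w x))) +
     integral {0..L} (\<lambda>x. deriv \<phi> x *\<^sub>R ((X x * e $ 1 + Y x * e $ 2) * \<beta> x)) = 0"
    if \<phi>: "test_function 0 L \<phi>" for \<phi> and e :: "real^2"
  proof -
    have cF: "continuous_on {0..L} (\<lambda>x. X x * e $ 2 - Y x * e $ 1)" "continuous_on {0..L} (\<lambda>x. X x * e $ 1 + Y x * e $ 2)"
      by (intro continuous_intros X_cont Y_cont)+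
    have i1: "(\<lambda>x. deriv (deriv \<phi>) x *\<^sub>R ((X x * e $ 2 - Y x * e $ 1) * (p * w x))) integrable_on {0..L}"
      by (rule set_lebesgue_integral_eq_integral(1)[OF absolutely_integrable_continuous_scaleR[OF cont_deriv(2)[OF \<phi>] iw[OF cF(1)]]])
    have i2: "(\<lambda>x. deriv \<phi> x *\<^sub>R ((X x * e $ 1 + Y x * e $ 2) * \<beta> x)) integrable_on {0..L}"
      by (rule set_lebesgue_integral_eq_integral(1)[OF absolutely_integrable_continuous_scaleR[OF cont_deriv(1)[OF \<phi>] i\<beta>[OF cF(2)]]])
    have "integral {0..L} (\<lambda>x. deriv (deriv \<phi>) x *\<^sub>R ((X x * e $ 2 - Y x * e $ 1) * (p * w x)) +
        deriv \<phi> x *\<^sub>R ((X x * e $ 1 + Y x * e $ 2) * \<beta> x)) = 0"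
      using first_variation[OF \<phi> el[OF \<phi>, of e]] by (simp add: \<beta>_def mult_ac)
    then show ?thesis unfolding Henstock_Kurzweil_Integration.integral_add[OF i1 i2] .
  qed
  have mY: "continuous_on {0..L} (\<lambda>x. - Y x)" by (intro continuous_intros Y_cont)
  \<comment> \<open>The two unit vectors as directions \<open>e\<close> pick out the components of
    \<open>N = (- Y, X)\<close> and \<open>T = (X, Y)\<close>.\<close>
  have "integral {0..L} (\<lambda>x. deriv (deriv \<phi>) x *\<^sub>R (- Y x * (p * w x))) +
     integral {0..L} (\<lambda>x. deriv \<phi> x *\<^sub>R (X x * \<beta> x)) = 0" if "test_function 0 L \<phi>" for \<phi>
    using eq[OF that, of "axis 1 1"] by (simp add: axis_def)
  from du_Bois_Reymond_second_order[OF L iw[OF mY] i\<beta>[OF X_cont] this]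
  obtain M1 c1 where M1: "AC_on 0 L M1 (\<lambda>x. X x * \<beta> x + c1)"
    "AE x in lebesgue_on {0<..<L}. - Y x * (p * w x) = M1 x" by blast
  have "integral {0..L} (\<lambda>x. deriv (deriv \<phi>) x *\<^sub>R (X x * (p * w x))) +
     integral {0..L} (\<lambda>x. deriv \<phi> x *\<^sub>R (Y x * \<beta> x)) = 0" if "test_function 0 L \<phi>" for \<phi>
    using eq[OF that, of "axis 2 1"] by (simp add: axis_def)
  from du_Bois_Reymond_second_order[OF L iw[OF X_cont] i\<beta>[OF Y_cont] this]
  obtain M2 c2 where M2: "AC_on 0 L M2 (\<lambda>x. Y x * \<beta> x + c2)"
    "AE x in lebesgue_on {0<..<L}. X x * (p * w x) = M2 x" by blast
  obtain N1 where N1: "negligible N1" "\<And>x. x \<in> {0<..<L} - N1 \<Longrightarrow> - Y x * (p * w x) = M1 x"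
    using M1(2) by (rule AE_lebesgue_on_IooE) blast
  obtain N2 where N2: "negligible N2" "\<And>x. x \<in> {0<..<L} - N2 \<Longrightarrow> X x * (p * w x) = M2 x"
    using M2(2) by (rule AE_lebesgue_on_IooE) blast
  have N: "negligible (N1 \<union> N2)" using N1 N2 by simp
  \<comment> \<open>The normal component of \<open>M\<close> divided by \<open>p\<close> is a
    continuous representative of \<open>w\<close>; the signed power \<open>1 / (p - 1)\<close> then
    inverts the one in the definition of \<open>w\<close>.\<close>
  define W where "W x = (M2 x * X x - M1 x * Y x) / p" for x
  define k where "k x = sgn (W x) * \<bar>W x\<bar> powr (1 / (p - 1))" for x
  have W_cont: "continuous_on {0..L} W"
    unfolding W_def[abs_def] using p
    by (intro continuous_intros AC_on_continuous[OF M1(1)] AC_on_continuous[OF M2(1)] X_cont Y_cont) auto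
  have k_cont: "continuous_on {0..L} k"
    unfolding k_def[abs_def] using p
    by (intro continuous_on_compose2[OF continuous_sgn_abs_powr W_cont, of "1 / (p - 1)", simplified]) auto
  have Wk: "sgn (k x) * \<bar>k x\<bar> powr (p - 1) = W x" for x
    using sgn_abs_powr_inverse[of "1 / (p - 1)" "W x"] p by (simp add: k_def)
  have W_eq: "W x = w x" if "x \<in> {0<..<L} - (N1 \<union> N2)" for x
  proof -
    have M: "M1 x = - Y x * (p * w x)" "M2 x = X x * (p * w x)" using N1(2)[of x] N2(2)[of x] that by auto
    have "W x = (X x * (p * w x) * X x + Y x * (p * w x) * Y x) / p"
      unfolding W_def M by simp
    also have "\<dots> = p * w x * ((X x)\<^sup>2 + (Y x)\<^sup>2) / p" by (simp add: power2_eq_square algebra_simps)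
    also have "\<dots> = w x" using XY[of x] that p by simp
    finally show ?thesis .
  qed
  have k_eq: "k x = \<kappa> x" if "x \<in> {0<..<L} - (N1 \<union> N2)" for x
    unfolding k_def W_eq[OF that] w_def using sgn_abs_powr_inverse[of "p - 1" "\<kappa> x"] p by simp
  then have k\<kappa>: "AE x in lebesgue_on {0<..<L}. k x = \<kappa> x" using N by (rule AE_lebesgue_on_IooI[rotated])
  have A12: "AE x in lebesgue_on {0<..<L}. A1 x = - k x * Y x \<and> A2 x = k x * X x"
    using orthogonal k\<kappa> by eventually_elim simp
  \<comment> \<open>Once the derivative is replaced almost everywhere by a continuous function,
    absolute continuity becomes classical differentiability up to the end points.\<close>
  have X': "AC_on 0 L X (\<lambda>x. - k x * Y x)"
    by (rule AC_on_cong_AE[OF X_AC]) (use A12 in eventually_elim, simp)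
  have Y': "AC_on 0 L Y (\<lambda>x. k x * X x)"
    by (rule AC_on_cong_AE[OF Y_AC]) (use A12 in eventually_elim, simp)
  have X'': "(X has_real_derivative - k x * Y x) (at x within {0..L})" if "x \<in> {0..L}" for x
    unfolding has_real_derivative_iff_has_vector_derivative
    by (rule AC_on_has_vector_derivative[OF X' _ that]) (intro continuous_intros k_cont Y_cont)
  have Y'': "(Y has_real_derivative k x * X x) (at x within {0..L})" if "x \<in> {0..L}" for x
    unfolding has_real_derivative_iff_has_vector_derivative
    by (rule AC_on_has_vector_derivative[OF Y' _ that]) (intro continuous_intros k_cont X_cont)
  define B where "B x = (1 - 2 * p) * \<bar>k x\<bar> powr p + l" for x
  have B_cont: "continuous_on {0..L} B"
    unfolding B_def[abs_def] using p by (intro continuous_intros continuous_on_powr' k_cont) auto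
  have B\<beta>: "AE x in lebesgue_on {0<..<L}. \<beta> x = B x"
    using k\<kappa> by eventually_elim (simp add: \<beta>_def B_def)
  have M1': "(M1 has_real_derivative X x * B x + c1) (at x within {0..L})" if "x \<in> {0..L}" for x
    unfolding has_real_derivative_iff_has_vector_derivative
  proof (rule AC_on_has_vector_derivative[OF AC_on_cong_AE[OF M1(1)] _ that])
    show "AE x in lebesgue_on {0<..<L}. X x * \<beta> x + c1 = X x * B x + c1" using B\<beta> by eventually_elim simp
  qed (intro continuous_intros B_cont X_cont)
  have M2': "(M2 has_real_derivative Y x * B x + c2) (at x within {0..L})" if "x \<in> {0..L}" for x
    unfolding has_real_derivative_iff_has_vector_derivative
  proof (rule AC_on_has_vector_derivative[OF AC_on_cong_AE[OF M2(1)] _ that])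
    show "AE x in lebesgue_on {0<..<L}. Y x * \<beta> x + c2 = Y x * B x + c2" using B\<beta> by eventually_elim simp
  qed (intro continuous_intros B_cont Y_cont)
  have M1_eq: "M1 x = - Y x * (p * W x)" if "x \<in> {0..L}" for x
  proof (rule continuous_AE_eq_imp_eq[OF L AC_on_continuous[OF M1(1)] _ _ that])
    show "AE x in lebesgue_on {0<..<L}. M1 x = - Y x * (p * W x)"
      by (rule AE_lebesgue_on_IooI[OF N]) (use N1(2) W_eq in auto)
  qed (intro continuous_intros W_cont Y_cont)
  have M2_eq: "M2 x = X x * (p * W x)" if "x \<in> {0..L}" for x
  proof (rule continuous_AE_eq_imp_eq[OF L AC_on_continuous[OF M2(1)] _ _ that])
    show "AE x in lebesgue_on {0<..<L}. M2 x = X x * (p * W x)"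
      by (rule AE_lebesgue_on_IooI[OF N]) (use N2(2) W_eq in auto)
  qed (intro continuous_intros W_cont X_cont)
  have kW: "k x * W x = \<bar>k x\<bar> powr p" for x
  proof (cases "k x = 0")
    case False
    have "k x * W x = \<bar>k x\<bar> powr (p - 1) * \<bar>k x\<bar>" unfolding Wk[symmetric] by (simp add: abs_sgn mult_ac)
    also have "\<dots> = \<bar>k x\<bar> powr p" using False by (simp add: powr_diff)
    finally show ?thesis .
  qed simp
  have "elastica_system p L l c1 c2 k X Y"
  proof (unfold_locales)
    fix x assume x: "x \<in> {0..L}"
    note XYx = XY[OF x, unfolded power2_eq_square]
    show "((\<lambda>x. sgn (k x) * \<bar>k x\<bar> powr (p - 1)) has_real_derivative (c2 * X x - c1 * Y x) / p) (at x within {0..L})"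
    proof -
      \<comment> \<open>\<open>M' = B T + C\<close> has normal component
        \<open>C \<bullet> N\<close>, and
        \<open>M \<bullet> N' = - k (M \<bullet> T) = 0\<close>.\<close>
      have "((\<lambda>x. M2 x * X x - M1 x * Y x) has_real_derivative
          (M2 x * (- k x * Y x) + (Y x * B x + c2) * X x) - (M1 x * (k x * X x) + (X x * B x + c1) * Y x)) (at x within {0..L})"
        by (intro DERIV_diff DERIV_mult' M1' M2' X'' Y'' x)
      also have "(M2 x * (- k x * Y x) + (Y x * B x + c2) * X x) - (M1 x * (k x * X x) + (X x * B x + c1) * Y x) = c2 * X x - c1 * Y x"
        unfolding M1_eq[OF x] M2_eq[OF x] by (simp add: algebra_simps)
      finally show ?thesis unfolding Wk W_def[abs_def] by (rule DERIV_cdivide)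
    qed
    show "(p - 1) * \<bar>k x\<bar> powr p = l + c1 * X x + c2 * Y x"
    proof -
      \<comment> \<open>\<open>M\<close> is normal, so \<open>M \<bullet> T\<close> vanishes
        identically; its derivative is also \<open>k (M \<bullet> N) + B + C \<bullet> T\<close>,
        with \<open>M \<bullet> N = p W\<close>.\<close>
      have "((\<lambda>x. M1 x * X x + M2 x * Y x) has_real_derivative
          (M1 x * (- k x * Y x) + (X x * B x + c1) * X x) + (M2 x * (k x * X x) + (Y x * B x + c2) * Y x)) (at x within {0..L})"
        by (intro DERIV_add DERIV_mult' M1' M2' X'' Y'' x)
      moreover have "((\<lambda>x. M1 x * X x + M2 x * Y x) has_real_derivative 0) (at x within {0..L})"
        by (rule has_field_derivative_transform_within[OF DERIV_const[of 0], of 1])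
          (use x M1_eq M2_eq in \<open>auto simp: algebra_simps\<close>)
      ultimately have "(M1 x * (- k x * Y x) + (X x * B x + c1) * X x) + (M2 x * (k x * X x) + (Y x * B x + c2) * Y x) = 0"
        using vector_derivative_unique_within_closed_interval[of 0 L x] L x
        by (simp add: has_real_derivative_iff_has_vector_derivative)
      moreover have "(M1 x * (- k x * Y x) + (X x * B x + c1) * X x) + (M2 x * (k x * X x) + (Y x * B x + c2) * Y x) =
          (p * (k x * W x) + B x) * (X x * X x + Y x * Y x) + c1 * X x + c2 * Y x"
        unfolding M1_eq[OF x] M2_eq[OF x] by (simp add: algebra_simps)
      ultimately have "p * \<bar>k x\<bar> powr p + B x + c1 * X x + c2 * Y x = 0" unfolding XYx kW by simp
      then show ?thesis by (simp add: B_def algebra_simps)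
    qed
  qed (use p L k_cont X'' Y'' XY in auto)
  then show ?thesis using k\<kappa> A12 by (rule that)
qed

definition \<Gamma> :: "real \<Rightarrow> complex" where "\<Gamma> x = Complex (\<gamma> x $ 1) (\<gamma> x $ 2)"

lemma \<gamma>_deriv: "x \<in> {0..L} \<Longrightarrow> (\<gamma> has_vector_derivative T x) (at x within {0..L})"
  by (rule AC_on_has_vector_derivative[OF \<gamma> AC_on_continuous[OF T]])

lemma \<Gamma>_deriv: "x \<in> {0..L} \<Longrightarrow> (\<Gamma> has_vector_derivative Complex (X x) (Y x)) (at x within {0..L})"
proof -
  assume x: "x \<in> {0..L}"
  have "bounded_linear (\<lambda>v::real^2. Complex (v $ 1) (v $ 2))"
    unfolding linear_conv_bounded_linear[symmetric] by (rule linearI) (simp_all add: complex_eq_iff)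
  from bounded_linear.has_vector_derivative[OF this \<gamma>_deriv[OF x]] show ?thesis
    by (simp add: \<Gamma>_def[abs_def] X_def Y_def)
qed

lemma analytic_from_complex:
  assumes "(\<lambda>n. c n * of_real r ^ n) sums \<Gamma> x"
  shows "(\<lambda>n. r ^ n *\<^sub>R (Re (c n) *\<^sub>R axis 1 1 + Im (c n) *\<^sub>R axis 2 1)) sums \<gamma> x"
proof -
  define V :: "complex \<Rightarrow> real^2" where "V z = Re z *\<^sub>R axis 1 1 + Im z *\<^sub>R axis 2 1" for z
  have V: "bounded_linear V"
    unfolding linear_conv_bounded_linear[symmetric] V_def[abs_def]
    by (rule linearI) (simp_all add: algebra_simps)
  have "(\<lambda>n. V (c n * of_real r ^ n)) sums V (\<Gamma> x)" by (rule bounded_linear.sums[OF V assms])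
  moreover have "V (c n * of_real r ^ n) = r ^ n *\<^sub>R V (c n)" for n
    by (simp add: V_def scaleR_add_right mult.commute flip: of_real_power)
  moreover have "V (\<Gamma> x) = \<gamma> x" unfolding V_def \<Gamma>_def using real2_eq_axis[of "\<gamma> x"] by simp
  ultimately show ?thesis by (simp add: V_def)
qed

text \<open>\<open>S\<close> is the second derivative \<open>k N\<close> and \<open>R\<close> the
  weak third derivative \<open>k' N - k\<^sup>2 T\<close>; the latter is integrable because
  \<open>k\<close> is absolutely continuous and the frame is C^1.\<close>

lemma regularity:
  assumes es: "elastica_system p L l c1 c2 k X Y"
    and A12: "AE x in lebesgue_on {0<..<L}. A1 x = - k x * Y x \<and> A2 x = k x * X x"
  shows "sobolev 0 L 3 1 \<gamma>" and "Ck_on 2 {0..L} \<gamma>"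
    and "real_analytic_on \<gamma> ({0..L} - top_of_set {0..L} frontier_of {s \<in> {0..L}. k s = 0})"
proof -
  interpret ES: elastica_system p L l c1 c2 k X Y by (rule es)
  define S where "S x = (- Y x *\<^sub>R k x) *\<^sub>R axis 1 1 + (X x *\<^sub>R k x) *\<^sub>R (axis 2 1 :: real^2)" for x
  define R where "R x = (- (k x * X x) *\<^sub>R k x + - Y x *\<^sub>R ES.k' x) *\<^sub>R axis 1 1
    + ((- k x * Y x) *\<^sub>R k x + X x *\<^sub>R ES.k' x) *\<^sub>R (axis 2 1 :: real^2)" for x
  have TS: "AC_on 0 L T S"
  proof (rule AC_on_cong_AE[OF T])
    show "AE x in lebesgue_on {0<..<L}. A x = S x"
      using A12
    proof eventually_elim
      case (elim x)
      then show ?case using real2_eq_axis[of "A x"] unfolding A1_def A2_def S_def by (simp add: mult_ac)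
    qed
  qed
  have SR: "AC_on 0 L S R"
    unfolding S_def[abs_def] R_def[abs_def]
  proof (intro AC_on_add)
    note [continuous_intros] = ES.k_cont ES.X_cont ES.Y_cont
    show "AC_on 0 L (\<lambda>x. (- Y x *\<^sub>R k x) *\<^sub>R axis 1 1) (\<lambda>x. (- (k x * X x) *\<^sub>R k x + - Y x *\<^sub>R ES.k' x) *\<^sub>R (axis 1 1 :: real^2))"
    proof (rule AC_on_bounded_linear[OF AC_on_scaleR[OF _ _ ES.AC_on_k] bounded_linear_scaleR_left])
      show "((\<lambda>x. - Y x) has_vector_derivative - (k x * X x)) (at x within {0..L})" if "x \<in> {0..L}" for x
        using DERIV_minus[OF ES.Y_deriv[OF that]] by (simp add: has_real_derivative_iff_has_vector_derivative)
      show "continuous_on {0..L} (\<lambda>x. - (k x * X x))" by (intro continuous_intros)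
    qed
    show "AC_on 0 L (\<lambda>x. (X x *\<^sub>R k x) *\<^sub>R axis 2 1) (\<lambda>x. ((- k x * Y x) *\<^sub>R k x + X x *\<^sub>R ES.k' x) *\<^sub>R (axis 2 1 :: real^2))"
    proof (rule AC_on_bounded_linear[OF AC_on_scaleR[OF _ _ ES.AC_on_k] bounded_linear_scaleR_left])
      show "(X has_vector_derivative - k x * Y x) (at x within {0..L})" if "x \<in> {0..L}" for x
        using ES.X_deriv[OF that] by (simp add: has_real_derivative_iff_has_vector_derivative)
      show "continuous_on {0..L} (\<lambda>x. - k x * Y x)" by (intro continuous_intros)
    qed
  qed
  have L0: "0 \<le> L" using L by simp
  have R: "has_weak_derivative 0 L 0 R R" "Lp_fun 0 L 1 R"
    using AC_on_absolutely_integrable[OF SR]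
    by (auto intro: has_weak_derivative_0 absolutely_integrable_imp_locally Lp_fun_1)
  have lp: "Lp_fun 0 L 1 \<gamma>" "Lp_fun 0 L 1 T" "Lp_fun 0 L 1 S"
    by (intro Lp_fun_1 absolutely_integrable_continuous_real AC_on_continuous[OF \<gamma>] AC_on_continuous[OF T] AC_on_continuous[OF SR])+
  have w0: "has_weak_derivative 0 L 0 \<gamma> \<gamma>"
    by (intro has_weak_derivative_0 absolutely_integrable_imp_locally absolutely_integrable_continuous_real AC_on_continuous[OF \<gamma>])
  have w1: "has_weak_derivative 0 L (Suc 0) \<gamma> T" using has_weak_derivative_1[OF L0 \<gamma>] by simp
  have w2: "has_weak_derivative 0 L (Suc (Suc 0)) \<gamma> S"
    using has_weak_derivative_Suc[OF L0 \<gamma> has_weak_derivative_1[OF L0 TS]] by simp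
  have w3: "has_weak_derivative 0 L (Suc (Suc (Suc 0))) \<gamma> R"
    by (rule has_weak_derivative_Suc[OF L0 \<gamma> has_weak_derivative_Suc[OF L0 TS has_weak_derivative_Suc[OF L0 SR R(1)]]])
  have "\<exists>g. has_weak_derivative 0 L i \<gamma> g \<and> Lp_fun 0 L 1 g" if "i \<le> 3" for i
  proof -
    have "i = 0 \<or> i = Suc 0 \<or> i = Suc (Suc 0) \<or> i = Suc (Suc (Suc 0))" using that by linarith
    then show ?thesis using w0 w1 w2 w3 lp R(2) by (elim disjE) blast+
  qed
  with lp(1) show "sobolev 0 L 3 1 \<gamma>" by (simp add: sobolev_def)
  have S_cont: "continuous_on {0..L} S" by (rule AC_on_continuous[OF SR])
  have T_deriv: "(T has_vector_derivative S x) (at x within {0..L})" if "x \<in> {0..L}" for x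
    by (rule AC_on_has_vector_derivative[OF TS S_cont that])
  show "Ck_on 2 {0..L} \<gamma>"
    unfolding numeral_2_eq_2 Ck_on.simps using \<gamma>_deriv T_deriv S_cont by blast
  show "real_analytic_on \<gamma> ({0..L} - top_of_set {0..L} frontier_of {s \<in> {0..L}. k s = 0})"
    unfolding real_analytic_on_def
  proof
    fix x0 assume x0: "x0 \<in> {0..L} - top_of_set {0..L} frontier_of {s \<in> {0..L}. k s = 0}"
    have "\<exists>r>0. \<exists>c. \<forall>x\<in>{0..L}. \<bar>x - x0\<bar> < r \<longrightarrow> (\<lambda>n. c n * of_real (x - x0) ^ n) sums \<Gamma> x"
    proof (cases "k x0 = 0")
      case False
      with x0 show ?thesis by (intro ES.analytic_where_k_nonzero[OF \<Gamma>_deriv]) auto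
    next
      case True
      let ?Z = "{s \<in> {0..L}. k s = 0}"
      \<comment> \<open>A zero of \<open>k\<close> off the relative frontier lies in the relative
        interior, so \<open>k\<close> vanishes near it within \<open>{0..L}\<close> and the power
        series is an affine polynomial.\<close>
      have "x0 \<in> ?Z" using True x0 by simp
      moreover have "?Z \<subseteq> top_of_set {0..L} closure_of ?Z" by (rule closure_of_subset) auto
      ultimately have "x0 \<in> top_of_set {0..L} closure_of ?Z" by blast
      with x0 have "x0 \<in> top_of_set {0..L} interior_of ?Z" by (simp add: frontier_of_def)
      then obtain V where V: "openin (top_of_set {0..L}) V" "x0 \<in> V" "V \<subseteq> ?Z"
        by (auto simp: interior_of_def)
      then obtain U where U: "open U" "V = {0..L} \<inter> U" by (auto simp: openin_open)
      then obtain r where r: "r > 0" "ball x0 r \<subseteq> U" using V(2) open_contains_ball by blast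
      have kz: "k x = 0" if "x \<in> {0..L}" "\<bar>x - x0\<bar> < r" for x
      proof -
        have "x \<in> ball x0 r" using that(2) by (simp add: dist_real_def)
        then have "x \<in> V" using r(2) U(2) that(1) by blast
        then show ?thesis using V(3) by blast
      qed
      define c where "c n = (if n = 0 then \<Gamma> x0 else if n = 1 then Complex (X x0) (Y x0) else 0)" for n :: nat
      have "(\<lambda>n. c n * of_real (x - x0) ^ n) sums \<Gamma> x" if x: "x \<in> {0..L}" "\<bar>x - x0\<bar> < r" for x
      proof -
        have "(\<lambda>n. c n * of_real (x - x0) ^ n) sums (\<Sum>n\<in>{0, 1}. c n * of_real (x - x0) ^ n)"
          by (rule sums_finite) (auto simp: c_def)
        also have "(\<Sum>n\<in>{0, 1}. c n * of_real (x - x0) ^ n) = \<Gamma> x0 + of_real (x - x0) * Complex (X x0) (Y x0)"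
          by (simp add: c_def mult.commute)
        also have "\<dots> = \<Gamma> x"
          using ES.affine_where_k_zero[OF \<Gamma>_deriv _ r(1) kz x] x0 by simp
        finally show ?thesis .
      qed
      with r(1) show ?thesis by blast
    qed
    then obtain r c where rc: "r > 0" "\<And>x. x \<in> {0..L} \<Longrightarrow> \<bar>x - x0\<bar> < r \<Longrightarrow> (\<lambda>n. c n * of_real (x - x0) ^ n) sums \<Gamma> x"
      by blast
    show "\<exists>r>0. \<exists>c. \<forall>x\<in>{0..L} - top_of_set {0..L} frontier_of {s \<in> {0..L}. k s = 0}.
        \<bar>x - x0\<bar> < r \<longrightarrow> (\<lambda>n. (x - x0) ^ n *\<^sub>R c n) sums \<gamma> x"
      by (rule exI[of _ r], rule conjI[OF rc(1)], rule exI[of _ "\<lambda>n. Re (c n) *\<^sub>R axis 1 1 + Im (c n) *\<^sub>R axis 2 1"])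
        (use analytic_from_complex[OF rc(2)] in blast)
  qed
qed

end

theorem theorem1p7:
  fixes p L :: real and \<gamma> :: "real \<Rightarrow> real^2"
  assumes "1 < p" and "0 < L" and "arclength_p_elastica p L \<gamma>"
  shows "sobolev 0 L 3 1 \<gamma> \<and>
         Ck_on 2 {0..L} \<gamma> \<and>
         (\<exists>k. continuous_representative 0 L (signed_curvature 0 L \<gamma>) k \<and>
              real_analytic_on \<gamma>
                ({0..L} - top_of_set {0..L} frontier_of {s \<in> {0..L}. k s = 0}))"
proof -
  have pe: "p_elastica p 0 L \<gamma>" and unit: "\<And>s. s \<in> {0..L} \<Longrightarrow> norm (vector_derivative \<gamma> (at s within {0..L})) = 1"
    using assms(3) by (auto simp: arclength_p_elastica_def)
  have im: "continuous_on {0..L} \<gamma>" "sobolev 0 L 2 p \<gamma>"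
    using pe by (auto simp: p_elastica_def immersed_W2p_def)
  obtain T A where TA: "AC_on 0 L \<gamma> T" "AC_on 0 L T A" "Lp_fun 0 L p A"
    using sobolev_2_AC[OF assms(2) less_imp_le[OF assms(1)] im(2,1)] by blast
  \<comment> \<open>The hypothesis speaks of \<open>vector_derivative\<close>; uniqueness of
    derivatives within a nondegenerate closed interval identifies it with \<open>T\<close>.\<close>
  have "norm (T x) = 1" if x: "x \<in> {0..L}" for x
  proof -
    have "(\<gamma> has_vector_derivative T x) (at x within {0..L})"
      by (rule AC_on_has_vector_derivative[OF TA(1) AC_on_continuous[OF TA(2)] x])
    from vector_derivative_within_closed_interval[OF assms(2) x this] unit[OF x] show ?thesis by simp
  qed
  then interpret unit_speed_W2p p L \<gamma> T A
    using assms TA by unfold_locales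
  obtain l where l: "\<And>\<eta> :: real \<Rightarrow> real^2. test_function 0 L \<eta> \<Longrightarrow>
     ((\<lambda>\<epsilon>. bending_energy p 0 L (\<lambda>x. \<gamma> x + \<epsilon> *\<^sub>R \<eta> x) + l * curve_length 0 L (\<lambda>x. \<gamma> x + \<epsilon> *\<^sub>R \<eta> x))
         has_real_derivative 0) (at 0)"
    using pe unfolding p_elastica_def by blast
  \<comment> \<open>Variations \<open>\<phi> x *\<^sub>R e\<close> of fixed direction are enough for
    the vector equation, since two directions give its two components.\<close>
  obtain c1 c2 k where k: "elastica_system p L l c1 c2 k X Y"
    "AE x in lebesgue_on {0<..<L}. k x = \<kappa> x"
    "AE x in lebesgue_on {0<..<L}. A1 x = - k x * Y x \<and> A2 x = k x * X x"
    by (rule elastica_imp_system[OF l[OF test_function_scaleR]])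
  have "AE x in lebesgue_on {0<..<L}. k x = signed_curvature 0 L \<gamma> x"
    using k(2) signed_curvature_AE by eventually_elim simp
  then have "continuous_representative 0 L (signed_curvature 0 L \<gamma>) k"
    using elastica_system.k_cont[OF k(1)] by (simp add: continuous_representative_def)
  then show ?thesis using regularity[OF k(1,3)] by blast
qed

end
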